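(* Let $W$ be an irreducible Coxeter group with simple reflections indexed by $I$, let $\mathbf d=(d_i)_{i\in I}$ be integers with $d_i\geqslant 2$ for all $i$, and let $6\leqslant k\leqslant\infty$. The nil-Hecke $\Bbbk$-algebra $n\mathcal H(W,\mathbf d,J_{<k})$ is a finitely generated $\Bbbk$-module if and only if either $W$ is a finite Coxeter group with $\mathbf d=(2,\dots,2)$, or $W$ is of type $A_n$ for some $n\geqslant 1$ with $\mathbf d=(d,2,\dots,2)$ or $(2,\dots,2,d)$ for some $d>2$. In the first case, the nil-Hecke algebra has $\Bbbk$-rank equal to $|W|$ unless $W$ is of type $I_2(m)$, in which case $$\dim n\mathcal H(W,\mathbf d,J_{<k})=\begin{cases}2m & \text{if } m<k,\\ 2m-1&\text{if } m\geqslant k.\end{cases}$$ In the second case, the $\Bbbk$-rank is $n!\,(1+n(d-1))$.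
   Context: $\Bbbk$ is a fixed nonzero unital commutative ring. A Coxeter group $W$ has a finite nonempty index set $I$ of simple reflections and a Coxeter matrix $(m_{ij})_{i,j\in I}$ with $m_{ii}=1$ and $m_{ij}=m_{ji}\in\{2,3,\dots,\infty\}$ for $i\ne j$. Let $J$ be the set of unordered pairs $\{a,b\}\subset I$, $a\neq b$, with $m_{ab}<\infty$. For $j=\{a,b\}\in J$ let $\mathbf v_j=\mathbf s_a\mathbf s_b\mathbf s_a\cdots$ and $\mathbf w_j=\mathbf s_b\mathbf s_a\mathbf s_b\cdots$ be the two alternating words with $m_{ab}$ letters each; these are the two sides of the braid relation for $j$, whose length is $\ell(\mathbf v_j)=\ell(\mathbf w_j)=m_{ab}$. For $J_0\subset J$ and $\mathbf d=(d_i)_{i\in I}$ with integers $d_i\geqslant 2$, the nil-Hecke algebra $n\mathcal H(W,\mathbf d,J_0)$ is the associative unital $\Bbbk$-algebra generated by $\{\mathbf s_i:i\in I\}$ with relations $$\mathbf s_i^{d_i}=0\ (i\in I),\qquad \mathbf v_j=\mathbf w_j\ (j\in J_0),\qquad \mathbf v_j=0=\mathbf w_j\ (j\in J\setminus J_0).$$ For $k\geqslant 1$ put $J_{<k}=\{j\in J:\ell(\mathbf v_j)<k\}$, and $J_{<\infty}=J$. $W$ is irreducible if the graph on $I$ with $i,j$ adjacent iff $m_{ij}\geqslant 3$ is connected. Types refer to the standard classification of irreducible finite Coxeter groups; in type $A_n$ the nodes are numbered consecutively along the path and $\mathbf d$ is listed in this order; $I_2(m)$ is the dihedral group of order $2m$.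 The statement $\dim M=r$ (or "$\Bbbk$-rank $r$") means that $M$ is a free $\Bbbk$-module of rank $r$. *)

theory Defs
  imports
    "HOL-Algebra.Algebraic_Closure_Type"
    "HOL-Library.Poly_Mapping"
    "HOL-Library.Extended_Nat"
begin

section \<open>Coxeter matrices and Coxeter groups\<close>

text \<open>
  The finite nonempty index set of simple reflections is a type of class \<^class>\<open>finite\<close>.
\<close>

definition coxeter_matrix :: "('i \<Rightarrow> 'i \<Rightarrow> enat) \<Rightarrow> bool" where
  "coxeter_matrix M \<longleftrightarrow>
     (\<forall>i. M i i = 1) \<and> (\<forall>i j. M i j = M j i) \<and> (\<forall>i j. i \<noteq> j \<longrightarrow> 2 \<le> M i j)"

text \<open>
  The Coxeter group is given by its presentation
  $\langle s_i \mid (s_i s_j)^{m_{ij}} = 1 \text{ if } m_{ij} < \infty\rangle$.  The relations for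
  $i = j$ read $s_i^2 = 1$, so every generator is its own inverse and the group is already the
  quotient of the free monoid of words by the congruence generated by the relations.
\<close>

inductive cox_eq :: "('i \<Rightarrow> 'i \<Rightarrow> enat) \<Rightarrow> 'i list \<Rightarrow> 'i list \<Rightarrow> bool" for M where
  relator: "M i j = enat n \<Longrightarrow> cox_eq M (concat (replicate n [i, j])) []"
| refl: "cox_eq M u u"
| sym: "cox_eq M u v \<Longrightarrow> cox_eq M v u"
| trans: "cox_eq M u v \<Longrightarrow> cox_eq M v w \<Longrightarrow> cox_eq M u w"
| append: "cox_eq M u v \<Longrightarrow> cox_eq M u' v' \<Longrightarrow> cox_eq M (u @ u') (v @ v')"

definition coxeter_group :: "('i \<Rightarrow> 'i \<Rightarrow> enat) \<Rightarrow> 'i list set monoid" where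
  "coxeter_group M =
     \<lparr>carrier = UNIV // {(u, v). cox_eq M u v},
      monoid.mult = (\<lambda>A B. {w. \<exists>a\<in>A. \<exists>b\<in>B. cox_eq M (a @ b) w}),
      monoid.one = {w. cox_eq M [] w}\<rparr>"

definition coxeter_irreducible :: "('i \<Rightarrow> 'i \<Rightarrow> enat) \<Rightarrow> bool" where
  "coxeter_irreducible M \<longleftrightarrow> (\<forall>i j. (\<lambda>a b. a \<noteq> b \<and> 3 \<le> M a b)\<^sup>*\<^sup>* i j)"

text \<open>
  A numbering of the nodes, by \<open>1, \<dots>, n\<close> consecutively along the path, that exhibits \<open>M\<close> as the
  Coxeter matrix of type $A_n$.
\<close>

definition type_A_numbering :: "('i \<Rightarrow> 'i \<Rightarrow> enat) \<Rightarrow> nat \<Rightarrow> (nat \<Rightarrow> 'i) \<Rightarrow> bool" where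
  "type_A_numbering M n f \<longleftrightarrow>
     n \<ge> 1 \<and> bij_betw f {1..n} UNIV \<and>
     (\<forall>p\<in>{1..n}. \<forall>q\<in>{1..n}.
        M (f p) (f q) = (if p = q then 1 else if p = q + 1 \<or> q = p + 1 then 3 else 2))"

text \<open>Type $A_n$ with \<open>d = (e, 2, \<dots>, 2)\<close> or \<open>d = (2, \<dots>, 2, e)\<close> along the path.\<close>

definition type_A_end_exponent ::
    "('i \<Rightarrow> 'i \<Rightarrow> enat) \<Rightarrow> ('i \<Rightarrow> nat) \<Rightarrow> nat \<Rightarrow> nat \<Rightarrow> bool" where
  "type_A_end_exponent M d n e \<longleftrightarrow>
     (\<exists>f. type_A_numbering M n f \<and>
        ((\<forall>p\<in>{1..n}. d (f p) = (if p = 1 then e else 2)) \<or>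
         (\<forall>p\<in>{1..n}. d (f p) = (if p = n then e else 2))))"

text \<open>In particular, \<open>m\<close> is finite.\<close>

definition type_I2 :: "('i \<Rightarrow> 'i \<Rightarrow> enat) \<Rightarrow> nat \<Rightarrow> bool" where
  "type_I2 M m \<longleftrightarrow> (\<exists>a b. a \<noteq> b \<and> UNIV = {a, b} \<and> M a b = enat m)"

section \<open>Free associative algebras\<close>

text \<open>
  The elements of the free monoid; its algebra, the free associative algebra \<open>'k\<langle>s\<^sub>i : i \<in> 'i\<rangle>\<close>, is
  the ring of finitely supported functions \<open>'i word \<Rightarrow>\<^sub>0 'k\<close> with the convolution product.
\<close>

datatype 'i word = Word (letters: "'i list")

instantiation word :: (type) monoid_add
begin
definition zero_word :: "'a word" where "0 = Word []"
definition plus_word :: "'a word \<Rightarrow> 'a word \<Rightarrow> 'a word" where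
  "u + v = Word (letters u @ letters v)"
instance
  by standard (auto simp: zero_word_def plus_word_def)
end

definition gen :: "'i \<Rightarrow> ('i word \<Rightarrow>\<^sub>0 'k::comm_ring_1)" where
  "gen i = Poly_Mapping.single (Word [i]) 1"

text \<open>
  The quotient of the free algebra by the two-sided ideal generated by \<open>rels\<close>, as a
  \<open>'k\<close>-algebra; scalars act on cosets through representatives.
\<close>

definition presented_algebra ::
    "('i word \<Rightarrow>\<^sub>0 'k::comm_ring_1) set \<Rightarrow> ('k, ('i word \<Rightarrow>\<^sub>0 'k) set) module" where
  "presented_algebra rels =
     (let F = ring_of_type_algebra :: ('i word \<Rightarrow>\<^sub>0 'k) ring;
          N = genideal F rels
      in ring.extend (F Quot N)
           (module.fields (\<lambda>c A. \<Union>p\<in>A. N +>\<^bsub>F\<^esub> (Poly_Mapping.single 0 c * p))))"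

section \<open>Nil-Hecke algebras\<close>

fun alternating :: "'i \<Rightarrow> 'i \<Rightarrow> nat \<Rightarrow> 'i list" where
  "alternating a b 0 = []"
| "alternating a b (Suc n) = a # alternating b a n"

definition braid_side ::
    "('i \<Rightarrow> 'i \<Rightarrow> enat) \<Rightarrow> 'i \<Rightarrow> 'i \<Rightarrow> ('i word \<Rightarrow>\<^sub>0 'k::comm_ring_1)" where
  "braid_side M a b = prod_list (map gen (alternating a b (the_enat (M a b))))"

definition braid_pairs :: "('i \<Rightarrow> 'i \<Rightarrow> enat) \<Rightarrow> 'i set set" where
  "braid_pairs M = {{a, b} |a b. a \<noteq> b \<and> M a b < \<infinity>}"

definition braid_pairs_less :: "('i \<Rightarrow> 'i \<Rightarrow> enat) \<Rightarrow> enat \<Rightarrow> 'i set set" where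
  "braid_pairs_less M k = {{a, b} |a b. a \<noteq> b \<and> M a b < \<infinity> \<and> M a b < k}"

definition nil_Hecke_relations ::
    "('i \<Rightarrow> 'i \<Rightarrow> enat) \<Rightarrow> ('i \<Rightarrow> nat) \<Rightarrow> 'i set set \<Rightarrow> ('i word \<Rightarrow>\<^sub>0 'k::comm_ring_1) set" where
  "nil_Hecke_relations M d J0 =
     {gen i ^ d i |i. True} \<union>
     {braid_side M a b - braid_side M b a |a b. a \<noteq> b \<and> {a, b} \<in> J0} \<union>
     {braid_side M a b |a b. a \<noteq> b \<and> {a, b} \<in> braid_pairs M - J0}"

definition nil_Hecke ::
    "'k::comm_ring_1 itself \<Rightarrow> ('i \<Rightarrow> 'i \<Rightarrow> enat) \<Rightarrow> ('i \<Rightarrow> nat) \<Rightarrow> 'i set set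
      \<Rightarrow> ('k, ('i word \<Rightarrow>\<^sub>0 'k) set) module" where
  "nil_Hecke _ M d J0 = presented_algebra (nil_Hecke_relations M d J0)"

section \<open>Finitely generated and free modules\<close>

definition fin_gen_module :: "('k, 'r) ring_scheme \<Rightarrow> ('k, 'a, 's) module_scheme \<Rightarrow> bool" where
  "fin_gen_module K V \<longleftrightarrow>
     (\<exists>S. finite S \<and> S \<subseteq> carrier V \<and>
       (\<forall>x\<in>carrier V. \<exists>c\<in>S \<rightarrow> carrier K. x = (\<Oplus>\<^bsub>V\<^esub>b\<in>S. c b \<odot>\<^bsub>V\<^esub> b)))"

text \<open>
  A basis: every element is a unique linear combination.  Coefficient families are extensional so
  that uniqueness concerns their values on the basis only.
\<close>

definition free_module_of_rank ::
    "('k, 'r) ring_scheme \<Rightarrow> ('k, 'a, 's) module_scheme \<Rightarrow> nat \<Rightarrow> bool" where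
  "free_module_of_rank K V r \<longleftrightarrow>
     (\<exists>B. finite B \<and> card B = r \<and> B \<subseteq> carrier V \<and>
       (\<forall>x\<in>carrier V. \<exists>!c. c \<in> B \<rightarrow>\<^sub>E carrier K \<and> x = (\<Oplus>\<^bsub>V\<^esub>b\<in>B. c b \<odot>\<^bsub>V\<^esub> b)))"

end

theory Submission
  imports Defs
begin

text \<open>
  Every defining relation of the algebra equates two words or kills a word.  Call a word vanishing if
  braid moves lead to a word with a killed factor.  The classes of the other words under braid moves
  form a basis of the algebra: they span it, and they are linearly independent, because a linear
  functional that is constant on classes and zero on vanishing words factors through the quotient
  (\<open>free_on_nonzero_classes\<close>, \<open>finitely_generated_imp_finite_classes\<close>).  So the algebra is finitely
  generated if and only if there are finitely many nonzero classes, and its rank is their number.  That a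
  word does not vanish is shown by a partial action of the letters on a set of states which satisfies the
  relations and in which the word can be read (\<open>run_vanishing\<close>); if the states are matched by normal forms,
  they count the classes (\<open>bij_betw_nonzero_classes\<close>).

  Suppose first that all exponents are 2.  If every finite bond is less than \<open>k\<close>, all braid relations are
  imposed.  By Matsumoto's theorem the words that do not vanish are the reduced words of the Coxeter group,
  and two of them are equivalent if and only if they represent the same element, so the nonzero classes are
  the group elements (\<open>classes_bij_coxeter_group\<close>).  If some finite bond is at least \<open>k\<close>, hence at least 6,
  and there is a third node, then an infinite periodic word without long alternating factors shows
  that both the classes and the group are infinite (\<open>infinite_classes_heavy_bond\<close>).  There remains the
  dihedral group, where the classes can be listed (\<open>card_classes_dihedral\<close>).

  Suppose now that the exponent at \<open>a\<close> is greater than 2. Follow the diagram from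
  \<open>a\<close>. At a second node with a large exponent, at a bond of at least 4, or at two
  commuting further neighbours, an infinite word can turn round and walk back to \<open>a\<close>,
  where the exponent permits it to turn again by \<open>a a\<close>; no relation ever applies to it
  except for the commutation of two letters (\<open>infinite_classes_bounce\<close>). Two further
  neighbours that do not commute belong to a triangle, round which an infinite word can run. If there is
  no such obstacle, the diagram is a path with end \<open>a\<close> and simple bonds
  (\<open>finite_classes_imp_type_A\<close>). In this case, with the nodes numbered from
  \<open>a\<close>, the normal forms are $w$ and $w\, s_1^k\, s_2 s_3 \cdots s_m$ with
  \<open>1 \<le> k < e\<close> and \<open>1 \<le> m \<le> n\<close>, where $w$ is one of the
  \<open>n!\<close> normal forms in $s_2, \dots, s_n$ (\<open>card_classes_type_A\<close>).
\<close>

section \<open>Algebras presented by binomials and monomials\<close>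

inductive word_cong :: "('i list \<times> 'i list) set \<Rightarrow> 'i list \<Rightarrow> 'i list \<Rightarrow> bool" for R where
  relation: "(u, v) \<in> R \<Longrightarrow> word_cong R u v"
| refl: "word_cong R u u"
| sym: "word_cong R u v \<Longrightarrow> word_cong R v u"
| trans: "word_cong R u v \<Longrightarrow> word_cong R v w \<Longrightarrow> word_cong R u w"
| append: "word_cong R u v \<Longrightarrow> word_cong R u' v' \<Longrightarrow> word_cong R (u @ u') (v @ v')"

definition vanishing :: "('i list \<times> 'i list) set \<Rightarrow> 'i list set \<Rightarrow> 'i list \<Rightarrow> bool" where
  "vanishing R Z u \<longleftrightarrow> (\<exists>x z y. z \<in> Z \<and> word_cong R u (x @ z @ y))"

definition nonzero_classes :: "('i list \<times> 'i list) set \<Rightarrow> 'i list set \<Rightarrow> 'i list set set" where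
  "nonzero_classes R Z = {u. \<not> vanishing R Z u} // {(u, v). word_cong R u v}"

definition word_elem :: "'i list \<Rightarrow> ('i word \<Rightarrow>\<^sub>0 'k::comm_ring_1)" where
  "word_elem u = Poly_Mapping.single (Word u) 1"

definition monomial_relations ::
    "('i list \<times> 'i list) set \<Rightarrow> 'i list set \<Rightarrow> ('i word \<Rightarrow>\<^sub>0 'k::comm_ring_1) set" where
  "monomial_relations R Z = {word_elem u - word_elem v |u v. (u, v) \<in> R} \<union> {word_elem z |z. z \<in> Z}"

lemma word_cong_context: "word_cong R u v \<Longrightarrow> word_cong R (x @ u @ y) (x @ v @ y)"
  by (intro word_cong.append word_cong.refl)

lemma vanishing_cong:
  assumes "word_cong R u v"
  shows "vanishing R Z u \<longleftrightarrow> vanishing R Z v"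
  unfolding vanishing_def using assms by (meson word_cong.sym word_cong.trans)

lemma vanishing_context:
  assumes "vanishing R Z u"
  shows "vanishing R Z (x @ u @ y)"
proof -
  obtain p z q where "z \<in> Z" "word_cong R u (p @ z @ q)"
    using assms by (auto simp: vanishing_def)
  then have "word_cong R (x @ u @ y) ((x @ p) @ z @ (q @ y))"
    using word_cong_context[of R u "p @ z @ q" x y] by simp
  with \<open>z \<in> Z\<close> show ?thesis
    unfolding vanishing_def by blast
qed

lemma vanishing_factor: "z \<in> Z \<Longrightarrow> vanishing R Z (x @ z @ y)"
  unfolding vanishing_def using word_cong.refl by blast

lemma word_cong_map:
  assumes "\<And>u v. (u, v) \<in> R \<Longrightarrow> word_cong R' (map h u) (map h v)" "word_cong R u v"
  shows "word_cong R' (map h u) (map h v)"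
  using assms(2)
  by (induction rule: word_cong.induct) (auto intro: assms(1) word_cong.intros(2-))

lemma vanishing_map:
  assumes "\<And>u v. (u, v) \<in> R \<Longrightarrow> word_cong R' (map h u) (map h v)"
    and "\<And>z. z \<in> Z \<Longrightarrow> vanishing R' Z' (map h z)" and "vanishing R Z u"
  shows "vanishing R' Z' (map h u)"
proof -
  obtain x z y where z: "z \<in> Z" "word_cong R u (x @ z @ y)"
    using assms(3) by (auto simp: vanishing_def)
  have "word_cong R' (map h u) (map h (x @ z @ y))"
    by (rule word_cong_map[OF assms(1) z(2)])
  moreover have "vanishing R' Z' (map h (x @ z @ y))"
    using vanishing_context[OF assms(2)[OF z(1)]] by simp
  ultimately show ?thesis using vanishing_cong by blast
qed

lemma equiv_word_cong: "equiv UNIV {(u, v). word_cong R u v}"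
  by (rule equivI) (auto simp: refl_on_def sym_def trans_def intro: word_cong.intros)

definition linear_extension :: "('i list \<Rightarrow> 'k) \<Rightarrow> ('i word \<Rightarrow>\<^sub>0 'k::comm_ring_1) \<Rightarrow> 'k" where
  "linear_extension h p =
     (\<Sum>u\<in>Poly_Mapping.keys p. Poly_Mapping.lookup p u * h (letters u))"

lemma linear_extension_superset:
  assumes "finite A" "Poly_Mapping.keys p \<subseteq> A"
  shows "linear_extension h p = (\<Sum>u\<in>A. Poly_Mapping.lookup p u * h (letters u))"
  unfolding linear_extension_def
  by (rule sum.mono_neutral_left) (use assms in \<open>auto simp: in_keys_iff\<close>)

lemma linear_extension_add: "linear_extension h (p + q) = linear_extension h p + linear_extension h q"
proof -
  let ?A = "Poly_Mapping.keys p \<union> Poly_Mapping.keys q \<union> Poly_Mapping.keys (p + q)"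
  show ?thesis
    by (subst (1 2 3) linear_extension_superset[of ?A])
       (auto simp: lookup_add distrib_right sum.distrib)
qed

lemma linear_extension_uminus: "linear_extension h (- p) = - linear_extension h p"
proof -
  let ?A = "Poly_Mapping.keys p \<union> Poly_Mapping.keys (- p)"
  show ?thesis
    by (subst (1 2) linear_extension_superset[of ?A]) (auto simp: sum_negf)
qed

lemma linear_extension_diff: "linear_extension h (p - q) = linear_extension h p - linear_extension h q"
  using linear_extension_add[of h p "- q"] by (simp add: linear_extension_uminus)

lemma linear_extension_0 [simp]: "linear_extension h 0 = 0"
  by (simp add: linear_extension_def)

lemma linear_extension_single [simp]: "linear_extension h (Poly_Mapping.single u c) = c * h (letters u)"
  by (subst linear_extension_superset[of "{u}"]) auto

lemma linear_extension_sum: "linear_extension h (\<Sum>i\<in>A. f i) = (\<Sum>i\<in>A. linear_extension h (f i))"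
  by (induction A rule: infinite_finite_induct) (auto simp: linear_extension_add)

lemma poly_mapping_eq_sum_singles:
  "p = (\<Sum>u\<in>Poly_Mapping.keys p. Poly_Mapping.single u (Poly_Mapping.lookup p u))"
  by (rule poly_mapping_eqI)
     (auto simp: lookup_sum lookup_single when_def not_in_keys_iff_lookup_eq_zero sum.delta')

lemma poly_mapping_additive_induct [case_names single add]:
  fixes p :: "'a \<Rightarrow>\<^sub>0 'b::comm_monoid_add"
  assumes single: "\<And>u c. P (Poly_Mapping.single u c)"
    and add: "\<And>p q. P p \<Longrightarrow> P q \<Longrightarrow> P (p + q)"
  shows "P p"
proof -
  have "P (\<Sum>u\<in>A. Poly_Mapping.single u (Poly_Mapping.lookup p u))" if "finite A" for A
    using that
  proof induction
    case empty
    show ?case using single[of undefined 0] by simp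
  qed (auto intro: single add)
  then show ?thesis
    using poly_mapping_eq_sum_singles[of p] by (metis finite_keys)
qed

lemma linear_extension_single_mult:
  "linear_extension h (Poly_Mapping.single a c * p) = c * linear_extension (\<lambda>u. h (letters a @ u)) p"
  by (induction p rule: poly_mapping_additive_induct)
     (auto simp: mult_single distrib_left linear_extension_add plus_word_def algebra_simps)

lemma linear_extension_scale:
  "linear_extension h (Poly_Mapping.single 0 c * p) = c * linear_extension h p"
  by (simp add: linear_extension_single_mult zero_word_def)

lemma linear_extension_mult_single:
  "linear_extension h (p * Poly_Mapping.single a c) = c * linear_extension (\<lambda>u. h (u @ letters a)) p"
  by (induction p rule: poly_mapping_additive_induct)
     (auto simp: mult_single distrib_right linear_extension_add plus_word_def algebra_simps)

text \<open>
  The functions on words whose linear extensions descend to the algebra presented by \<open>R\<close> and \<open>Z\<close>.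
\<close>

definition compatible :: "('i list \<times> 'i list) set \<Rightarrow> 'i list set \<Rightarrow> ('i list \<Rightarrow> 'k::zero) \<Rightarrow> bool" where
  "compatible R Z h \<longleftrightarrow>
     (\<forall>u v. word_cong R u v \<longrightarrow> h u = h v) \<and> (\<forall>u. vanishing R Z u \<longrightarrow> h u = 0)"

lemma compatible_translate:
  assumes "compatible R Z h"
  shows "compatible R Z (\<lambda>u. h (x @ u))" "compatible R Z (\<lambda>u. h (u @ y))"
proof -
  have h: "\<And>u v. word_cong R u v \<Longrightarrow> h u = h v" "\<And>u. vanishing R Z u \<Longrightarrow> h u = 0"
    using assms by (auto simp: compatible_def)
  show "compatible R Z (\<lambda>u. h (x @ u))"
    unfolding compatible_def
    using h(1)[OF word_cong_context[of R _ _ x "[]"]] h(2)[OF vanishing_context[of R Z _ x "[]"]]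
    by simp
  show "compatible R Z (\<lambda>u. h (u @ y))"
    unfolding compatible_def
    using h(1)[OF word_cong_context[of R _ _ "[]" y]] h(2)[OF vanishing_context[of R Z _ "[]" y]]
    by simp
qed

lemma ring_of_type_algebra_simps:
  "carrier ring_of_type_algebra = UNIV"
  "x \<otimes>\<^bsub>ring_of_type_algebra\<^esub> y = x * y"
  "\<one>\<^bsub>ring_of_type_algebra\<^esub> = 1"
  "\<zero>\<^bsub>ring_of_type_algebra\<^esub> = 0"
  "x \<oplus>\<^bsub>ring_of_type_algebra\<^esub> y = x + y"
  by (simp_all add: ring_of_type_algebra_def)

lemma ring_ring_of_type_algebra: "ring (ring_of_type_algebra :: 'a::ring_1 ring)"
proof -
  have "\<exists>y. x + y = 0" for x :: 'a
    using add.right_inverse by blast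
  then show ?thesis
    unfolding ring_of_type_algebra_def using add.right_inverse
    by unfold_locales (auto simp: algebra_simps Units_def)
qed

lemma a_minus_ring_of_type_algebra:
  fixes x y :: "'a::ring_1"
  shows "x \<ominus>\<^bsub>ring_of_type_algebra\<^esub> y = x - y"
proof -
  interpret ring "ring_of_type_algebra :: 'a ring" by (rule ring_ring_of_type_algebra)
  have "\<ominus>\<^bsub>ring_of_type_algebra\<^esub> y = - y"
    by (rule minus_equality) (auto simp: ring_of_type_algebra_simps)
  then show ?thesis
    by (simp add: a_minus_def ring_of_type_algebra_simps)
qed

text \<open>
  Shifting a compatible function by a word on either side keeps it compatible, and pairing with the
  shifted function is pairing with a product.  So the common kernel absorbs products; as it contains
  the relations, it will contain the ideal that they generate, which bounds that ideal from above.
\<close>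

lemma compatible_kernel_ideal:
  "ideal {p. \<forall>h. compatible R Z h \<longrightarrow> linear_extension h p = 0}
     (ring_of_type_algebra :: ('i word \<Rightarrow>\<^sub>0 'k::comm_ring_1) ring)" (is "ideal ?K ?F")
proof -
  interpret F: ring ?F by (rule ring_ring_of_type_algebra)
  show ?thesis
  proof (rule idealI[OF F.ring_axioms])
    show "subgroup ?K (add_monoid ?F)"
    proof (rule F.add.subgroupI)
      fix p assume "p \<in> ?K"
      moreover have "\<ominus>\<^bsub>?F\<^esub> p = - p"
        by (rule F.minus_equality) (auto simp: ring_of_type_algebra_simps)
      ultimately show "\<ominus>\<^bsub>?F\<^esub> p \<in> ?K"
        by (simp add: linear_extension_uminus)
    qed (auto simp: ring_of_type_algebra_simps linear_extension_add intro!: exI[of _ 0])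
  next
    fix p q assume p: "p \<in> ?K"
    have "linear_extension h (q * p) = 0 \<and> linear_extension h (p * q) = 0" if "compatible R Z h" for h
      using p compatible_translate[OF that]
      by (induction q rule: poly_mapping_additive_induct)
         (auto simp: linear_extension_single_mult linear_extension_mult_single distrib_left
           distrib_right linear_extension_add)
    then show "q \<otimes>\<^bsub>?F\<^esub> p \<in> ?K" "p \<otimes>\<^bsub>?F\<^esub> q \<in> ?K"
      by (auto simp: ring_of_type_algebra_simps)
  qed
qed

context
  fixes R :: "('i list \<times> 'i list) set" and Z :: "'i list set"
    and F :: "('i word \<Rightarrow>\<^sub>0 'k::comm_ring_1) ring" and N
    and H :: "('k, ('i word \<Rightarrow>\<^sub>0 'k) set) module"
    and coset
  defines "F \<equiv> ring_of_type_algebra"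
    and "N \<equiv> genideal F (monomial_relations R Z)"
    and "H \<equiv> presented_algebra (monomial_relations R Z)"
    and "coset \<equiv> (\<lambda>p. N +>\<^bsub>F\<^esub> p)"
begin

lemma relation_ideal: "ideal N F"
proof -
  interpret ring F unfolding F_def by (rule ring_ring_of_type_algebra)
  show ?thesis
    unfolding N_def by (rule genideal_ideal) (simp add: F_def ring_of_type_algebra_simps)
qed

lemma relation_ideal_closed:
  "0 \<in> N" "p \<in> N \<Longrightarrow> q \<in> N \<Longrightarrow> p + q \<in> N" "p \<in> N \<Longrightarrow> q \<in> N \<Longrightarrow> p - q \<in> N"
  "p \<in> N \<Longrightarrow> r * p \<in> N" "p \<in> N \<Longrightarrow> p * r \<in> N"
proof -
  interpret N: ideal N F by (rule relation_ideal)
  show "0 \<in> N" using additive_subgroup.zero_closed[OF ideal.axioms(1)[OF relation_ideal]] by (simp add: F_def ring_of_type_algebra_simps)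
  show add: "p + q \<in> N" if "p \<in> N" "q \<in> N" for p q
    using additive_subgroup.a_closed[OF ideal.axioms(1)[OF relation_ideal] that] by (simp add: F_def ring_of_type_algebra_simps)
  show l: "r * p \<in> N" if "p \<in> N" for p r
    using N.I_l_closed[OF that, of r] by (simp add: F_def ring_of_type_algebra_simps)
  show "p * r \<in> N" if "p \<in> N"
    using N.I_r_closed[OF that, of r] by (simp add: F_def ring_of_type_algebra_simps)
  show "p - q \<in> N" if "p \<in> N" "q \<in> N"
    using add[OF that(1) l[OF that(2), of "- 1"]] by simp
qed

lemma monomial_relations_in_ideal: "p \<in> monomial_relations R Z \<Longrightarrow> p \<in> N"
proof -
  interpret ring F unfolding F_def by (rule ring_ring_of_type_algebra)
  show "p \<in> monomial_relations R Z \<Longrightarrow> p \<in> N"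
    using genideal_self[of "monomial_relations R Z"]
    by (auto simp: N_def F_def ring_of_type_algebra_simps)
qed

text \<open>
  This gives linear independence: an element with a nonzero coefficient sum over some nonzero class
  is not in the ideal.
\<close>

lemma relation_ideal_in_kernel:
  assumes "p \<in> N" "compatible R Z h"
  shows "linear_extension h p = 0"
proof -
  interpret ring F unfolding F_def by (rule ring_ring_of_type_algebra)
  let ?K = "{p. \<forall>h. compatible R Z h \<longrightarrow> linear_extension h p = 0}"
  have "vanishing R Z z" if "z \<in> Z" for z
    unfolding vanishing_def using that word_cong.refl[of R z]
    by (metis append.left_neutral append_Nil2)
  then have "monomial_relations R Z \<subseteq> ?K"
    by (auto simp: monomial_relations_def word_elem_def linear_extension_diff compatible_def
        word_cong.relation)
  moreover have "ideal ?K F"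
    unfolding F_def by (rule compatible_kernel_ideal)
  ultimately have "N \<subseteq> ?K"
    unfolding N_def using genideal_minimal by blast
  with assms show ?thesis by blast
qed

lemma word_elem_append: "word_elem (u @ v) = word_elem u * word_elem v"
  by (simp add: word_elem_def mult_single plus_word_def)

lemma word_cong_in_ideal: "word_cong R u v \<Longrightarrow> word_elem u - word_elem v \<in> N"
proof (induction rule: word_cong.induct)
  case (relation u v)
  then show ?case
    by (intro monomial_relations_in_ideal) (auto simp: monomial_relations_def)
next
  case (refl u)
  then show ?case by (simp add: relation_ideal_closed)
next
  case (sym u v)
  then show ?case using relation_ideal_closed(3)[OF relation_ideal_closed(1) sym.IH] by simp
next
  case (trans u v w)
  then show ?case using relation_ideal_closed(2)[OF trans.IH] by simp
next
  case (append u v u' v')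
  have eq: "word_elem (u @ u') - word_elem (v @ v') = (word_elem u - word_elem v) * word_elem u' + word_elem v * (word_elem u' - word_elem v')"
    by (simp add: word_elem_append algebra_simps)
  show ?case
    unfolding eq by (intro relation_ideal_closed(2,4,5) append.IH)
qed

lemma vanishing_in_ideal:
  assumes "vanishing R Z u"
  shows "word_elem u \<in> N"
proof -
  obtain x z y where z: "z \<in> Z" and u: "word_cong R u (x @ z @ y)"
    using assms by (auto simp: vanishing_def)
  have "word_elem z \<in> N"
    using z by (intro monomial_relations_in_ideal) (auto simp: monomial_relations_def)
  then have "word_elem (x @ z @ y) \<in> N"
    by (simp add: word_elem_append relation_ideal_closed)
  with word_cong_in_ideal[OF u] have "word_elem u - word_elem (x @ z @ y) + word_elem (x @ z @ y) \<in> N"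
    by (rule relation_ideal_closed)
  then show ?thesis by simp
qed

lemma coset_eq_iff: "coset p = coset q \<longleftrightarrow> p - q \<in> N"
proof -
  interpret ring F unfolding F_def by (rule ring_ring_of_type_algebra)
  show ?thesis
    using quotient_eq_iff_same_a_r_cos[OF relation_ideal, of p q]
    by (simp add: F_def ring_of_type_algebra_simps a_minus_ring_of_type_algebra coset_def)
qed

lemma presented_algebra_fields:
  "carrier H = range coset"
  "add H = set_add F"
  "zero H = N"
  "c \<odot>\<^bsub>H\<^esub> A = (\<Union>p\<in>A. coset (Poly_Mapping.single 0 c * p))"
  by (auto simp: H_def presented_algebra_def Let_def F_def[symmetric] N_def[symmetric]
      ring.defs module.defs FactRing_def A_RCOSETS_def' coset_def)
     (auto simp: F_def ring_of_type_algebra_simps)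

lemma mem_coset_iff: "q \<in> coset p \<longleftrightarrow> q - p \<in> N"
proof -
  interpret N: ideal N F by (rule relation_ideal)
  have "q \<in> coset q" "q \<in> coset p \<longleftrightarrow> coset p = coset q"
    unfolding coset_def
    using N.a_rcos_self[of q] N.a_repr_independence'[of q p] by (auto simp: F_def ring_of_type_algebra_simps)
  then show ?thesis
    using coset_eq_iff[of q p] by auto
qed

lemma coset_smult: "c \<odot>\<^bsub>H\<^esub> coset p = coset (Poly_Mapping.single 0 c * p)"
proof -
  have "coset (Poly_Mapping.single 0 c * q) = coset (Poly_Mapping.single 0 c * p)" if "q \<in> coset p" for q
    using that relation_ideal_closed(4)[of "q - p" "Poly_Mapping.single 0 c"]
    by (simp add: coset_eq_iff mem_coset_iff right_diff_distrib)
  moreover have "p \<in> coset p"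
    by (simp add: mem_coset_iff relation_ideal_closed)
  ultimately show ?thesis
    unfolding presented_algebra_fields by blast
qed

lemma coset_add: "coset p \<oplus>\<^bsub>H\<^esub> coset q = coset (p + q)"
proof -
  interpret N: ideal N F by (rule relation_ideal)
  show ?thesis
    unfolding presented_algebra_fields coset_def
    using N.a_rcos_sum[of p q] by (simp add: F_def ring_of_type_algebra_simps)
qed

lemma coset_zero: "\<zero>\<^bsub>H\<^esub> = coset 0"
  unfolding presented_algebra_fields using mem_coset_iff[of _ 0] by auto

lemma abelian_monoid_presented_algebra: "abelian_monoid H"
  by (rule abelian_monoidI) (auto simp: presented_algebra_fields(1) coset_add coset_zero ac_simps)

lemma coset_finsum:
  assumes "finite S" and "\<And>b. b \<in> S \<Longrightarrow> f b = coset (g b)"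
  shows "(\<Oplus>\<^bsub>H\<^esub>b\<in>S. f b) = coset (\<Sum>b\<in>S. g b)"
proof -
  interpret H: abelian_monoid H by (rule abelian_monoid_presented_algebra)
  show ?thesis
    using assms
  proof induction
    case empty
    then show ?case by (simp add: coset_zero)
  next
    case (insert x S)
    then show ?case
      by (subst H.finsum_insert) (auto simp: presented_algebra_fields(1) coset_add)
  qed
qed

definition class_indicator :: "'i list set \<Rightarrow> 'i list \<Rightarrow> 'k" where
  "class_indicator C u = (if u \<in> C then 1 else 0)"

lemma nonzero_classesE:
  assumes "C \<in> nonzero_classes R Z"
  obtains u where "\<not> vanishing R Z u" "C = {v. word_cong R u v}"
  using assms by (auto simp: nonzero_classes_def elim!: quotientE)

lemma compatible_class_indicator:
  assumes "C \<in> nonzero_classes R Z"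
  shows "compatible R Z (class_indicator C)"
proof -
  obtain u where "\<not> vanishing R Z u" "C = {v. word_cong R u v}"
    using assms by (rule nonzero_classesE)
  then show ?thesis
    unfolding compatible_def class_indicator_def
    by (auto dest: vanishing_cong[of R _ _ Z] intro: word_cong.trans word_cong.sym)
qed

definition rep :: "'i list set \<Rightarrow> 'i list" where
  "rep C = (SOME u. u \<in> C)"

lemma rep_in_class: "C \<in> nonzero_classes R Z \<Longrightarrow> rep C \<in> C"
  unfolding rep_def by (rule someI_ex) (auto elim!: nonzero_classesE intro: word_cong.refl)

lemma class_indicator_rep:
  assumes "C \<in> nonzero_classes R Z" "D \<in> nonzero_classes R Z"
  shows "class_indicator C (rep D) = (if C = D then 1 else 0)"
proof -
  have "C = D" if "rep D \<in> C"
    using quotient_disj[OF equiv_word_cong[of R], of C D] that rep_in_class[OF assms(2)] assms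
    by (auto simp: nonzero_classes_def quotient_def)
  then show ?thesis
    using rep_in_class[OF assms(1)] by (auto simp: class_indicator_def)
qed

text \<open>
  Modulo the relations, congruent words are equal and vanishing words are zero, so collecting the
  coefficients of an element along the nonzero classes does not change its coset.  Together with
  \<open>relation_ideal_in_kernel\<close> this makes the representatives a basis.
\<close>

lemma coset_eq_combination:
  assumes "finite (nonzero_classes R Z)"
  shows "coset p = coset (\<Sum>C\<in>nonzero_classes R Z.
           Poly_Mapping.single 0 (linear_extension (class_indicator C) p) * word_elem (rep C))"
    (is "_ = coset (?s p)")
proof -
  have reduce_single: "Poly_Mapping.single u c - ?s (Poly_Mapping.single u c) \<in> N" for u c
  proof -
    have eq: "Poly_Mapping.single u c = Poly_Mapping.single 0 c * word_elem (letters u)"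
      by (simp add: word_elem_def mult_single)
    show ?thesis
    proof (cases "vanishing R Z (letters u)")
      case True
      then have "class_indicator C (letters u) = 0" if "C \<in> nonzero_classes R Z" for C
        using compatible_class_indicator[OF that] by (simp add: compatible_def)
      then have "?s (Poly_Mapping.single u c) = 0" by simp
      then show ?thesis
        using True by (simp add: eq relation_ideal_closed vanishing_in_ideal)
    next
      case False
      define D where "D = {v. word_cong R (letters u) v}"
      have D: "D \<in> nonzero_classes R Z"
        using False by (auto simp: nonzero_classes_def D_def quotient_def)
      have ind: "class_indicator C (letters u) = (if C = D then 1 else 0)"
        if C: "C \<in> nonzero_classes R Z" for C
      proof -
        have "class_indicator C (letters u) = class_indicator C (rep D)"
          using compatible_class_indicator[OF C] rep_in_class[OF D]
          by (auto simp: compatible_def D_def)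
        then show ?thesis using class_indicator_rep[OF C D] by simp
      qed
      have "?s (Poly_Mapping.single u c) =
          (\<Sum>C\<in>nonzero_classes R Z. if C = D then Poly_Mapping.single 0 c * word_elem (rep D) else 0)"
        by (rule sum.cong) (auto simp: ind)
      also have "\<dots> = Poly_Mapping.single 0 c * word_elem (rep D)"
        using assms D by simp
      finally have "Poly_Mapping.single u c - ?s (Poly_Mapping.single u c) =
          Poly_Mapping.single 0 c * (word_elem (letters u) - word_elem (rep D))"
        by (simp add: eq right_diff_distrib)
      moreover have "word_cong R (letters u) (rep D)"
        using rep_in_class[OF D] by (simp add: D_def)
      ultimately show ?thesis
        by (metis relation_ideal_closed(4) word_cong_in_ideal)
    qed
  qed
  have "p - ?s p \<in> N"
  proof (induction p rule: poly_mapping_additive_induct)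
    case (single u c)
    show ?case by (rule reduce_single)
  next
    case (add p q)
    have eq: "p + q - ?s (p + q) = (p - ?s p) + (q - ?s q)"
      by (simp add: linear_extension_add single_add distrib_right sum.distrib)
    show ?case
      unfolding eq by (rule relation_ideal_closed(2)[OF add])
  qed
  then show ?thesis by (simp add: coset_eq_iff)
qed

text \<open>
  Finitely many generators involve finitely many words.  The representative of a class that contains
  none of these words has coefficient sum 1 over its class, while every combination of the generators
  has coefficient sum 0 there.
\<close>

lemma finitely_generated_imp_finite_classes:
  assumes "fin_gen_module K H"
  shows "finite (nonzero_classes R Z)"
proof -
  obtain S where S: "finite S" "S \<subseteq> carrier H"
    and gen: "\<And>x. x \<in> carrier H \<Longrightarrow> \<exists>c\<in>S \<rightarrow> carrier K. x = (\<Oplus>\<^bsub>H\<^esub>b\<in>S. c b \<odot>\<^bsub>H\<^esub> b)"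
    using assms unfolding fin_gen_module_def by blast
  have "\<exists>g. \<forall>b\<in>S. b = coset (g b)"
    using S(2) unfolding presented_algebra_fields by (intro bchoice) auto
  then obtain g where g: "\<And>b. b \<in> S \<Longrightarrow> b = coset (g b)" by blast
  define U where "U = (\<Union>b\<in>S. Poly_Mapping.keys (g b))"
  have "finite U" using S(1) by (simp add: U_def)
  have "C \<in> (\<lambda>u. {v. word_cong R (letters u) v}) ` U" if C: "C \<in> nonzero_classes R Z" for C
  proof -
    obtain c where "coset (word_elem (rep C)) = (\<Oplus>\<^bsub>H\<^esub>b\<in>S. c b \<odot>\<^bsub>H\<^esub> b)"
      using gen[of "coset (word_elem (rep C))"] by (auto simp: presented_algebra_fields)
    also have "(\<Oplus>\<^bsub>H\<^esub>b\<in>S. c b \<odot>\<^bsub>H\<^esub> b) = coset (\<Sum>b\<in>S. Poly_Mapping.single 0 (c b) * g b)"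
      by (rule coset_finsum) (use S(1) g coset_smult in metis)+
    finally have "word_elem (rep C) - (\<Sum>b\<in>S. Poly_Mapping.single 0 (c b) * g b) \<in> N"
      by (simp add: coset_eq_iff)
    then have "linear_extension (class_indicator C) (word_elem (rep C)) =
        (\<Sum>b\<in>S. c b * linear_extension (class_indicator C) (g b))"
      using relation_ideal_in_kernel[OF _ compatible_class_indicator[OF C]]
      by (fastforce simp: linear_extension_diff linear_extension_sum linear_extension_scale)
    moreover have "linear_extension (class_indicator C) (word_elem (rep C)) = 1"
      using class_indicator_rep[OF C C] by (simp add: word_elem_def)
    ultimately obtain b where "b \<in> S" "linear_extension (class_indicator C) (g b) \<noteq> 0"
      by (metis (no_types, lifting) mult_zero_right sum.neutral zero_neq_one)
    then obtain u where u: "u \<in> Poly_Mapping.keys (g b)" "class_indicator C (letters u) \<noteq> 0"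
      unfolding linear_extension_def by (metis (no_types, lifting) mult_zero_right sum.neutral)
    from u(2) have "letters u \<in> C" by (auto simp: class_indicator_def split: if_splits)
    then have "C = {v. word_cong R (letters u) v}"
      using C by (elim nonzero_classesE) (auto intro: word_cong.trans word_cong.sym)
    then show ?thesis using u(1) \<open>b \<in> S\<close> by (auto simp: U_def)
  qed
  then have "nonzero_classes R Z \<subseteq> (\<lambda>u. {v. word_cong R (letters u) v}) ` U" by blast
  then show ?thesis using \<open>finite U\<close> finite_surj by blast
qed

lemma free_on_nonzero_classes:
  assumes fin: "finite (nonzero_classes R Z)" and K: "carrier K = UNIV"
  shows "free_module_of_rank K H (card (nonzero_classes R Z))"
proof -
  define e where "e C = coset (word_elem (rep C))" for C
  define B where "B = e ` nonzero_classes R Z"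
  have comb: "(\<Oplus>\<^bsub>H\<^esub>b\<in>B. c b \<odot>\<^bsub>H\<^esub> b) =
      coset (\<Sum>C\<in>nonzero_classes R Z. Poly_Mapping.single 0 (c (e C)) * word_elem (rep C))"
    if inj: "inj_on e (nonzero_classes R Z)" for c
  proof -
    define i where "i = the_inv_into (nonzero_classes R Z) e"
    have i: "i (e C) = C" if "C \<in> nonzero_classes R Z" for C
      using inj that by (simp add: i_def the_inv_into_f_f)
    have "(\<Oplus>\<^bsub>H\<^esub>b\<in>B. c b \<odot>\<^bsub>H\<^esub> b) =
        coset (\<Sum>b\<in>B. Poly_Mapping.single 0 (c b) * word_elem (rep (i b)))"
      by (rule coset_finsum) (auto simp: B_def fin i[unfolded e_def] e_def coset_smult)
    also have "(\<Sum>b\<in>B. Poly_Mapping.single 0 (c b) * word_elem (rep (i b))) =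
        (\<Sum>C\<in>nonzero_classes R Z. Poly_Mapping.single 0 (c (e C)) * word_elem (rep C))"
      unfolding B_def by (subst sum.reindex[OF inj]) (simp add: i)
    finally show ?thesis .
  qed
  have coeff: "linear_extension (class_indicator D) (word_elem (rep C)) = (if C = D then 1 else 0)"
    if "C \<in> nonzero_classes R Z" "D \<in> nonzero_classes R Z" for C D
    using class_indicator_rep[OF that(2,1)] by (auto simp: word_elem_def)
  have inj: "inj_on e (nonzero_classes R Z)"
  proof (rule inj_onI)
    fix C D assume C: "C \<in> nonzero_classes R Z" and D: "D \<in> nonzero_classes R Z" and "e C = e D"
    then have "word_elem (rep C) - word_elem (rep D) \<in> N"
      by (simp add: e_def coset_eq_iff)
    then have "linear_extension (class_indicator D) (word_elem (rep C)) = 1"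
      using relation_ideal_in_kernel[OF _ compatible_class_indicator[OF D]] coeff[OF D D]
      by (fastforce simp: linear_extension_diff)
    with coeff[OF C D] show "C = D" by (auto split: if_splits)
  qed
  have "\<exists>!c. c \<in> B \<rightarrow>\<^sub>E carrier K \<and> x = (\<Oplus>\<^bsub>H\<^esub>b\<in>B. c b \<odot>\<^bsub>H\<^esub> b)" if "x \<in> carrier H" for x
  proof -
    obtain p where p: "x = coset p"
      using \<open>x \<in> carrier H\<close> unfolding presented_algebra_fields(1) by (elim imageE)
    define c where "c = (\<lambda>b\<in>B. linear_extension
        (class_indicator (the_inv_into (nonzero_classes R Z) e b)) p)"
    have "x = (\<Oplus>\<^bsub>H\<^esub>b\<in>B. c b \<odot>\<^bsub>H\<^esub> b)"
      unfolding comb[OF inj] p coset_eq_combination[OF fin, of p]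
      by (rule arg_cong[of _ _ coset], rule sum.cong)
         (auto simp: c_def B_def the_inv_into_f_f[OF inj])
    moreover have "c \<in> B \<rightarrow>\<^sub>E carrier K" by (auto simp: c_def K)
    moreover have "c' = c" if c': "c' \<in> B \<rightarrow>\<^sub>E carrier K" "x = (\<Oplus>\<^bsub>H\<^esub>b\<in>B. c' b \<odot>\<^bsub>H\<^esub> b)" for c'
    proof (rule extensionalityI[of _ B])
      show "c' \<in> extensional B" "c \<in> extensional B"
        using c' by (auto simp: c_def PiE_def)
      fix b assume "b \<in> B"
      then obtain D where D: "D \<in> nonzero_classes R Z" "b = e D" by (auto simp: B_def)
      have "p - (\<Sum>C\<in>nonzero_classes R Z. Poly_Mapping.single 0 (c' (e C)) * word_elem (rep C)) \<in> N"
        using c'(2) by (simp add: comb[OF inj] p coset_eq_iff)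
      from relation_ideal_in_kernel[OF this compatible_class_indicator[OF D(1)]]
      have "linear_extension (class_indicator D) p =
          (\<Sum>C\<in>nonzero_classes R Z. c' (e C) * linear_extension (class_indicator D) (word_elem (rep C)))"
        by (simp add: linear_extension_diff linear_extension_sum linear_extension_scale)
      also have "\<dots> = (\<Sum>C\<in>nonzero_classes R Z. if C = D then c' (e D) else 0)"
        by (rule sum.cong) (auto simp: coeff D(1))
      also have "\<dots> = c' b" using fin D by simp
      finally show "c' b = c b"
        using D by (simp add: c_def B_def the_inv_into_f_f[OF inj])
    qed
    ultimately show ?thesis by blast
  qed
  moreover have "B \<subseteq> carrier H" by (auto simp: B_def e_def presented_algebra_fields)
  moreover have "card B = card (nonzero_classes R Z)" "finite B"
    using inj fin by (auto simp: B_def card_image)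
  ultimately show ?thesis
    unfolding free_module_of_rank_def by (intro exI[of _ B]) simp
qed

end

lemma free_imp_fin_gen:
  assumes "free_module_of_rank K V r"
  shows "fin_gen_module K V"
proof -
  obtain B where B: "finite B \<and> card B = r \<and> B \<subseteq> carrier V \<and> (\<forall>x\<in>carrier V.
      \<exists>!c. c \<in> B \<rightarrow>\<^sub>E carrier K \<and> x = (\<Oplus>\<^bsub>V\<^esub>b\<in>B. c b \<odot>\<^bsub>V\<^esub> b))"
    using assms unfolding free_module_of_rank_def by (elim exE)
  have "\<exists>c\<in>B \<rightarrow> carrier K. x = (\<Oplus>\<^bsub>V\<^esub>b\<in>B. c b \<odot>\<^bsub>V\<^esub> b)" if "x \<in> carrier V" for x
    using B[THEN conjunct2, THEN conjunct2, THEN conjunct2, rule_format, OF that]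
    by (elim ex1E conjE) (auto simp: PiE_def)
  then show ?thesis
    unfolding fin_gen_module_def using B by (intro exI[of _ B]) simp
qed

section \<open>Partial actions of words\<close>

text \<open>
  A letter acts by a partial map on states; \<open>None\<close> plays the role of zero.  Words are read from left
  to right.
\<close>

fun run :: "('i \<Rightarrow> 's \<Rightarrow> 's option) \<Rightarrow> 'i list \<Rightarrow> 's \<Rightarrow> 's option" where
  "run act [] s = Some s"
| "run act (i # u) s = Option.bind (act i s) (run act u)"

definition respects_relations ::
    "('i list \<times> 'i list) set \<Rightarrow> 'i list set \<Rightarrow> ('i \<Rightarrow> 's \<Rightarrow> 's option) \<Rightarrow> bool" where
  "respects_relations R Z act \<longleftrightarrow>
     (\<forall>(u, v)\<in>R. run act u = run act v) \<and> (\<forall>z\<in>Z. run act z = (\<lambda>s. None))"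

lemma run_append: "run act (u @ v) s = Option.bind (run act u s) (run act v)"
  by (induction u arbitrary: s) (auto split: Option.bind_split)

text \<open>
  An action may be cut down to a set of states that it preserves, so that the defining relations
  need to be verified on that set only.
\<close>

lemma run_restrict:
  assumes closed: "\<And>j y z. j \<in> L \<Longrightarrow> y \<in> V \<Longrightarrow> act j y = Some z \<Longrightarrow> z \<in> V"
    and "x \<in> V" "set u \<subseteq> L"
  shows "run (\<lambda>j y. if y \<in> V then act j y else None) u x = run act u x"
  using assms(2,3)
proof (induction u arbitrary: x)
  case (Cons j u)
  then show ?case using closed[of j x] by (auto split: Option.bind_split)
qed simp

lemma run_comp: "run (\<lambda>i. act (g i)) u x = run act (map g u) x"
  by (induction u arbitrary: x) (auto split: Option.bind_split)

lemma run_word_cong: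
  assumes "respects_relations R Z act" "word_cong R u v"
  shows "run act u = run act v"
  using assms(2)
proof (induction rule: word_cong.induct)
  case (relation u v)
  then show ?case using assms(1) by (auto simp: respects_relations_def)
qed (auto simp: run_append intro!: ext)

text \<open>
  Used contrapositively, as the certificate that a word does not vanish.
\<close>

lemma run_vanishing:
  assumes "respects_relations R Z act" "vanishing R Z u"
  shows "run act u s = None"
proof -
  obtain x z y where "z \<in> Z" "word_cong R u (x @ z @ y)"
    using assms(2) by (auto simp: vanishing_def)
  then show ?thesis
    using run_word_cong[OF assms(1), of u "x @ z @ y"] assms(1)
    by (auto simp: respects_relations_def run_append split: Option.bind_split)
qed

lemma class_in_nonzero_classes:
  "\<not> vanishing R Z u \<Longrightarrow> {v. word_cong R u v} \<in> nonzero_classes R Z"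
  by (auto simp: nonzero_classes_def quotient_def)

lemma class_eq_iff: "{w. word_cong R u w} = {w. word_cong R v w} \<longleftrightarrow> word_cong R u v"
  by (auto intro: word_cong.intros)

lemma word_cong_length:
  assumes "\<And>u v. (u, v) \<in> R \<Longrightarrow> length u = length v" "word_cong R u v"
  shows "length u = length v"
  using assms(2) by (induction rule: word_cong.induct) (auto simp: assms(1))

text \<open>
  If no state of \<open>Q\<close> is a dead end, there are readable words of every length.  Since the relations
  preserve length, these words lie in different classes.
\<close>

lemma infinite_nonzero_classes:
  assumes len: "\<And>u v. (u, v) \<in> R \<Longrightarrow> length u = length v"
    and act: "respects_relations R Z act"
    and s0: "s0 \<in> Q" and step: "\<And>s. s \<in> Q \<Longrightarrow> \<exists>i. \<exists>t\<in>Q. act i s = Some t"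
  shows "infinite (nonzero_classes R Z)"
proof
  assume fin: "finite (nonzero_classes R Z)"
  have "\<exists>u. length u = n \<and> (\<exists>t\<in>Q. run act u s0 = Some t)" for n
  proof (induction n)
    case 0
    show ?case using s0 by (intro exI[of _ "[]"]) auto
  next
    case (Suc n)
    then obtain u t where u: "length u = n" "t \<in> Q" "run act u s0 = Some t" by blast
    obtain i t' where "t' \<in> Q" "act i t = Some t'" using step[OF u(2)] by blast
    with u show ?case by (intro exI[of _ "u @ [i]"]) (auto simp: run_append)
  qed
  then obtain u where u: "\<And>n. length (u n) = n" "\<And>n. run act (u n) s0 \<noteq> None"
    by (metis option.distinct(1))
  then have "\<not> vanishing R Z (u n)" for n
    using run_vanishing[OF act] by metis
  then have "range (\<lambda>n. {v. word_cong R (u n) v}) \<subseteq> nonzero_classes R Z"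
    using class_in_nonzero_classes by blast
  moreover have "inj (\<lambda>n. {v. word_cong R (u n) v})"
    unfolding inj_def class_eq_iff using word_cong_length[OF len] u(1) by metis
  ultimately show False
    using fin finite_subset range_inj_infinite by blast
qed

text \<open>
  Normal forms.  The word \<open>w s\<close> leads from \<open>s0\<close> to \<open>s\<close>, so different states give different nonzero
  classes; and since multiplication by a letter turns a normal form into a normal form or into a
  vanishing word, every nonzero class contains one.
\<close>

lemma bij_betw_nonzero_classes:
  assumes act: "respects_relations R Z act"
    and s0: "s0 \<in> A" "w s0 = []" and run: "\<And>s. s \<in> A \<Longrightarrow> run act (w s) s0 = Some s"
    and closed: "\<And>i s t. s \<in> A \<Longrightarrow> act i s = Some t \<Longrightarrow> t \<in> A \<and> word_cong R (w s @ [i]) (w t)"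
    and undef: "\<And>i s. s \<in> A \<Longrightarrow> act i s = None \<Longrightarrow> vanishing R Z (w s @ [i])"
  shows "bij_betw (\<lambda>s. {v. word_cong R (w s) v}) A (nonzero_classes R Z)"
proof (rule bij_betwI')
  fix s t assume "s \<in> A" "t \<in> A"
  then show "{v. word_cong R (w s) v} = {v. word_cong R (w t) v} \<longleftrightarrow> s = t"
    unfolding class_eq_iff using run_word_cong[OF act, of "w s" "w t"] run
    by (metis option.inject word_cong.refl)
next
  fix s assume "s \<in> A"
  then have "\<not> vanishing R Z (w s)"
    using run run_vanishing[OF act] by fastforce
  then show "{v. word_cong R (w s) v} \<in> nonzero_classes R Z"
    by (rule class_in_nonzero_classes)
next
  have normal: "vanishing R Z u \<or> (\<exists>s\<in>A. word_cong R u (w s))" for u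
  proof (induction u rule: rev_induct)
    case Nil
    show ?case using s0 by (metis word_cong.refl)
  next
    case (snoc i u)
    show ?case
    proof (cases "vanishing R Z u")
      case True
      then show ?thesis using vanishing_context[of R Z u "[]" "[i]"] by simp
    next
      case False
      then obtain s where s: "s \<in> A" "word_cong R u (w s)" using snoc by blast
      have c: "word_cong R (u @ [i]) (w s @ [i])"
        using s(2) by (intro word_cong.append word_cong.refl)
      show ?thesis
      proof (cases "act i s")
        case None
        then show ?thesis using undef[OF s(1)] vanishing_cong[OF c] by blast
      next
        case (Some t)
        then show ?thesis using closed[OF s(1) Some] c by (blast intro: word_cong.trans)
      qed
    qed
  qed
  fix C assume "C \<in> nonzero_classes R Z"
  then obtain u where u: "\<not> vanishing R Z u" "C = {v. word_cong R u v}"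
    by (auto simp: nonzero_classes_def elim!: quotientE)
  with normal[of u] show "\<exists>s\<in>A. C = {v. word_cong R (w s) v}"
    using class_eq_iff by metis
qed

section \<open>Nil-Hecke algebras as presentations by braid relations and killed words\<close>

definition braid_rel :: "('i \<Rightarrow> 'i \<Rightarrow> enat) \<Rightarrow> 'i set set \<Rightarrow> ('i list \<times> 'i list) set" where
  "braid_rel M J0 = {(alternating a b (the_enat (M a b)), alternating b a (the_enat (M a b))) |a b.
     a \<noteq> b \<and> {a, b} \<in> J0}"

definition zero_words :: "('i \<Rightarrow> 'i \<Rightarrow> enat) \<Rightarrow> ('i \<Rightarrow> nat) \<Rightarrow> 'i set set \<Rightarrow> 'i list set" where
  "zero_words M d J0 = {replicate (d i) i |i. True} \<union>
     {alternating a b (the_enat (M a b)) |a b. a \<noteq> b \<and> {a, b} \<in> braid_pairs M - J0}"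

abbreviation nil_Hecke_classes :: "('i \<Rightarrow> 'i \<Rightarrow> enat) \<Rightarrow> ('i \<Rightarrow> nat) \<Rightarrow> 'i set set \<Rightarrow> 'i list set set" where
  "nil_Hecke_classes M d J0 \<equiv> nonzero_classes (braid_rel M J0) (zero_words M d J0)"

lemma word_elem_Nil: "word_elem [] = 1"
  by (simp add: word_elem_def flip: zero_word_def)

lemma word_elem_Cons: "word_elem (i # u) = gen i * word_elem u"
  by (simp add: word_elem_def gen_def mult_single plus_word_def)

lemma word_elem_eq_prod: "prod_list (map gen u) = word_elem u"
  by (induction u) (simp_all add: word_elem_Nil word_elem_Cons)

lemma gen_power: "gen i ^ n = word_elem (replicate n i)"
  by (induction n) (simp_all add: word_elem_Nil word_elem_Cons)

lemma nil_Hecke_relations_monomial: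
  assumes "coxeter_matrix M"
  shows "nil_Hecke_relations M d J0 = monomial_relations (braid_rel M J0) (zero_words M d J0)"
proof -
  have sym: "M a b = M b a" for a b using assms by (auto simp: coxeter_matrix_def)
  have side: "braid_side M a b = word_elem (alternating a b (the_enat (M a b)))" for a b
    by (simp add: braid_side_def word_elem_eq_prod)
  have differences: "{braid_side M a b - braid_side M b a :: _ \<Rightarrow>\<^sub>0 'b |a b. a \<noteq> b \<and> {a, b} \<in> J0} =
      {word_elem u - word_elem v |u v. (u, v) \<in> braid_rel M J0}"
    unfolding side braid_rel_def by (auto simp: sym[of _ b for b]; metis sym)
  have monomials: "{gen i ^ d i :: _ \<Rightarrow>\<^sub>0 'b |i. True} \<union>
      {braid_side M a b |a b. a \<noteq> b \<and> {a, b} \<in> braid_pairs M - J0} =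
      {word_elem z |z. z \<in> zero_words M d J0}"
    unfolding side zero_words_def gen_power by auto
  show ?thesis
    unfolding nil_Hecke_relations_def monomial_relations_def
      differences[symmetric] monomials[symmetric] by (simp only: Un_ac)
qed

lemma length_alternating [simp]: "length (alternating a b n) = n"
  by (induction a b n rule: alternating.induct) auto

lemma braid_rel_length: "(u, v) \<in> braid_rel M J0 \<Longrightarrow> length u = length v"
  by (auto simp: braid_rel_def)

section \<open>Walks through syllables of commuting letters\<close>

text \<open>
  An infinite word is written as a sequence of syllables \<open>S s\<close>, where \<open>nxt\<close> leads from one
  syllable to the next and a syllable is a set of commuting letters that may be read in any order.
  The conditions say that no defining relation applies to such a word except for the commutations
  inside a syllable: letters of consecutive syllables do not commute, a letter is repeated only if
  its exponent permits, and an alternating factor in \<open>x\<close> and \<open>y\<close> is shorter than \<open>M x y\<close>.  In the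
  last condition the first alternative limits alternating factors to three letters, the second one
  to five.
\<close>

locale syllable_walk =
  fixes M :: "'i::finite \<Rightarrow> 'i \<Rightarrow> enat" and d :: "'i \<Rightarrow> nat"
    and Q :: "'s set" and S :: "'s \<Rightarrow> 'i set" and nxt :: "'s \<Rightarrow> 's"
  assumes sym: "M x y = M y x"
    and inhabited: "Q \<noteq> {}"
    and closed: "s \<in> Q \<Longrightarrow> nxt s \<in> Q"
    and nonempty: "s \<in> Q \<Longrightarrow> S s \<noteq> {}"
    and within: "s \<in> Q \<Longrightarrow> x \<in> S s \<Longrightarrow> y \<in> S s \<Longrightarrow> x \<noteq> y \<Longrightarrow> M x y = 2"
    and between: "s \<in> Q \<Longrightarrow> x \<in> S s \<Longrightarrow> y \<in> S (nxt s) \<Longrightarrow> x \<noteq> y \<Longrightarrow> 3 \<le> M x y"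
    and repetition: "s \<in> Q \<Longrightarrow> x \<in> S s \<Longrightarrow> x \<in> S (nxt s) \<Longrightarrow> 3 \<le> d x \<and> x \<notin> S (nxt (nxt s))"
    and zigzag: "s \<in> Q \<Longrightarrow> x \<in> S s \<Longrightarrow> S (nxt s) = {y} \<Longrightarrow> x \<in> S (nxt (nxt s)) \<Longrightarrow> x \<noteq> y \<Longrightarrow>
      4 \<le> M x y \<and> (S (nxt (nxt s)) = {x} \<longrightarrow> y \<notin> S (nxt (nxt (nxt s)))) \<or>
      6 \<le> M x y \<and> \<not> (S (nxt (nxt s)) = {x} \<and> S (nxt (nxt (nxt s))) = {y} \<and>
        S (nxt (nxt (nxt (nxt s)))) = {x})"
begin

text \<open>
  A state consists of the current syllable and of its letters that have already been read.
\<close>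

definition read :: "'i \<Rightarrow> 's \<times> 'i set \<Rightarrow> ('s \<times> 'i set) option" where
  "read x = (\<lambda>(s, T). if s \<in> Q \<and> x \<in> S s \<and> x \<notin> T
     then Some (if insert x T = S s then (nxt s, {}) else (s, insert x T)) else None)"

lemma read_SomeE:
  assumes "read x (s, T) = Some st"
  obtains "s \<in> Q" "x \<in> S s" "x \<notin> T" "insert x T = S s" "st = (nxt s, {})"
  | "s \<in> Q" "x \<in> S s" "x \<notin> T" "insert x T \<noteq> S s" "st = (s, insert x T)"
  using assms by (auto simp: read_def split: if_splits)

lemma run_read_commute:
  assumes "M x y = 2" "x \<noteq> y"
  shows "run read [x, y] = run read [y, x]"
proof
  fix st :: "'s \<times> 'i set"
  obtain s T where st: "st = (s, T)" by (cases st)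
  have "\<not> (a \<in> S s \<and> b \<in> S (nxt s))" if "s \<in> Q" "M a b = 2" "a \<noteq> b" for a b
    using between[OF that(1), of a b] that by (auto simp: numeral_eq_enat)
  moreover have "insert a T \<noteq> S s" if "b \<in> S s" "b \<notin> T" "a \<noteq> b" for a b
    using that by (metis insertE)
  ultimately show "run read [x, y] st = run read [y, x] st"
    using assms sym[of x y] closed[of s] unfolding st
    by (auto simp: read_def insert_commute[of x y])
qed

text \<open>
  The letters of a syllable commute, so a letter that is followed by itself or by a letter that it
  does not commute with is the last one of its syllable.
\<close>

lemma read_completes:
  assumes "read x (s, T) = Some st" "read y st \<noteq> None" "x = y \<or> 3 \<le> M x y"
  shows "s \<in> Q" "x \<in> S s" "insert x T = S s" "st = (nxt s, {})" "y \<in> S (nxt s)"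
proof -
  have "s \<in> Q \<and> x \<in> S s \<and> insert x T = S s \<and> st = (nxt s, {})"
    using assms(1)
  proof (cases rule: read_SomeE)
    case 2
    then have "y \<in> S s" "y \<noteq> x"
      using assms(2) by (auto simp: read_def split: if_splits)
    then show ?thesis
      using within[OF 2(1,2)] assms(3) by (fastforce simp: numeral_eq_enat)
  qed auto
  then show "s \<in> Q" "x \<in> S s" "insert x T = S s" "st = (nxt s, {})" "y \<in> S (nxt s)"
    using assms(2) by (auto simp: read_def split: if_splits)
qed

lemma run_read_repetition:
  assumes "2 \<le> d x"
  shows "run read (replicate (d x) x) st = None"
proof (cases st)
  case (Pair s T)
  have two: "s \<in> Q \<and> st' = (nxt s, {}) \<and> x \<in> S s \<and> x \<in> S (nxt s)"
    if "read x (s, T) = Some st'" "read x st' \<noteq> None" for s T st'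
    using read_completes[OF that] by blast
  have three: "run read [x, x, x] st = None" if "3 \<le> d x"
  proof (rule ccontr)
    assume "run read [x, x, x] st \<noteq> None"
    then obtain st1 st2 where st: "read x (s, T) = Some st1" "read x st1 = Some st2" "read x st2 \<noteq> None"
      unfolding Pair by (auto split: Option.bind_splits)
    from two[OF st(1)] st(2) have 1: "s \<in> Q" "st1 = (nxt s, {})" "x \<in> S s" "x \<in> S (nxt s)" by auto
    from two[of "nxt s" "{}" st2] st(2,3) 1 have "x \<in> S (nxt (nxt s))" by auto
    with repetition[OF 1(1,3,4)] show False by blast
  qed
  have "run read [x, x] st = None" if "\<not> 3 \<le> d x"
  proof (rule ccontr)
    assume "run read [x, x] st \<noteq> None"
    then obtain st1 where "read x (s, T) = Some st1" "read x st1 \<noteq> None"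
      unfolding Pair by (auto split: Option.bind_splits)
    from two[OF this] repetition[of s x] that show False by blast
  qed
  then show ?thesis
  proof (cases "3 \<le> d x")
    case True
    then have "replicate (d x) x = [x, x, x] @ replicate (d x - 3) x"
      by (simp add: numeral_3_eq_3 replicate_Suc[symmetric] del: replicate_Suc)
    then show ?thesis using three[OF True] by (simp only: run_append) simp
  next
    case False
    then have "d x = 2" using assms by simp
    then show ?thesis
      using \<open>\<not> 3 \<le> d x \<Longrightarrow> run read [x, x] st = None\<close> False by (simp add: numeral_2_eq_2)
  qed
qed

lemma run_read_alternating:
  assumes "x \<noteq> y" "M x y = enat m" "3 \<le> m"
  shows "run read (alternating x y m) st = None"
proof (rule ccontr)
  assume defined: "run read (alternating x y m) st \<noteq> None"
  obtain s T where st: "st = (s, T)" by (cases st)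
  have M: "3 \<le> M x y" "3 \<le> M y x" using assms(2,3) sym[of x y] by (auto simp: numeral_eq_enat)
  have prefix: "run read (alternating x y n) st \<noteq> None" if "n \<le> m" for n
  proof -
    have "\<exists>u. alternating x y m = alternating x y n @ u" for x y
      using that
    proof (induction n arbitrary: x y m)
      case (Suc n)
      then show ?case by (cases m) auto
    qed simp
    then show ?thesis using defined by (metis run_append bind.simps(1))
  qed
  have "run read [x, y, x] st \<noteq> None"
    using prefix[OF assms(3)] by (simp add: numeral_3_eq_3)
  then obtain st1 st2 where r: "read x (s, T) = Some st1" "read y st1 = Some st2" "read x st2 \<noteq> None"
    unfolding st by (auto split: Option.bind_splits)
  have 1: "s \<in> Q" "x \<in> S s" "insert x T = S s" "st1 = (nxt s, {})"
    using read_completes[OF r(1), of y] r(2) M by auto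
  have 2: "S (nxt s) = {y}" "st2 = (nxt (nxt s), {})" "x \<in> S (nxt (nxt s))"
    using read_completes[of y "nxt s" "{}" st2 x] r(2,3) 1 M by auto
  (* Every inner letter of the alternating word fills a syllable of its own. *)
  have zz: "4 \<le> m \<and> (S (nxt (nxt s)) = {x} \<longrightarrow> y \<notin> S (nxt (nxt (nxt s)))) \<or>
      6 \<le> m \<and> \<not> (S (nxt (nxt s)) = {x} \<and> S (nxt (nxt (nxt s))) = {y} \<and>
        S (nxt (nxt (nxt (nxt s)))) = {x})"
    using zigzag[OF 1(1,2) 2(1,3) assms(1)] assms(2) by (auto simp: numeral_eq_enat)
  have "4 \<le> m" using zz by auto
  then have "run read [x, y] (nxt (nxt s), {}) \<noteq> None"
    using prefix[of 4] 1 2 r st by (simp add: eval_nat_numeral)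
  then obtain st3 where r3: "read x (nxt (nxt s), {}) = Some st3" "read y st3 \<noteq> None"
    by (auto split: Option.bind_splits)
  have 3: "S (nxt (nxt s)) = {x}" "st3 = (nxt (nxt (nxt s)), {})" "y \<in> S (nxt (nxt (nxt s)))"
    using read_completes[OF r3] M by auto
  then have "6 \<le> m" using zz by auto
  then have "run read [y, x, y] st3 \<noteq> None"
    using prefix[of 6] 1 2 r r3 st by (simp add: eval_nat_numeral)
  then obtain st4 st5 where r4: "read y (nxt (nxt (nxt s)), {}) = Some st4" "read x st4 = Some st5"
      "read y st5 \<noteq> None"
    unfolding 3 by (auto split: Option.bind_splits)
  have 4: "S (nxt (nxt (nxt s))) = {y}" "st4 = (nxt (nxt (nxt (nxt s))), {})"
    using read_completes[OF r4(1), of x] r4(2) M by auto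
  have "S (nxt (nxt (nxt (nxt s)))) = {x}"
    using read_completes[of x _ "{}" st5 y] r4(2,3) M unfolding 4 by auto
  with 3 4 zz show False by auto
qed

text \<open>
  The action by reading satisfies all defining relations, and it never gets stuck.
\<close>

theorem infinite_classes:
  assumes "coxeter_matrix M" "\<And>i. 2 \<le> d i" "3 \<le> k"
  shows "infinite (nil_Hecke_classes M d (braid_pairs_less M k))"
proof -
  have alt: "run read (alternating a b m) = (\<lambda>st. None)" if "a \<noteq> b" "M a b = enat m" "3 \<le> m" for a b m
    using run_read_alternating[OF that] by blast
  have two: "2 \<le> m" if "a \<noteq> b" "M a b = enat m" for a b m
    using assms(1) that unfolding coxeter_matrix_def by (metis enat_ord_simps(1) numeral_eq_enat)
  have "run read (alternating a b (the_enat (M a b))) = run read (alternating b a (the_enat (M a b)))"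
    if ab: "a \<noteq> b" "{a, b} \<in> braid_pairs_less M k" for a b
  proof -
    have "M a b < \<infinity>" using ab sym by (auto simp: braid_pairs_less_def doubleton_eq_iff)
    then obtain m where m: "M a b = enat m" by auto
    show ?thesis
    proof (cases "3 \<le> m")
      case True
      then show ?thesis using alt[of a b m] alt[of b a m] ab m sym[of a b] by simp
    next
      case False
      then have "m = 2" using two[OF ab(1) m] by simp
      then show ?thesis
        using run_read_commute[of a b] ab m by (simp add: numeral_eq_enat numeral_2_eq_2)
    qed
  qed
  moreover have "run read (alternating a b (the_enat (M a b))) = (\<lambda>st. None)"
    if ab: "a \<noteq> b" "{a, b} \<in> braid_pairs M - braid_pairs_less M k" for a b
  proof -
    have fin: "M a b < \<infinity>" using ab sym by (auto simp: braid_pairs_def doubleton_eq_iff)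
    then obtain m where m: "M a b = enat m" by auto
    have "k \<le> M a b"
    proof (rule ccontr)
      assume "\<not> k \<le> M a b"
      then have "{a, b} \<in> braid_pairs_less M k"
        using ab(1) fin unfolding braid_pairs_less_def by (auto simp: not_le)
      with ab(2) show False by blast
    qed
    then have "3 \<le> m" using assms(3) m by (metis enat_ord_simps(1) numeral_eq_enat order_trans)
    then show ?thesis using alt[OF ab(1) m] m by simp
  qed
  moreover have "run read (replicate (d i) i) = (\<lambda>st. None)" for i
    using run_read_repetition[OF assms(2)] by blast
  ultimately have act: "respects_relations (braid_rel M (braid_pairs_less M k))
      (zero_words M d (braid_pairs_less M k)) read"
    unfolding respects_relations_def braid_rel_def zero_words_def by blast
  obtain s where "s \<in> Q" using inhabited by blast
  then have start: "(s, {}) \<in> {(s, T). s \<in> Q \<and> T \<subset> S s}" using nonempty by auto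
  have "\<exists>i. \<exists>t\<in>{(s, T). s \<in> Q \<and> T \<subset> S s}. read i st = Some t"
    if "st \<in> {(s, T). s \<in> Q \<and> T \<subset> S s}" for st
  proof -
    obtain s T x where st: "st = (s, T)" "s \<in> Q" "T \<subset> S s" "x \<in> S s" "x \<notin> T"
      using \<open>st \<in> _\<close> by auto
    then have "\<exists>t\<in>{(s, T). s \<in> Q \<and> T \<subset> S s}. read x st = Some t"
      using closed[of s] nonempty[of "nxt s"] by (auto simp: read_def psubset_eq)
    then show ?thesis by blast
  qed
  then show ?thesis
    by (intro infinite_nonzero_classes[OF _ act start]) (auto dest: braid_rel_length)
qed

end

lemma coxeter_matrix_sym: "coxeter_matrix M \<Longrightarrow> M a b = M b a"
  by (auto simp: coxeter_matrix_def)

text \<open>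
  Around a triangle no braid relation applies to the periodic word \<open>p q r p q r \<dots>\<close>.
\<close>

lemma infinite_classes_triangle:
  fixes M :: "'i::finite \<Rightarrow> 'i \<Rightarrow> enat"
  assumes M: "coxeter_matrix M" and d: "\<And>i. 2 \<le> d i" and k: "3 \<le> k"
    and distinct: "p \<noteq> q" "q \<noteq> r" "p \<noteq> r"
    and ge3: "3 \<le> M p q" "3 \<le> M q r" "3 \<le> M p r"
  shows "infinite (nil_Hecke_classes M d (braid_pairs_less M k))"
proof -
  (* The numerals are arbitrary labels for the three positions in the period. *)
  define S where "S n = (if n = (2::nat) then {p} else if n = 3 then {q} else {r})" for n
  define nxt where "nxt n = (if n = (2::nat) then 3 else if n = 3 then 4 else 2::nat)" for n
  have S: "S 2 = {p}" "S 3 = {q}" "S 4 = {r}" and nxt: "nxt 2 = 3" "nxt 3 = 4" "nxt 4 = 2"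
    by (simp_all add: S_def nxt_def)
  have ge3': "3 \<le> M q p" "3 \<le> M r q" "3 \<le> M r p"
    using ge3 coxeter_matrix_sym[OF M] by metis+
  interpret syllable_walk M d "{2, 3, 4}" S nxt
  proof
    show "M x y = M y x" for x y by (rule coxeter_matrix_sym[OF M])
    show "nxt s \<in> {2,3,4}" if "s \<in> {2,3,4}" for s using that nxt by auto
    show "S s \<noteq> {}" if "s \<in> {2,3,4}" for s using that S by auto
    show "M x y = 2" if "s \<in> {2,3,4}" "x \<in> S s" "y \<in> S s" "x \<noteq> y" for x y s using that S by auto
    show "3 \<le> M x y" if "s \<in> {2,3,4}" "x \<in> S s" "y \<in> S (nxt s)" "x \<noteq> y" for x y s
      using that S nxt ge3 ge3' by auto
    show "3 \<le> d x \<and> x \<notin> S (nxt (nxt s))" if "s \<in> {2,3,4}" "x \<in> S s" "x \<in> S (nxt s)" for x s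
      using that S nxt distinct by auto
    have "\<not> (x \<in> S (nxt (nxt s)))" if "s \<in> {2,3,4}" "x \<in> S s" for x s
      using that S nxt distinct by auto
    then show "4 \<le> M x y \<and> (S (nxt (nxt s)) = {x} \<longrightarrow> y \<notin> S (nxt (nxt (nxt s)))) \<or>
      6 \<le> M x y \<and> \<not> (S (nxt (nxt s)) = {x} \<and> S (nxt (nxt (nxt s))) = {y} \<and>
        S (nxt (nxt (nxt (nxt s)))) = {x})"
      if "s \<in> {2,3,4}" "x \<in> S s" "S (nxt s) = {y}" "x \<in> S (nxt (nxt s))" "x \<noteq> y" for x y s
      using that by blast
  qed simp
  show ?thesis by (rule infinite_classes[OF M d k])
qed

text \<open>
  Let a third node \<open>c\<close> be attached to \<open>b\<close>.  If \<open>c\<close> commutes with \<open>a\<close>, consider the periodic word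
  with syllables \<open>{a, c}\<close>, \<open>{b}\<close>, \<open>{a}\<close>, \<open>{b}\<close>.  The letter \<open>c\<close> cuts its alternating factors in \<open>a\<close>
  and \<open>b\<close>, so that their length is at most five.  No two letters \<open>b\<close> are separated by \<open>c\<close> alone, nor
  two letters \<open>c\<close> by \<open>b\<close> alone.  If \<open>c\<close> does not commute with \<open>a\<close>, there is a triangle.
\<close>

lemma infinite_classes_heavy_bond:
  fixes M :: "'i::finite \<Rightarrow> 'i \<Rightarrow> enat"
  assumes M: "coxeter_matrix M" and d: "\<And>i. 2 \<le> d i" and k: "3 \<le> k"
    and distinct: "a \<noteq> b" "b \<noteq> c" "a \<noteq> c"
    and ab: "6 \<le> M a b" and bc: "3 \<le> M b c"
  shows "infinite (nil_Hecke_classes M d (braid_pairs_less M k))"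
proof (cases "3 \<le> M a c")
  case True
  have "3 \<le> M a b" using ab by (meson order_trans numeral_le_iff semiring_norm)
  then show ?thesis
    by (rule infinite_classes_triangle[OF M d k distinct _ bc True])
next
  case False
  have "2 \<le> M a c" using M distinct(3) by (auto simp: coxeter_matrix_def)
  with False have ac: "M a c = 2"
    by (cases "M a c") (auto simp: numeral_eq_enat)
  have ab3: "3 \<le> M a b" using ab by (meson order_trans numeral_le_iff semiring_norm)
  define S where "S n = (if n = (2::nat) then {a, c} else if n = 4 then {a} else {b})" for n
  define nxt where "nxt n = (if n = (2::nat) then 3 else if n = 3 then 4 else if n = 4 then 5 else 2::nat)" for n
  have S: "S 2 = {a, c}" "S 3 = {b}" "S 4 = {a}" "S 5 = {b}"
    and nxt: "nxt 2 = 3" "nxt 3 = 4" "nxt 4 = 5" "nxt 5 = 2"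
    by (simp_all add: S_def nxt_def)
  have sym: "3 \<le> M b a" "6 \<le> M b a" "3 \<le> M c b" "M c a = 2"
    using ab ab3 ac bc coxeter_matrix_sym[OF M] by metis+
  have ne: "{a, c} \<noteq> {x}" for x using distinct by auto
  interpret syllable_walk M d "{2, 3, 4, 5}" S nxt
  proof
    show "M x y = M y x" for x y by (rule coxeter_matrix_sym[OF M])
  qed (use distinct ab ab3 ac bc sym ne in \<open>auto simp: S nxt\<close>)
  show ?thesis by (rule infinite_classes[OF M d k])
qed

text \<open>
  The positions of a walk that goes along a path \<open>f 0, \<dots>, f r\<close>, turns round, and comes back:
  \<open>Up j\<close> and \<open>Down j\<close> stand at \<open>f j\<close> on the way out and on the way back, \<open>Top\<close> is the turning point
  beyond \<open>f r\<close>.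
\<close>

datatype phase = Up nat | Top | Down nat

text \<open>
  The word \<open>f 0, \<dots>, f r, T, f r, \<dots>, f 0\<close>, repeated for ever.  At the start it turns by
  the factor \<open>f 0 f 0\<close>, which the exponent of \<open>f 0\<close> permits.  At the other end it turns in one of three
  ways: by \<open>f r f r\<close> if \<open>f r\<close> has a large exponent too (here \<open>T\<close> is empty); by \<open>f r t f r\<close>, to which no
  braid relation applies if the bond to \<open>t\<close> is at least 4; or by passing through two commuting
  neighbours, which separate the two occurrences of \<open>f r\<close>.
\<close>

lemma infinite_classes_bounce:
  fixes M :: "'i::finite \<Rightarrow> 'i \<Rightarrow> enat"
  assumes M: "coxeter_matrix M" and d: "\<And>i. 2 \<le> d i" and k: "3 \<le> k"
    and inj: "inj_on f {..r}" and path: "\<And>j. j < r \<Longrightarrow> 3 \<le> M (f j) (f (Suc j))"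
    and start: "3 \<le> d (f 0)"
    and finish: "T = {} \<and> 0 < r \<and> 3 \<le> d (f r) \<or>
      T \<noteq> {} \<and> T \<inter> f ` {..r} = {} \<and> (\<forall>x\<in>T. 3 \<le> M (f r) x) \<and>
      (\<forall>x\<in>T. \<forall>y\<in>T. x \<noteq> y \<longrightarrow> M x y = 2) \<and> (\<forall>x. T = {x} \<longrightarrow> 4 \<le> M (f r) x)"
  shows "infinite (nil_Hecke_classes M d (braid_pairs_less M k))"
proof -
  define Q where "Q = Up ` {..r} \<union> Down ` {..r} \<union> (if T = {} then {} else {Top})"
  define S where "S s = (case s of Up j \<Rightarrow> {f j} | Top \<Rightarrow> T | Down j \<Rightarrow> {f j})" for s
  define nxt where "nxt s = (case s of
      Up j \<Rightarrow> if j < r then Up (Suc j) else if T = {} then Down r else Top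
    | Top \<Rightarrow> Down r
    | Down j \<Rightarrow> if j = 0 then Up 0 else Down (j - 1))" for s
  have sym: "M x y = M y x" for x y by (rule coxeter_matrix_sym[OF M])
  have path': "3 \<le> M (f j) (f (j - 1))" if "0 < j" "j \<le> r" for j
    using path[of "j - 1"] that sym[of "f j" "f (j - 1)"] by simp
  have f_eq: "f i = f j \<longleftrightarrow> i = j" if "i \<le> r" "j \<le> r" for i j
    using inj that by (auto simp: inj_on_def)
  have outside: "f j \<notin> T" if "j \<le> r" for j
    using finish that by auto
  have top: "3 \<le> M (f r) x" "3 \<le> M x (f r)" if "x \<in> T" for x
    using finish that sym by (auto simp: sym)
  interpret syllable_walk M d Q S nxt
  proof
    show "M x y = M y x" for x y by (rule sym)
    show "Q \<noteq> {}" by (auto simp: Q_def)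
  next
    fix s assume s: "s \<in> Q"
    then show "nxt s \<in> Q" by (auto simp: Q_def nxt_def split: if_splits)
    from s show "S s \<noteq> {}" by (auto simp: Q_def S_def split: if_splits)
    show "M x y = 2" if "x \<in> S s" "y \<in> S s" "x \<noteq> y" for x y
      using s that finish by (auto simp: Q_def S_def split: if_splits)
    show "3 \<le> M x y" if "x \<in> S s" "y \<in> S (nxt s)" "x \<noteq> y" for x y
    proof (cases s)
      case (Up j)
      then show ?thesis using s that path[of j] top[of y]
        by (auto simp: Q_def S_def nxt_def split: if_splits)
    next
      case Top
      then show ?thesis using s that top[of x] by (auto simp: Q_def S_def nxt_def split: if_splits)
    next
      case (Down j)
      then show ?thesis using s that path'[of j]
        by (auto simp: Q_def S_def nxt_def split: if_splits)
    qed
    show "3 \<le> d x \<and> x \<notin> S (nxt (nxt s))" if "x \<in> S s" "x \<in> S (nxt s)" for x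
    proof (cases s)
      case (Up j)
      then show ?thesis using s that finish outside[of j] f_eq[of j "Suc j"] f_eq[of r "r - 1"]
        by (auto simp: Q_def S_def nxt_def split: if_splits)
    next
      case Top
      then show ?thesis using s that outside[of r] by (auto simp: Q_def S_def nxt_def split: if_splits)
    next
      case (Down j)
      then have "j \<le> r" using s by (auto simp: Q_def split: if_splits)
      then have "f j \<noteq> f (j - 1)" if "j \<noteq> 0" using f_eq[of j "j - 1"] that by auto
      moreover have "0 < r" if "T = {}" using finish that by auto
      ultimately show ?thesis using Down that start outside[of 0] f_eq[of 0 1]
        by (auto simp: S_def nxt_def split: if_splits)
    qed
    have "4 \<le> M x y \<and> (S (nxt (nxt s)) = {x} \<longrightarrow> y \<notin> S (nxt (nxt (nxt s))))"
      if z: "x \<in> S s" "S (nxt s) = {y}" "x \<in> S (nxt (nxt s))" "x \<noteq> y" for x y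
    proof (cases s)
      case (Up j)
      consider "Suc j < r" | "Suc j = r" | "j = r" using s Up by (force simp: Q_def split: if_splits)
      then show ?thesis
      proof cases
        case 1
        then show ?thesis using Up z f_eq[of j "Suc (Suc j)"] by (auto simp: S_def nxt_def)
      next
        case 2
        then show ?thesis using Up z outside[of j] by (auto simp: S_def nxt_def split: if_splits)
      next
        case 3
        then have T: "T = {y}" "x = f r"
          using Up z by (auto simp: S_def nxt_def split: if_splits)
        then have "4 \<le> M x y" using finish by auto
        moreover have "y \<notin> S (nxt (nxt (nxt s)))"
          using outside[of 0] outside[of "r - 1"] T Up 3
          by (auto simp: S_def nxt_def)
        ultimately show ?thesis by blast
      qed
    next
      case Top
      then show ?thesis
        using z outside[of 0] outside[of "r - 1"] by (auto simp: S_def nxt_def split: if_splits)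
    next
      case (Down j)
      consider "j = 0" | "j = 1" | "2 \<le> j" by linarith
      then show ?thesis
      proof cases
        case 3
        have "j \<le> r" using Down s by (auto simp: Q_def split: if_splits)
        moreover from this have "j - Suc (Suc 0) \<le> r" "j \<noteq> j - Suc (Suc 0)" using 3 by simp_all
        ultimately have "f j \<noteq> f (j - Suc (Suc 0))" using f_eq by metis
        then show ?thesis
          using Down 3 z by (auto simp: S_def nxt_def split: if_splits)
      qed (use Down z in \<open>auto simp: S_def nxt_def split: if_splits\<close>)
    qed
    then show "4 \<le> M x y \<and> (S (nxt (nxt s)) = {x} \<longrightarrow> y \<notin> S (nxt (nxt (nxt s)))) \<or>
      6 \<le> M x y \<and> \<not> (S (nxt (nxt s)) = {x} \<and> S (nxt (nxt (nxt s))) = {y} \<and>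
        S (nxt (nxt (nxt (nxt s)))) = {x})"
      if "x \<in> S s" "S (nxt s) = {y}" "x \<in> S (nxt (nxt s))" "x \<noteq> y" for x y
      using that by blast
  qed
  show ?thesis by (rule infinite_classes[OF M d k])
qed

section \<open>A large exponent forces type A\<close>

lemma coxeter_matrix_cases:
  assumes "coxeter_matrix M" "a \<noteq> b"
  obtains "M a b = 2" | "3 \<le> M a b"
proof -
  have "2 \<le> M a b" using assms by (auto simp: coxeter_matrix_def)
  then have "M a b = 2 \<or> 3 \<le> M a b"
    by (cases "M a b") (auto simp: numeral_eq_enat)
  then show thesis using that by blast
qed

text \<open>
  A piece of a diagram of type A that starts at \<open>f 0\<close> and has no neighbours outside the path, except
  possibly at its last node \<open>f r\<close>; only at \<open>f 0\<close> may the exponent be large.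
\<close>

definition tail_path :: "('i \<Rightarrow> 'i \<Rightarrow> enat) \<Rightarrow> ('i \<Rightarrow> nat) \<Rightarrow> nat \<Rightarrow> (nat \<Rightarrow> 'i) \<Rightarrow> bool" where
  "tail_path M d r f \<longleftrightarrow> inj_on f {..r} \<and> (\<forall>j<r. M (f j) (f (Suc j)) = 3) \<and>
     (\<forall>j\<in>{1..r}. d (f j) = 2) \<and>
     (\<forall>j<r. \<forall>x. x \<noteq> f j \<longrightarrow> 3 \<le> M (f j) x \<longrightarrow> (\<exists>i\<le>r. x = f i \<and> (i = Suc j \<or> j = Suc i)))"

text \<open>
  If there are finitely many nonzero classes, the path continues in at most one way.  Two further
  neighbours of \<open>f r\<close> would commute, and the word bounces off this pair, or form a triangle with it; a bond
  of at least 4 or a further large exponent is again an end to bounce off.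
\<close>

lemma tail_path_extend:
  fixes M :: "'i::finite \<Rightarrow> 'i \<Rightarrow> enat"
  assumes M: "coxeter_matrix M" and d: "\<And>i. 2 \<le> d i" and k: "3 \<le> k"
    and fin: "finite (nil_Hecke_classes M d (braid_pairs_less M k))"
    and path: "tail_path M d r f" and start: "3 \<le> d (f 0)"
    and t: "t \<noteq> f r" "3 \<le> M (f r) t" "r = 0 \<or> t \<noteq> f (r - 1)"
  shows "tail_path M d (Suc r) (f(Suc r := t))"
proof -
  have sym: "M x y = M y x" for x y by (rule coxeter_matrix_sym[OF M])
  have inj: "inj_on f {..r}" and edge: "\<And>j. j < r \<Longrightarrow> M (f j) (f (Suc j)) = 3"
    and two: "\<And>j. 1 \<le> j \<Longrightarrow> j \<le> r \<Longrightarrow> d (f j) = 2"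
    and nb: "\<And>j x. j < r \<Longrightarrow> x \<noteq> f j \<Longrightarrow> 3 \<le> M (f j) x \<Longrightarrow> \<exists>i\<le>r. x = f i \<and> (i = Suc j \<or> j = Suc i)"
    using path by (auto simp: tail_path_def)
  have edge': "3 \<le> M (f j) (f (Suc j))" if "j < r" for j using edge[OF that] by simp
  note bounce = infinite_classes_bounce[of M d k f r, OF M d k inj edge' start]
  have outside: "x \<notin> f ` {..r}" if x: "x \<noteq> f r" "3 \<le> M (f r) x" "r = 0 \<or> x \<noteq> f (r - 1)" for x
  proof
    assume "x \<in> f ` {..r}"
    then obtain j where j: "j \<le> r" "x = f j" by auto
    then have "j < r" using x(1) by (cases "j = r") auto
    moreover have "3 \<le> M (f j) (f r)" using x(2) j sym by metis
    ultimately obtain i where i: "i \<le> r" "f r = f i" "i = Suc j \<or> j = Suc i"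
      using nb[of j "f r"] x(1) j by metis
    then have "i = r" using inj by (auto simp: inj_on_def)
    with i \<open>j < r\<close> have "r = Suc j" by auto
    then show False using x(3) j by auto
  qed
  have t_out: "t \<notin> f ` {..r}" using outside t by blast
  have unique: "x = t" if x: "x \<noteq> f r" "3 \<le> M (f r) x" "r = 0 \<or> x \<noteq> f (r - 1)" for x
  proof (rule ccontr)
    assume "x \<noteq> t"
    from M this show False
    proof (cases rule: coxeter_matrix_cases)
      case 1
      have "infinite (nil_Hecke_classes M d (braid_pairs_less M k))"
        by (rule bounce[of "{x, t}"])
           (use edge' outside[OF x] t_out x t 1 sym[of x t] \<open>x \<noteq> t\<close> in \<open>auto simp: doubleton_eq_iff\<close>)
      then show False using fin by blast
    next
      case 2
      have "infinite (nil_Hecke_classes M d (braid_pairs_less M k))"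
        by (rule infinite_classes_triangle[OF M d k, of "f r" x t])
           (use x t 2 \<open>x \<noteq> t\<close> in auto)
      then show False using fin by blast
    qed
  qed
  have Mt: "M (f r) t = 3"
  proof (rule ccontr)
    assume "M (f r) t \<noteq> 3"
    with t(2) have "4 \<le> M (f r) t"
      by (cases "M (f r) t") (auto simp: numeral_eq_enat)
    then have "infinite (nil_Hecke_classes M d (braid_pairs_less M k))"
      by (intro bounce[of "{t}"]) (use edge' t_out t in auto)
    then show False using fin by blast
  qed
  let ?g = "f(Suc r := t)"
  have inj': "inj_on ?g {..Suc r}"
    using inj t_out by (auto simp: inj_on_def atMost_Suc)
  have edge2: "M (?g j) (?g (Suc j)) = 3" if "j < Suc r" for j
    using that edge[of j] Mt by (cases "j = r") auto
  have dt: "d t = 2"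
  proof (rule ccontr)
    assume "d t \<noteq> 2"
    then have "3 \<le> d t" using d[of t] by linarith
    then have "infinite (nil_Hecke_classes M d (braid_pairs_less M k))"
      by (intro infinite_classes_bounce[OF M d k inj', where T = "{}"]) (use edge2 start in auto)
    then show False using fin by blast
  qed
  have "\<exists>i\<le>Suc r. x = ?g i \<and> (i = Suc j \<or> j = Suc i)" if j: "j < Suc r" and x: "x \<noteq> ?g j" "3 \<le> M (?g j) x" for j x
  proof (cases "j = r")
    case True
    show ?thesis
    proof (cases "r = 0 \<or> x \<noteq> f (r - 1)")
      case True
      then have "x = t" using unique[of x] x \<open>j = r\<close> by auto
      then show ?thesis using \<open>j = r\<close> by (intro exI[of _ "Suc r"]) auto
    next
      case False
      then show ?thesis using \<open>j = r\<close> by (intro exI[of _ "r - 1"]) auto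
    qed
  next
    case False
    then have "j < r" using j by simp
    then obtain i where "i \<le> r" "x = f i" "i = Suc j \<or> j = Suc i"
      using nb[of j x] x by auto
    then show ?thesis by (intro exI[of _ i]) auto
  qed
  then show ?thesis
    unfolding tail_path_def using inj' edge2 two dt by auto
qed

text \<open>
  Extend a path from \<open>a\<close> as long as possible.  Nothing else is attached to the resulting path, so by
  irreducibility it is the whole diagram.
\<close>

theorem finite_classes_imp_type_A:
  fixes M :: "'i::finite \<Rightarrow> 'i \<Rightarrow> enat"
  assumes M: "coxeter_matrix M" and irr: "coxeter_irreducible M"
    and d: "\<And>i. 2 \<le> d i" and k: "3 \<le> k"
    and fin: "finite (nil_Hecke_classes M d (braid_pairs_less M k))"
    and a: "3 \<le> d a"
  shows "\<exists>n. 1 \<le> n \<and> type_A_end_exponent M d n (d a)"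
proof -
  have sym: "M x y = M y x" for x y by (rule coxeter_matrix_sym[OF M])
  have "\<exists>r f. tail_path M d r f \<and> f 0 = a \<and>
      \<not> (\<exists>t. t \<noteq> f r \<and> 3 \<le> M (f r) t \<and> (r = 0 \<or> t \<noteq> f (r - 1)))"
    (is ?terminal)
  proof (rule ccontr)
    assume extendable: "\<not> ?terminal"
    have "\<exists>f. tail_path M d r f \<and> f 0 = a" for r
    proof (induction r)
      case 0
      show ?case by (intro exI[of _ "\<lambda>_. a"]) (auto simp: tail_path_def)
    next
      case (Suc r)
      then obtain f where f: "tail_path M d r f" "f 0 = a" by blast
      then obtain t where "t \<noteq> f r" "3 \<le> M (f r) t" "r = 0 \<or> t \<noteq> f (r - 1)"
        using extendable by blast
      then have "tail_path M d (Suc r) (f(Suc r := t))"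
        using tail_path_extend[OF M d k fin f(1)] f(2) a by blast
      then show ?case using f(2) by (metis fun_upd_other nat.distinct(1))
    qed
    (* A path that can always be extended would outgrow the finite set of nodes. *)
    then obtain f where "tail_path M d (card (UNIV :: 'i set)) f" by blast
    then have "inj_on f {..card (UNIV :: 'i set)}" by (simp add: tail_path_def)
    then have "card {..card (UNIV :: 'i set)} \<le> card (UNIV :: 'i set)"
      by (intro card_inj_on_le[of f]) auto
    then show False by simp
  qed
  then obtain r f where path: "tail_path M d r f" and f0: "f 0 = a"
    and terminal: "\<And>t. t \<noteq> f r \<Longrightarrow> 3 \<le> M (f r) t \<Longrightarrow> r \<noteq> 0 \<and> t = f (r - 1)" by blast
  have inj: "inj_on f {..r}" and edge: "\<And>j. j < r \<Longrightarrow> M (f j) (f (Suc j)) = 3"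
    and two: "\<And>j. 1 \<le> j \<Longrightarrow> j \<le> r \<Longrightarrow> d (f j) = 2"
    and nb': "\<And>j x. j < r \<Longrightarrow> x \<noteq> f j \<Longrightarrow> 3 \<le> M (f j) x \<Longrightarrow> \<exists>i\<le>r. x = f i \<and> (i = Suc j \<or> j = Suc i)"
    using path by (auto simp: tail_path_def)
  have nb: "\<exists>i\<le>r. x = f i \<and> (i = Suc j \<or> j = Suc i)" if "j \<le> r" "x \<noteq> f j" "3 \<le> M (f j) x" for j x
  proof (cases "j = r")
    case True
    then show ?thesis using terminal[of x] that by (intro exI[of _ "r - 1"]) auto
  qed (use nb'[of j x] that in auto)
  have surj: "f ` {..r} = UNIV"
  proof -
    have "x \<in> f ` {..r}" for x
    proof -
      have "(\<lambda>a b. a \<noteq> b \<and> 3 \<le> M a b)\<^sup>*\<^sup>* a x"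
        using irr by (simp add: coxeter_irreducible_def)
      then show ?thesis
      proof (induction rule: rtranclp_induct)
        case base
        show ?case using f0 by auto
      next
        case (step y z)
        then obtain j where "j \<le> r" "y = f j" by auto
        then show ?case using nb[of j z] step(2) by auto
      qed
    qed
    then show ?thesis by auto
  qed
  define g where "g p = f (p - 1)" for p :: nat
  have bij: "bij_betw g {1..Suc r} UNIV"
  proof -
    have "bij_betw (\<lambda>p. p - 1) {1..Suc r} {..r}"
      by (rule bij_betwI[of _ _ _ Suc]) auto
    moreover have "bij_betw f {..r} UNIV" using inj surj by (simp add: bij_betw_def)
    ultimately show ?thesis
      unfolding g_def using bij_betw_trans[of "\<lambda>p. p - 1" _ _ f] by (simp add: comp_def)
  qed
  have Mf: "M (f i) (f j) = (if i = j then 1 else if i = Suc j \<or> j = Suc i then 3 else 2)"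
    if ij: "i \<le> r" "j \<le> r" for i j
  proof -
    consider "i = j" | "i = Suc j" | "j = Suc i" | "i \<noteq> j" "i \<noteq> Suc j" "j \<noteq> Suc i" by blast
    then show ?thesis
    proof cases
      case 1
      then show ?thesis using M by (simp add: coxeter_matrix_def)
    next
      case 2
      then show ?thesis using edge[of j] ij sym[of "f i" "f j"] by simp
    next
      case 3
      then show ?thesis using edge[of i] ij by simp
    next
      case 4
      have f_eq: "f u = f v \<longleftrightarrow> u = v" if "u \<le> r" "v \<le> r" for u v
        using inj that by (auto simp: inj_on_def)
      have "f i \<noteq> f j" using 4 ij f_eq by auto
      from M this show ?thesis
      proof (cases rule: coxeter_matrix_cases)
        case 2
        then obtain v where "v \<le> r" "f j = f v" "v = Suc i \<or> i = Suc v"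
          using nb[of i "f j"] \<open>f i \<noteq> f j\<close> ij by metis
        then show ?thesis using 4 ij f_eq by auto
      qed (use 4 in simp)
    qed
  qed
  have "type_A_numbering M (Suc r) g"
    unfolding type_A_numbering_def
  proof (intro conjI ballI)
    fix p q assume "p \<in> {1..Suc r}" "q \<in> {1..Suc r}"
    then obtain i j where "p = Suc i" "q = Suc j" "i \<le> r" "j \<le> r"
      by (metis Suc_le_D Suc_le_mono atLeastAtMost_iff One_nat_def)
    then show "M (g p) (g q) = (if p = q then 1 else if p = q + 1 \<or> q = p + 1 then 3 else 2)"
      using Mf[of i j] by (simp add: g_def)
  qed (use bij in auto)
  moreover have "\<forall>p\<in>{1..Suc r}. d (g p) = (if p = 1 then d a else 2)"
    using two f0 by (auto simp: g_def)
  ultimately have "type_A_end_exponent M d (Suc r) (d a)"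
    unfolding type_A_end_exponent_def by blast
  then show ?thesis by (intro exI[of _ "Suc r"]) simp
qed

section \<open>The word problem in Coxeter groups\<close>

text \<open>
  The aim of this section is the theorem of Matsumoto and Tits: words without a square in their braid
  class are the reduced ones, and reduced words of the same group element are related by braid moves.
\<close>

definition reduced :: "('i \<Rightarrow> 'i \<Rightarrow> enat) \<Rightarrow> 'i list \<Rightarrow> bool" where
  "reduced M u \<longleftrightarrow> (\<forall>v. cox_eq M u v \<longrightarrow> length u \<le> length v)"

text \<open>
  A word $i_1 \dots i_l$ determines the reflections
  $i_1 \cdots i_{p-1}\, i_p\, i_{p-1} \cdots i_1$ for $p \le l$.  This is the parity of the
  number of those \<open>p\<close> for which the reflection equals \<open>t\<close> in the group.
\<close>

fun reflection_parity :: "('i \<Rightarrow> 'i \<Rightarrow> enat) \<Rightarrow> 'i list \<Rightarrow> 'i list \<Rightarrow> bool" where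
  "reflection_parity M [] t \<longleftrightarrow> False"
| "reflection_parity M (i # u) t \<longleftrightarrow> (cox_eq M [i] t \<noteq> reflection_parity M u (i # t @ [i]))"

text \<open>
  The negative of the bilinear form of the geometric representation; the value for \<open>\<infinity>\<close> is the
  limit of the others.
\<close>

definition bond_cos :: "('i \<Rightarrow> 'i \<Rightarrow> enat) \<Rightarrow> 'i \<Rightarrow> 'i \<Rightarrow> real" where
  "bond_cos M i j = (case M i j of enat m \<Rightarrow> cos (pi / real m) | \<infinity> \<Rightarrow> 1)"

text \<open>
  The simple reflections in the dual of the geometric representation, in coordinates with respect to
  the simple roots (the numbers game: firing a node adds multiples of its value to all values).
\<close>

definition fire :: "('i \<Rightarrow> 'i \<Rightarrow> enat) \<Rightarrow> 'i \<Rightarrow> ('i \<Rightarrow> real) \<Rightarrow> 'i \<Rightarrow> real" where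
  "fire M i f = (\<lambda>k. f k + 2 * bond_cos M i k * f i)"

lemma cox_eq_context: "cox_eq M u v \<Longrightarrow> cox_eq M (x @ u @ y) (x @ v @ y)"
  by (intro cox_eq.append cox_eq.refl)

lemma alternating_add:
  "alternating a b (m + n) =
     alternating a b m @ (if even m then alternating a b n else alternating b a n)"
  by (induction m arbitrary: a b) auto

lemma alternating_double: "alternating a b (2 * n) = concat (replicate n [a, b])"
  by (induction n) auto

lemma alternating_snoc: "alternating a b (Suc n) = alternating a b n @ [if even n then a else b]"
  using alternating_add[of a b n 1] by simp

lemma alternating_last:
  assumes "n \<noteq> 0"
  shows "alternating a b n = alternating a b (n - 1) @ [if even n then b else a]"
  using alternating_snoc[of a b "n - 1"] assms by (cases n) auto

lemma rev_alternating:
  "rev (alternating a b n) = (if even n then alternating b a n else alternating a b n)"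
proof (induction n arbitrary: a b)
  case (Suc n)
  have "rev (alternating a b (Suc n)) = rev (alternating b a n) @ [a]" by simp
  also have "\<dots> = (if even (Suc n) then alternating b a (Suc n) else alternating a b (Suc n))"
    unfolding Suc[of b a] alternating_snoc by simp
  finally show ?case .
qed simp

lemma alternating_conjugate:
  "alternating a b n @ (if even n then a else b) # rev (alternating a b n) = alternating a b (2 * n + 1)"
  using alternating_add[of a b n "Suc n"]
  by (simp add: rev_alternating mult_2)

context
  fixes M :: "'i \<Rightarrow> 'i \<Rightarrow> enat"
  assumes M: "coxeter_matrix M"
begin

lemma diag: "M i i = enat 1"
  using M by (simp add: coxeter_matrix_def one_enat_def)

lemma cox_eq_square: "cox_eq M [i, i] []"
  using cox_eq.relator[of M i i 1] diag by simp

lemma cox_eq_cancel_rev: "cox_eq M (u @ rev u) []"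
proof (induction u rule: rev_induct)
  case (snoc i u)
  have "cox_eq M (u @ [i, i] @ rev u) (u @ [] @ rev u)"
    by (intro cox_eq_context cox_eq_square)
  then show ?case using snoc by (auto intro: cox_eq.trans)
qed (simp add: cox_eq.refl)

lemma cox_eq_cancel_rev': "cox_eq M (rev u @ u) []"
  using cox_eq_cancel_rev[of "rev u"] by simp

lemma cox_eq_left_cancel:
  assumes "cox_eq M (x @ u) (x @ v)"
  shows "cox_eq M u v"
proof -
  have "cox_eq M ((rev x @ x) @ w) w" for w
    using cox_eq_context[OF cox_eq_cancel_rev'[of x], of "[]" w] by simp
  moreover have "cox_eq M ((rev x @ x) @ u) ((rev x @ x) @ v)"
    using cox_eq_context[OF assms, of "rev x" "[]"] by simp
  ultimately show ?thesis by (meson cox_eq.sym cox_eq.trans)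
qed

lemma cox_eq_rev:
  assumes "cox_eq M u v"
  shows "cox_eq M (rev u) (rev v)"
proof -
  have "cox_eq M (u @ rev v) (v @ rev v)"
    using cox_eq_context[OF assms, of "[]" "rev v"] by simp
  then have "cox_eq M (u @ rev v) (u @ rev u)"
    using cox_eq_cancel_rev by (meson cox_eq.sym cox_eq.trans)
  then show ?thesis by (meson cox_eq_left_cancel cox_eq.sym)
qed

lemma cox_eq_conjugate: "cox_eq M t (i # s @ [i]) \<longleftrightarrow> cox_eq M (i # t @ [i]) s"
proof -
  have double: "cox_eq M (i # (i # s @ [i]) @ [i]) s" for s
  proof -
    have "cox_eq M ([i, i] @ s @ [i, i]) ([] @ s @ [])"
      by (intro cox_eq.append cox_eq.refl cox_eq_square)
    then show ?thesis by simp
  qed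
  have conj: "cox_eq M (i # t @ [i]) (i # s @ [i])" if "cox_eq M t s" for s t
    using cox_eq_context[OF that, of "[i]" "[i]"] by simp
  show ?thesis
  proof
    assume "cox_eq M t (i # s @ [i])"
    from conj[OF this] double show "cox_eq M (i # t @ [i]) s" by (rule cox_eq.trans)
  next
    assume "cox_eq M (i # t @ [i]) s"
    from cox_eq.sym[OF double] conj[OF this] show "cox_eq M t (i # s @ [i])" by (rule cox_eq.trans)
  qed
qed

lemma cox_eq_even_length: "cox_eq M u v \<Longrightarrow> even (length u) \<longleftrightarrow> even (length v)"
  by (induction rule: cox_eq.induct) (auto simp: length_concat sum_list_replicate)

subsection \<open>Counting reflections modulo two\<close>

lemma reflection_parity_cong:
  "cox_eq M t t' \<Longrightarrow> reflection_parity M u t \<longleftrightarrow> reflection_parity M u t'"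
proof (induction u arbitrary: t t')
  case (Cons i u)
  have "cox_eq M (i # t @ [i]) (i # t' @ [i])"
    using cox_eq_context[OF Cons.prems, of "[i]" "[i]"] by simp
  then show ?case
    using Cons.IH Cons.prems by (auto intro: cox_eq.trans cox_eq.sym)
qed simp

lemma reflection_parity_append:
  "reflection_parity M (u @ v) t \<longleftrightarrow>
     reflection_parity M u t \<noteq> reflection_parity M v (rev u @ t @ u)"
  by (induction u arbitrary: t) auto

text \<open>
  The reflections of an alternating word are given by the alternating words of odd length.
\<close>

lemma reflection_parity_alternating:
  "reflection_parity M (alternating i j n) t \<longleftrightarrow>
     odd (\<Sum>q<n. of_bool (cox_eq M (alternating i j (2 * q + 1)) t) :: nat)"
proof (induction n arbitrary: i j t)
  case (Suc n)
  have "cox_eq M (alternating j i (2 * q + 1)) (i # t @ [i]) \<longleftrightarrow>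
      cox_eq M (alternating i j (2 * Suc q + 1)) t" for q
  proof -
    have "alternating i j (2 * Suc q + 1) = i # alternating j i (2 * q + 1) @ [i]"
      using alternating_snoc[of j i "2 * q + 1"] by simp
    then show ?thesis by (simp only: cox_eq_conjugate)
  qed
  then have "(\<Sum>q<Suc n. of_bool (cox_eq M (alternating i j (2 * q + 1)) t) :: nat) =
      of_bool (cox_eq M [i] t) +
      (\<Sum>q<n. of_bool (cox_eq M (alternating j i (2 * q + 1)) (i # t @ [i])))"
    unfolding sum.lessThan_Suc_shift by simp
  then show ?case
    using Suc[of j i "i # t @ [i]"] by (simp del: sum_of_bool_eq sum.lessThan_Suc)
qed simp

text \<open>
  In the list of the \<open>2 * n\<close> reflections of $(ij)^n$ the second half repeats the first one, since the
  first \<open>2 * n\<close> letters of a long alternating word cancel.  So every reflection occurs an even number of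
  times.
\<close>

lemma reflection_parity_relator:
  assumes "M i j = enat n"
  shows "\<not> reflection_parity M (concat (replicate n [i, j])) t"
proof -
  let ?c = "\<lambda>q. of_bool (cox_eq M (alternating i j (2 * q + 1)) t) :: nat"
  have "cox_eq M (alternating i j (2 * n) @ u) u" for u
    using cox_eq_context[OF cox_eq.relator[of M i j n, OF assms], of "[]" u] by (simp add: alternating_double)
  moreover have "alternating i j (2 * (n + q) + 1) = alternating i j (2 * n) @ alternating i j (2 * q + 1)" for q
    using alternating_add[of i j "2 * n" "2 * q + 1"] by (simp add: algebra_simps)
  ultimately have "cox_eq M (alternating i j (2 * (n + q) + 1)) (alternating i j (2 * q + 1))" for q
    by metis
  then have "cox_eq M (alternating i j (2 * (n + q) + 1)) t \<longleftrightarrow> cox_eq M (alternating i j (2 * q + 1)) t" for q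
    by (meson cox_eq.sym cox_eq.trans)
  then have period: "?c (n + q) = ?c q" for q by (simp only:)
  have "sum ?c {..<n + k} = sum ?c {..<n} + (\<Sum>q<k. ?c (n + q))" for k
    by (induction k) (simp_all del: sum_of_bool_eq)
  then have "sum ?c {..<2 * n} = 2 * sum ?c {..<n}"
    unfolding period by (simp add: mult_2 del: sum_of_bool_eq)
  then have "even (sum ?c {..<2 * n})" by (simp only: dvd_triv_left)
  then show ?thesis
    unfolding alternating_double[symmetric] reflection_parity_alternating by blast
qed

text \<open>
  Hence the parity depends on the group element only.
\<close>

lemma reflection_parity_invariant:
  "cox_eq M u v \<Longrightarrow> reflection_parity M u t \<longleftrightarrow> reflection_parity M v t"
proof (induction arbitrary: t rule: cox_eq.induct)
  case (relator i j n)
  then show ?case using reflection_parity_relator by simp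
next
  case (append u v u' v')
  have "cox_eq M (rev u @ t @ u) (rev v @ t @ v)"
    by (intro cox_eq.append cox_eq.refl cox_eq_rev append.hyps)
  then show ?case
    using append.IH reflection_parity_cong by (simp add: reflection_parity_append)
qed auto

lemma reflection_parity_occurs:
  "reflection_parity M u t \<Longrightarrow> \<exists>x j y. u = x @ j # y \<and> cox_eq M (x @ j # rev x) t"
proof (induction u arbitrary: t)
  case (Cons i u)
  show ?case
  proof (cases "cox_eq M [i] t")
    case True
    then show ?thesis by (intro exI[of _ "[]"]) auto
  next
    case False
    then obtain x j y where u: "u = x @ j # y" "cox_eq M (x @ j # rev x) (i # t @ [i])"
      using Cons.IH[of "i # t @ [i]"] Cons.prems by auto
    then have "cox_eq M ((i # x) @ j # rev (i # x)) t"
      using cox_eq_conjugate[of "x @ j # rev x" i t] by simp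
    with u(1) show ?thesis by (metis append_Cons)
  qed
qed simp

lemma delete_letter:
  assumes "cox_eq M (x @ j # rev x) [i]"
  shows "cox_eq M (i # x @ j # y) (x @ y)"
proof -
  have "cox_eq M ([i] @ x @ j # y) ((x @ j # rev x) @ x @ j # y)"
    using cox_eq.append[OF cox_eq.sym[OF assms] cox_eq.refl] .
  also have "(x @ j # rev x) @ x @ j # y = (x @ [j]) @ (rev x @ x) @ (j # y)" by simp
  finally have 1: "cox_eq M (i # x @ j # y) ((x @ [j]) @ (rev x @ x) @ (j # y))" by simp
  have 2: "cox_eq M ((x @ [j]) @ (rev x @ x) @ (j # y)) ((x @ [j]) @ [] @ (j # y))"
    by (intro cox_eq_context cox_eq_cancel_rev')
  have 3: "cox_eq M (x @ [j, j] @ y) (x @ [] @ y)"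
    by (intro cox_eq_context cox_eq_square)
  show ?thesis
    using cox_eq.trans[OF cox_eq.trans[OF 1 2]] 3 by simp
qed

lemma reduced_cong:
  "reduced M u \<Longrightarrow> cox_eq M u v \<Longrightarrow> length v = length u \<Longrightarrow> reduced M v"
  unfolding reduced_def by (metis cox_eq.trans)

lemma reduced_suffix: "reduced M (x @ u) \<Longrightarrow> reduced M u"
  unfolding reduced_def using cox_eq_context[of M u _ x "[]"] by fastforce

lemma reduced_length_eq: "reduced M u \<Longrightarrow> reduced M v \<Longrightarrow> cox_eq M u v \<Longrightarrow> length u = length v"
  unfolding reduced_def by (meson cox_eq.sym order_antisym)

lemma reduced_exists: "\<exists>v. cox_eq M u v \<and> reduced M v"
proof -
  obtain v where "cox_eq M u v" "\<And>w. cox_eq M u w \<Longrightarrow> length v \<le> length w"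
    using ex_has_least_nat[of "cox_eq M u" u length] cox_eq.refl by blast
  then show ?thesis unfolding reduced_def by (metis cox_eq.trans)
qed

text \<open>
  If \<open>i # u\<close> is not reduced, then \<open>u\<close> is equivalent to a reduced word \<open>i # v\<close>.  The reflection \<open>i\<close>
  occurs at the first letter of \<open>i # v\<close> and not in \<open>v\<close>, since otherwise a letter could be deleted.  Its
  parity is therefore odd for \<open>i # v\<close>, and hence for \<open>u\<close>, where it must occur as well.
\<close>

theorem exchange:
  assumes u: "reduced M u" and iu: "\<not> reduced M (i # u)"
  obtains x j y where "u = x @ j # y" "cox_eq M (x @ j # rev x) [i]" "cox_eq M (i # u) (x @ y)"
proof -
  obtain v where v: "cox_eq M (i # u) v" "reduced M v" using reduced_exists by blast
  have "length v < length (i # u)"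
    using iu v unfolding reduced_def by (metis cox_eq.trans cox_eq.sym not_le order_trans)
  moreover have "even (length v) \<longleftrightarrow> even (length (i # u))"
    using cox_eq_even_length[OF v(1)] by simp
  ultimately have len: "length v < length u"
    by (cases "length v = length u") auto
  have "cox_eq M ([i] @ [i] @ u) ([i] @ v)"
    using cox_eq_context[OF v(1), of "[i]" "[]"] by simp
  moreover have "cox_eq M ([i, i] @ u) ([] @ u)"
    by (intro cox_eq.append cox_eq.refl cox_eq_square)
  ultimately have iv: "cox_eq M u (i # v)"
    by (metis append_Cons append_Nil cox_eq.sym cox_eq.trans)
  have "\<not> reflection_parity M v [i]"
  proof
    assume "reflection_parity M v [i]"
    then obtain x j y where xy: "v = x @ j # y" "cox_eq M (x @ j # rev x) [i]"
      using reflection_parity_occurs by blast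
    then have "cox_eq M (i # v) (x @ y)" using delete_letter by simp
    then have "length u \<le> length (x @ y)" using u iv unfolding reduced_def by (metis cox_eq.trans)
    then show False using len xy(1) by simp
  qed
  moreover have "cox_eq M [i, i, i] [i]"
    using cox_eq.append[OF cox_eq_square[of i] cox_eq.refl[of M "[i]"]] by simp
  ultimately have "reflection_parity M (i # v) [i]"
    using reflection_parity_cong[of "[i, i, i]" "[i]" v] by (simp add: cox_eq.refl)
  then have "reflection_parity M u [i]"
    using reflection_parity_invariant[OF iv] by simp
  then obtain x j y where "u = x @ j # y" "cox_eq M (x @ j # rev x) [i]"
    using reflection_parity_occurs by blast
  with delete_letter[of x j i y] show thesis using that by simp
qed

subsection \<open>The order of a product of two simple reflections\<close>

lemma bond_cos_diag: "bond_cos M i i = - 1"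
  by (simp add: bond_cos_def diag)

lemma bond_cos_sym: "bond_cos M i j = bond_cos M j i"
  using M by (simp add: bond_cos_def coxeter_matrix_def)

text \<open>
  When \<open>i\<close> and \<open>j\<close> are fired alternately, the values fired satisfy a three-term recurrence.  If \<open>v\<close>
  is its solution with the right initial values, \<open>v t\<close> is the value that is fired at time \<open>t\<close>, and
  every node accumulates the partial sums of \<open>v\<close> over the even and over the odd times, weighted by
  its bonds to \<open>i\<close> and to \<open>j\<close>.
\<close>

lemma fold_fire_alternating:
  fixes v :: "real \<Rightarrow> real"
  assumes rec: "\<And>t. v (t + 1) + v (t - 1) = 2 * bond_cos M i j * v t"
    and init: "f i = v 0" "f j = - v (- 1)"
  shows "fold (fire M) (concat (replicate q [i, j])) f k =
      f k + 2 * bond_cos M i k * (\<Sum>p<q. v (2 * real p)) + 2 * bond_cos M j k * (\<Sum>p<q. v (2 * real p + 1))"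
    and "fold (fire M) (concat (replicate q [i, j])) f i = v (2 * real q)"
    and "fold (fire M) (concat (replicate q [i, j])) f j = - v (2 * real q - 1)"
proof -
  have snoc: "concat (replicate (Suc q) [i, j]) = concat (replicate q [i, j]) @ [i, j]" for q
    by (induction q) auto
  have "(\<forall>k. fold (fire M) (concat (replicate q [i, j])) f k =
      f k + 2 * bond_cos M i k * (\<Sum>p<q. v (2 * real p)) + 2 * bond_cos M j k * (\<Sum>p<q. v (2 * real p + 1))) \<and>
    fold (fire M) (concat (replicate q [i, j])) f i = v (2 * real q) \<and>
    fold (fire M) (concat (replicate q [i, j])) f j = - v (2 * real q - 1)"
  proof (induction q)
    case 0
    then show ?case using init by simp
  next
    case (Suc q)
    define g where "g = fold (fire M) (concat (replicate q [i, j])) f"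
    have g: "g i = v (2 * real q)" "g j = - v (2 * real q - 1)" using Suc by (auto simp: g_def)
    have next1: "fire M i g j = v (2 * real q + 1)"
      using rec[of "2 * real q"] by (simp add: fire_def g)
    have step: "fold (fire M) (concat (replicate (Suc q) [i, j])) f k =
        g k + 2 * bond_cos M i k * v (2 * real q) + 2 * bond_cos M j k * v (2 * real q + 1)" for k
      unfolding snoc fold_append comp_def g_def[symmetric]
      by (simp add: fire_def[of M j] next1) (simp add: fire_def g)
    have "g i + 2 * bond_cos M i i * v (2 * real q) + 2 * bond_cos M j i * v (2 * real q + 1) =
        v (2 * real (Suc q))"
      using rec[of "2 * real q + 1"] bond_cos_sym[of i j] by (simp add: g bond_cos_diag algebra_simps)
    moreover have "g j + 2 * bond_cos M i j * v (2 * real q) + 2 * bond_cos M j j * v (2 * real q + 1) =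
        - v (2 * real (Suc q) - 1)"
      using rec[of "2 * real q"] by (simp add: g bond_cos_diag algebra_simps)
    moreover have "g k = f k + 2 * bond_cos M i k * (\<Sum>p<q. v (2 * real p)) +
        2 * bond_cos M j k * (\<Sum>p<q. v (2 * real p + 1))" for k
      using Suc by (simp add: g_def)
    ultimately show ?case
      unfolding step by (simp add: algebra_simps)
  qed
  then show "fold (fire M) (concat (replicate q [i, j])) f k =
      f k + 2 * bond_cos M i k * (\<Sum>p<q. v (2 * real p)) + 2 * bond_cos M j k * (\<Sum>p<q. v (2 * real p + 1))"
    and "fold (fire M) (concat (replicate q [i, j])) f i = v (2 * real q)"
    and "fold (fire M) (concat (replicate q [i, j])) f j = - v (2 * real q - 1)"
    by blast+
qed

text \<open>
  A wave sampled \<open>n\<close> times in equal steps over one full period has sum 0; multiplied by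
  \<open>2 * sin (pi / n)\<close> the sum telescopes.
\<close>

lemma sum_wave_eq_0:
  assumes "2 \<le> n"
  shows "(\<Sum>p<n. A * cos ((2 * real p + s) * (pi / real n)) + B * sin ((2 * real p + s) * (pi / real n))) = 0"
proof -
  define h where "h = pi / real n"
  define w where "w t = A * sin (t * h) - B * cos (t * h)" for t
  have h: "0 < h" "h < pi" using assms by (auto simp: h_def field_simps)
  have step: "2 * sin h * (A * cos (t * h) + B * sin (t * h)) = w (t + 1) - w (t - 1)" for t
    by (simp add: w_def distrib_right left_diff_distrib sin_add sin_diff cos_add cos_diff algebra_simps)
  have "2 * sin h * (\<Sum>p<n. A * cos ((2 * real p + s) * h) + B * sin ((2 * real p + s) * h)) =
      (\<Sum>p<n. w (2 * real p + s + 1) - w (2 * real p + s - 1))"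
    by (simp only: sum_distrib_left step)
  also have "\<dots> = (\<Sum>p<n. w (2 * real (Suc p) + s - 1) - w (2 * real p + s - 1))"
    by (intro sum.cong arg_cong2[of _ _ _ _ minus] arg_cong[of _ _ w]) auto
  also have "\<dots> = w (2 * real n + s - 1) - w (s - 1)"
    by (subst sum_lessThan_telescope) simp
  also have "\<dots> = 0"
  proof -
    have "(2 * real n + s - 1) * h = (s - 1) * h + 2 * pi"
      using assms by (simp add: h_def field_simps)
    then show ?thesis by (simp add: w_def)
  qed
  finally show ?thesis
    using sin_gt_zero[OF h] by (simp add: h_def)
qed

lemma fold_fire_relator:
  assumes "M i j = enat n"
  shows "fold (fire M) (concat (replicate n [i, j])) f = f"
proof (cases "i = j")
  case True
  then have "n = 1" using assms diag by simp
  then show ?thesis using True by (auto simp: fire_def bond_cos_diag)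
next
  case False
  then have n: "2 \<le> n" using M assms by (metis coxeter_matrix_def enat_ord_simps(1) numeral_eq_enat)
  define h where "h = pi / real n"
  have h: "0 < h" "h < pi" using n by (auto simp: h_def field_simps)
  have "sin h \<noteq> 0" using sin_gt_zero[OF h] by simp
  (* The amplitudes of the wave with value f i at time 0 and value - f j at time - 1. *)
  define B where "B = (f i * cos h + f j) / sin h"
  define v where "v t = f i * cos (t * h) + B * sin (t * h)" for t
  have c: "bond_cos M i j = cos h" by (simp add: bond_cos_def assms h_def)
  have rec: "v (t + 1) + v (t - 1) = 2 * bond_cos M i j * v t" for t
    by (simp add: v_def c distrib_right left_diff_distrib sin_add sin_diff cos_add cos_diff algebra_simps)
  have init: "f i = v 0" "f j = - v (- 1)"
    using \<open>sin h \<noteq> 0\<close> by (simp_all add: v_def B_def)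
  have "(\<Sum>p<n. v (2 * real p)) = 0" "(\<Sum>p<n. v (2 * real p + 1)) = 0"
    using sum_wave_eq_0[OF n, of "f i" 0 B] sum_wave_eq_0[OF n, of "f i" 1 B]
    by (simp_all add: v_def h_def)
  then show ?thesis
    using fold_fire_alternating(1)[of v i j f, OF rec init] by (intro ext) simp
qed

lemma fold_fire_cong: "cox_eq M u v \<Longrightarrow> fold (fire M) u = fold (fire M) v"
proof (induction rule: cox_eq.induct)
  case (relator i j n)
  then show ?case using fold_fire_relator by auto
qed auto

text \<open>
  Fire \<open>i\<close> and \<open>j\<close> alternately, starting from the value 0 at \<open>i\<close> and 1 at \<open>j\<close>.  The value fired at
  time \<open>t\<close> is proportional to \<open>sin (t * pi / m)\<close>, or equal to \<open>t\<close> if the bond is infinite.  In the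
  first case the initial values do not recur before time \<open>2 * m\<close>, and in the second case never.
\<close>

theorem order_simple_product:
  assumes "i \<noteq> j" "0 < q" "cox_eq M (concat (replicate q [i, j])) []"
  shows "M i j \<le> enat q"
proof -
  define f where "f k = (if k = j then 1 else 0 :: real)" for k
  have f: "f i = 0" "f j = 1" using assms(1) by (auto simp: f_def)
  have eq: "fold (fire M) (concat (replicate q [i, j])) f = f"
    using fold_fire_cong[OF assms(3)] by simp
  show ?thesis
  proof (cases "M i j")
    case (enat m)
    show ?thesis
    proof (rule ccontr)
      assume "\<not> M i j \<le> enat q"
      then have qm: "q < m" using enat by simp
      then have m: "2 \<le> m" using assms(2) by simp
      define h where "h = pi / real m"
      have h: "0 < h" "h < pi" using m by (auto simp: h_def field_simps)
      have sin: "sin h > 0" using sin_gt_zero[OF h] .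
      define v where "v t = sin (t * h) / sin h" for t
      have c: "bond_cos M i j = cos h" by (simp add: bond_cos_def enat h_def)
      have rec: "v (t + 1) + v (t - 1) = 2 * bond_cos M i j * v t" for t
        by (simp add: v_def c distrib_right left_diff_distrib sin_add sin_diff algebra_simps add_divide_distrib[symmetric])
      have init: "f i = v 0" "f j = - v (- 1)" using f sin by (simp_all add: v_def)
      have "v (2 * real q) = 0" "v (2 * real q - 1) = - 1"
        using fold_fire_alternating(2,3)[of v i j f q, OF rec init] eq f by auto
      then have s: "sin (2 * real q * h) = 0" "sin ((2 * real q - 1) * h) = - sin h"
        using sin by (auto simp: v_def field_simps)
      have "sin ((2 * real q - 1) * h) = sin (2 * real q * h) * cos h - cos (2 * real q * h) * sin h"
        by (simp add: left_diff_distrib sin_diff)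
      then have "cos (2 * real q * h) = 1" using s sin by simp
      then have "cos (2 * (real q * h)) = 1" by (simp add: mult.assoc)
      then have "sin (real q * h) = 0" by (simp add: cos_double_sin)
      moreover have "0 < real q * h" "real q * h < pi"
        using qm assms(2) h m by (auto simp: h_def field_simps)
      ultimately show False using sin_gt_zero by fastforce
    qed
  next
    case infinity
    have "bond_cos M i j = 1" by (simp add: bond_cos_def infinity)
    then have "2 * real q = 0"
      using fold_fire_alternating(2)[of "\<lambda>t. t" i j f q] eq f by simp
    then show ?thesis using assms(2) by simp
  qed
qed

subsection \<open>Reduced words of the same element are related by braid moves\<close>

lemma cox_eq_braid:
  assumes "M i j = enat m"
  shows "cox_eq M (alternating i j m) (alternating j i m)"
proof -
  have "alternating i j (m + m) = alternating i j m @ rev (alternating j i m)"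
    unfolding alternating_add rev_alternating by simp
  then have "cox_eq M (alternating i j m @ rev (alternating j i m)) []"
    using cox_eq.relator[of M i j m, OF assms] by (simp add: alternating_double flip: mult_2)
  then have "cox_eq M ((alternating i j m @ rev (alternating j i m)) @ alternating j i m) ([] @ alternating j i m)"
    by (intro cox_eq.append cox_eq.refl)
  moreover have "cox_eq M (alternating i j m @ (rev (alternating j i m) @ alternating j i m)) (alternating i j m @ [])"
    by (intro cox_eq.append cox_eq.refl cox_eq_cancel_rev')
  ultimately show ?thesis by (metis append_Nil append_Nil2 append_assoc cox_eq.sym cox_eq.trans)
qed

lemma braid_cong_imp_cox_eq: "word_cong (braid_rel M J0) u v \<Longrightarrow> J0 \<subseteq> braid_pairs M \<Longrightarrow> cox_eq M u v"
proof (induction rule: word_cong.induct)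
  case (relation u v)
  then obtain a b where ab: "u = alternating a b (the_enat (M a b))" "v = alternating b a (the_enat (M a b))"
      "{a, b} \<in> braid_pairs M" by (auto simp: braid_rel_def)
  then have "M a b < \<infinity>"
    using M by (auto simp: braid_pairs_def doubleton_eq_iff coxeter_matrix_def)
  then show ?case using ab cox_eq_braid by auto
qed (auto intro: cox_eq.intros)

text \<open>
  If an element has reduced words that start with \<open>i\<close> and with \<open>j\<close>, it has a reduced word that starts
  with the alternating word of length \<open>q\<close>, for every \<open>q \<le> M i j\<close>.  Given such a word for \<open>q\<close>, starting
  with \<open>j\<close>, the exchange condition for \<open>i\<close> deletes a letter.  If that letter lies behind the alternating
  prefix, putting \<open>i\<close> in front makes the prefix longer.  If it lies in the prefix, a power of
  the product of the two generators with exponent less than \<open>M i j\<close> is trivial, contrary to \<open>order_simple_product\<close>.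
\<close>

lemma reduced_starting_letters:
  assumes u: "reduced M u" and i: "\<not> reduced M (i # u)" and j: "\<not> reduced M (j # u)" and ij: "i \<noteq> j"
    and q: "enat q \<le> M i j"
  shows "\<exists>x. cox_eq M u (alternating i j q @ x) \<and> length (alternating i j q @ x) = length u"
  using i j ij q
proof (induction q arbitrary: i j)
  case 0
  then show ?case by (intro exI[of _ u]) (simp add: cox_eq.refl)
next
  case (Suc q)
  have sym: "M j i = M i j" using M by (simp add: coxeter_matrix_def)
  have "enat q \<le> M j i" using Suc.prems(4) by (simp add: sym order_trans[of _ "enat (Suc q)"])
  then obtain x where x: "cox_eq M u (alternating j i q @ x)" "length (alternating j i q @ x) = length u"
    using Suc.IH[of j i] Suc.prems by auto
  let ?w = "alternating j i q @ x"
  have w: "reduced M ?w" using reduced_cong[OF u x] .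
  have "cox_eq M (i # u) (i # ?w)" using cox_eq_context[OF x(1), of "[i]" "[]"] by simp
  then have iw: "\<not> reduced M (i # ?w)"
    using Suc.prems(1) reduced_cong[of "i # ?w" "i # u"] x(2) cox_eq.sym by force
  obtain p l r where plr: "?w = p @ l # r" "cox_eq M (p @ l # rev p) [i]" "cox_eq M (i # ?w) (p @ r)"
    using exchange[OF w iw] .
  show ?case
  proof (cases "length p < q")
    case True
    define s where "s = length p"
    have "p @ [l] = take (Suc s) ?w" using plr(1) by (simp add: s_def)
    also have "\<dots> = take (Suc s) (alternating j i q)" using True by (simp add: s_def)
    also have "\<dots> = alternating j i (Suc s)"
      using alternating_add[of j i "Suc s" "q - Suc s"] True by (simp add: s_def)
    also have "\<dots> = alternating j i s @ [if even s then j else i]" by (rule alternating_snoc)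
    finally have "p = alternating j i s" "l = (if even s then j else i)" by auto
    then have "p @ l # rev p = alternating j i (2 * s + 1)" using alternating_conjugate[of j i s] by simp
    then have "cox_eq M (alternating j i (2 * s + 1) @ [i]) ([i] @ [i])"
      using plr(2) by (intro cox_eq.append cox_eq.refl) simp
    then have "cox_eq M (alternating j i (2 * Suc s)) []"
      using alternating_snoc[of j i "2 * s + 1"] cox_eq_square[of i] by (auto intro: cox_eq.trans)
    then have "M j i \<le> enat (Suc s)"
      using order_simple_product[of j i "Suc s"] Suc.prems(3) by (simp only: alternating_double) simp
    then have "enat (Suc q) \<le> enat (Suc s)" using Suc.prems(4) sym by (metis order_trans)
    then show ?thesis using True by (simp add: s_def)
  next
    case False
    then have "p = alternating j i q @ drop q p"
      using plr(1) by (metis append_eq_append_conv_if append_take_drop_id length_alternating not_less)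
    define y where "y = drop q p @ r"
    have pr: "p @ r = alternating j i q @ y"
      using \<open>p = alternating j i q @ drop q p\<close> by (metis append_assoc y_def)
    have "cox_eq M ([i] @ i # ?w) ([i] @ p @ r)" using plr(3) by (intro cox_eq.append cox_eq.refl)
    moreover have "cox_eq M ([i, i] @ ?w) ([] @ ?w)" by (intro cox_eq.append cox_eq.refl cox_eq_square)
    ultimately have "cox_eq M ?w (i # p @ r)"
      by (metis append_Cons append_Nil cox_eq.sym cox_eq.trans)
    then have "cox_eq M u (alternating i j (Suc q) @ y)"
      using x(1) pr by (auto intro: cox_eq.trans)
    moreover have "length (alternating i j (Suc q) @ y) = length u"
      using x(2) plr(1) pr by (metis (no_types, lifting) One_nat_def add.commute add_Suc_right alternating.simps(2) append_Cons length_Cons length_append)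
    ultimately show ?thesis by blast
  qed
qed

text \<open>
  Let the words start with \<open>i\<close> and \<open>j\<close>.  If \<open>i = j\<close>, cancel.  Otherwise \<open>reduced_starting_letters\<close> provides
  a word with prefix one side of the braid relation; this word agrees with \<open>u\<close> in the first letter, and after
  a braid move it agrees with \<open>v\<close>.  In both comparisons the induction hypothesis applies to the tails.
\<close>

theorem matsumoto:
  assumes "reduced M u" "reduced M v" "cox_eq M u v"
  shows "word_cong (braid_rel M (braid_pairs M)) u v"
  using assms
proof (induction "length u" arbitrary: u v rule: less_induct)
  case less
  let ?B = "word_cong (braid_rel M (braid_pairs M))"
  have len: "length u = length v" using reduced_length_eq less.prems by blast
  have same_head: "?B (i # x) (i # y)"
    if "reduced M (i # x)" "reduced M (i # y)" "cox_eq M (i # x) (i # y)" "length (i # x) = length u" for i x y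
  proof -
    have "?B x y"
      using that less.hyps[of x y] reduced_suffix[of "[i]"] cox_eq_left_cancel[of "[i]" x y] by auto
    then show ?thesis using word_cong_context[of _ x y "[i]" "[]"] by simp
  qed
  show ?case
  proof (cases u)
    case Nil
    then show ?thesis using len by (simp add: word_cong.refl)
  next
    case (Cons i u')
    then obtain j v' where v: "v = j # v'" using len by (cases v) auto
    show ?thesis
    proof (cases "i = j")
      case True
      then show ?thesis using same_head[of i u' v'] less.prems Cons v by simp
    next
      case False
      have drop_head: "\<not> reduced M (i # w)" if "cox_eq M w (i # x)" "length w = Suc (length x)" for i w x
      proof -
        have "cox_eq M ([i] @ w) ([i] @ i # x)" using that(1) by (intro cox_eq.append cox_eq.refl)
        moreover have "cox_eq M ([i, i] @ x) ([] @ x)" by (intro cox_eq.append cox_eq.refl cox_eq_square)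
        ultimately have "cox_eq M (i # w) x" by (auto intro: cox_eq.trans)
        then show ?thesis using that(2) unfolding reduced_def by fastforce
      qed
      have i: "\<not> reduced M (i # u)" using drop_head[of u i u'] Cons by (simp add: cox_eq.refl)
      have j: "\<not> reduced M (j # u)" using drop_head[of u j v'] less.prems(3) v len by simp
      note start = reduced_starting_letters[OF less.prems(1) i j False]
      show ?thesis
      proof (cases "M i j")
        case infinity
        then obtain x where "length (alternating i j (Suc (length u)) @ x) = length u"
          using start[of "Suc (length u)"] by auto
        then show ?thesis by simp
      next
        case (enat m)
        then obtain x where x: "cox_eq M u (alternating i j m @ x)" "length (alternating i j m @ x) = length u"
          using start[of m] by auto
        have "2 \<le> M i j" using M False by (simp add: coxeter_matrix_def)
        then have "m \<noteq> 0" using enat by (auto simp: numeral_eq_enat)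
        then obtain m' where m': "m = Suc m'" by (cases m) auto
        have 1: "?B u (alternating i j m @ x)"
          using same_head[of i u' "alternating j i m' @ x"] less.prems(1) x Cons m'
            reduced_cong[OF less.prems(1) x] by simp
        have "{i, j} \<in> braid_pairs M"
          using False enat unfolding braid_pairs_def by (intro CollectI exI[of _ i] exI[of _ j]) simp
        then have pair: "(alternating i j m, alternating j i m) \<in> braid_rel M (braid_pairs M)"
          using False enat unfolding braid_rel_def by (intro CollectI exI[of _ i] exI[of _ j]) simp
        then have 2: "?B (alternating i j m @ x) (alternating j i m @ x)"
          by (intro word_cong.append word_cong.refl word_cong.relation)
        have x': "cox_eq M u (alternating j i m @ x)"
          using x(1) braid_cong_imp_cox_eq[OF 2] by (auto intro: cox_eq.trans)
        have red: "reduced M (alternating j i m @ x)"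
          using reduced_cong[OF less.prems(1) x'] x(2) by simp
        have 3: "?B (alternating j i m @ x) v"
          using same_head[of j "alternating i j m' @ x" v'] less.prems red x(2) m' v x'
          by (auto intro: cox_eq.trans cox_eq.sym)
        show ?thesis using 1 2 3 by (blast intro: word_cong.trans)
      qed
    qed
  qed
qed

text \<open>
  A square can be cancelled, so a vanishing word is not reduced.  Conversely, take the longest reduced
  suffix \<open>u\<close> of a word that is not reduced, and the letter \<open>i\<close> before it.  By the exchange condition and
  Matsumoto's theorem braid moves turn \<open>u\<close> into a word that starts with \<open>i\<close>, which creates a square.
\<close>

theorem vanishing_iff_not_reduced:
  assumes "\<And>i. d i = 2"
  shows "vanishing (braid_rel M (braid_pairs M)) (zero_words M d (braid_pairs M)) u \<longleftrightarrow> \<not> reduced M u"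
    (is "?V u \<longleftrightarrow> _")
proof
  have Z: "zero_words M d (braid_pairs M) = {[i, i] |i. True}"
    by (auto simp: zero_words_def assms numeral_2_eq_2)
  show "\<not> reduced M u" if V: "?V u"
  proof -
    obtain x i y where wc: "word_cong (braid_rel M (braid_pairs M)) u (x @ [i, i] @ y)"
      using V unfolding vanishing_def Z by blast
    then have c: "cox_eq M u (x @ [i, i] @ y)" by (rule braid_cong_imp_cox_eq) simp
    have len: "length u = length (x @ [i, i] @ y)"
      by (rule word_cong_length[OF _ wc]) (rule braid_rel_length)
    have "cox_eq M u (x @ [] @ y)"
      using c cox_eq_context[OF cox_eq_square] by (rule cox_eq.trans)
    then show ?thesis unfolding reduced_def using len by fastforce
  qed
  show "?V u" if "\<not> reduced M u"
    using that
  proof (induction u)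
    case Nil
    then show ?case by (simp add: reduced_def)
  next
    case (Cons i u)
    show ?case
    proof (cases "reduced M u")
      case False
      then show ?thesis using Cons vanishing_context[of _ _ u "[i]" "[]"] by simp
    next
      case True
      obtain x j y where u: "u = x @ j # y" "cox_eq M (i # u) (x @ y)"
        using exchange[OF True Cons.prems] by blast
      have "cox_eq M ([i] @ i # u) ([i] @ x @ y)" using u(2) by (intro cox_eq.append cox_eq.refl)
      moreover have "cox_eq M ([i, i] @ u) ([] @ u)" by (intro cox_eq.append cox_eq.refl cox_eq_square)
      ultimately have c: "cox_eq M u (i # x @ y)"
        by (metis append_Cons append_Nil cox_eq.sym cox_eq.trans)
      then have "reduced M (i # x @ y)" using reduced_cong[OF True] u(1) by simp
      then have "word_cong (braid_rel M (braid_pairs M)) u (i # x @ y)" using matsumoto[OF True _ c] by blast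
      then have "word_cong (braid_rel M (braid_pairs M)) ([i] @ u) ([i] @ i # x @ y)"
        by (intro word_cong.append word_cong.refl)
      then have "word_cong (braid_rel M (braid_pairs M)) (i # u) ([] @ [i, i] @ (x @ y))" by simp
      then show ?thesis unfolding vanishing_def Z by blast
    qed
  qed
qed

text \<open>
  Every element has a reduced word, and all of its reduced words lie in one class.
\<close>

theorem classes_bij_coxeter_group:
  assumes "\<And>i. d i = 2"
  shows "bij_betw (\<lambda>C. \<Union>u\<in>C. {w. cox_eq M u w})
    (nil_Hecke_classes M d (braid_pairs M)) (carrier (coxeter_group M))"
proof -
  let ?g = "\<lambda>C. \<Union>u\<in>C. {w. cox_eq M u w}"
  let ?R = "braid_rel M (braid_pairs M)"
  have g: "?g {v. word_cong ?R u v} = {w. cox_eq M u w}" for u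
    using braid_cong_imp_cox_eq[of "braid_pairs M" u] word_cong.refl[of ?R u]
    by (auto intro: cox_eq.trans)
  have classes: "nil_Hecke_classes M d (braid_pairs M) = {{v. word_cong ?R u v} |u. reduced M u}"
    unfolding nonzero_classes_def vanishing_iff_not_reduced[OF assms] by (auto simp: quotient_def)
  show ?thesis
  proof (rule bij_betw_imageI)
    show "inj_on ?g (nil_Hecke_classes M d (braid_pairs M))"
    proof (rule inj_onI)
      fix C D assume "C \<in> nil_Hecke_classes M d (braid_pairs M)" "D \<in> nil_Hecke_classes M d (braid_pairs M)"
        and eq: "?g C = ?g D"
      then obtain u v where u: "C = {w. word_cong ?R u w}" "reduced M u"
        and v: "D = {w. word_cong ?R v w}" "reduced M v" unfolding classes by blast
      have "{w. cox_eq M u w} = {w. cox_eq M v w}" using eq g[of u] g[of v] unfolding u v by simp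
      then have "cox_eq M u v" using cox_eq.refl[of M v] by blast
      then show "C = D" unfolding u v class_eq_iff using matsumoto u(2) v(2) by blast
    qed
    have "?g ` nil_Hecke_classes M d (braid_pairs M) = {{w. cox_eq M u w} |u. reduced M u}"
      unfolding classes using g by (auto simp: image_iff; metis)
    also have "\<dots> = {{w. cox_eq M u w} |u. True}"
    proof -
      have "\<exists>v. {w. cox_eq M u w} = {w. cox_eq M v w} \<and> reduced M v" for u
      proof -
        obtain v where "cox_eq M u v" "reduced M v" using reduced_exists by blast
        then show ?thesis by (intro exI[of _ v]) (auto intro: cox_eq.trans cox_eq.sym)
      qed
      then show ?thesis by blast
    qed
    also have "\<dots> = carrier (coxeter_group M)"
      by (auto simp: coxeter_group_def quotient_def)
    finally show "?g ` nil_Hecke_classes M d (braid_pairs M) = carrier (coxeter_group M)" .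
  qed
qed

end

section \<open>Counting in type A with one large exponent at an end\<close>

text \<open>
  For the letters \<open>1, \<dots>, n\<close> of type A with exponent \<open>e\<close> at 1, the normal forms are the words
  $w\, 1^k\, 2\, 3 \cdots m$ with \<open>1 \<le> k < e\<close> and \<open>1 \<le> m \<le> n\<close>, or just \<open>w\<close>, where \<open>w\<close> is a normal form
  for the letters \<open>2, \<dots>, n\<close>, whose exponents are 2.  Such a form is encoded by the pair \<open>(k, m)\<close>,
  which is \<open>(0, 0)\<close> in the case of \<open>w\<close> alone, followed by the code of \<open>w\<close> with its letters lowered by 1.

  The function describes what a letter \<open>j\<close> multiplied from the right does to the factor
  $1^k\, 2 \cdots m$: it kills it, or it changes \<open>(k, m)\<close>, or it moves through to the left and acts on
  \<open>w\<close>.  In the last case the output contains the letter that emerges on the left, lowered by 1.  A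
  letter \<open>j > m + 1\<close> emerges unchanged, and a letter \<open>j < m\<close> emerges as \<open>j + 1\<close>; but if \<open>j = 1\<close> this
  creates a square when \<open>k > 1\<close>, and the product vanishes.
\<close>

definition letter_output :: "nat \<Rightarrow> nat \<Rightarrow> nat \<times> nat \<Rightarrow> (nat list \<times> nat \<times> nat) option" where
  "letter_output e j p = (case p of (k, m) \<Rightarrow>
     if k = 0 then (if j = 1 then Some ([], 1, 1) else Some ([j - 1], 0, m))
     else if j = m + 1 then Some ([], k, m + 1)
     else if m + 1 < j then Some ([j - 1], k, m)
     else if j = m then (if m = 1 \<and> k + 1 < e then Some ([], k + 1, 1) else None)
     else if j = 1 \<and> k \<noteq> 1 then None else Some ([j], k, m))"

primrec step :: "nat \<Rightarrow> nat \<Rightarrow> (nat \<times> nat) list \<Rightarrow> (nat \<times> nat) list option" where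
  "step e j [] = None"
| "step e j (p # x) = (case letter_output e j p of
     None \<Rightarrow> None
   | Some (w, q) \<Rightarrow> (case w of [] \<Rightarrow> Some (q # x) | i # _ \<Rightarrow> map_option (Cons q) (step 2 i x)))"

fun word_output :: "nat \<Rightarrow> nat list \<Rightarrow> nat \<times> nat \<Rightarrow> (nat list \<times> nat \<times> nat) option" where
  "word_output e [] p = Some ([], p)"
| "word_output e (j # u) p = (case letter_output e j p of
     None \<Rightarrow> None
   | Some (w, q) \<Rightarrow> map_option (\<lambda>(v, r). (w @ v, r)) (word_output e u q))"

text \<open>
  The outermost pair works as a transducer whose output acts on the rest of the state.  This reduces an
  identity between words at the outermost pair to identities between the emitted words one level below.
\<close>

lemma run_step_Cons:
  "run (step e) u (p # x) = (case word_output e u p of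
     None \<Rightarrow> None | Some (w, q) \<Rightarrow> map_option (Cons q) (run (step 2) w x))"
proof (induction u arbitrary: p x)
  case (Cons j u)
  show ?case
  proof (cases "letter_output e j p")
    case (Some wq)
    obtain w k m where wq: "wq = (w, k, m)" by (cases wq)
    have "w = [] \<or> (\<exists>i. w = [i])"
      using Some wq by (auto simp: letter_output_def split: prod.splits if_splits)
    then show ?thesis
      using Some wq Cons
      by (auto simp: run_append split: option.splits Option.bind_splits)
  qed simp
qed simp

definition type_A_relations_hold :: "nat \<Rightarrow> (nat \<times> nat) list \<Rightarrow> bool" where
  "type_A_relations_hold e x \<longleftrightarrow>
     run (step e) (replicate e 1) x = None \<and>
     (\<forall>j\<ge>2. run (step e) [j, j] x = None) \<and>
     (\<forall>i j. 1 \<le> i \<longrightarrow> i + 2 \<le> j \<longrightarrow> run (step e) [i, j] x = run (step e) [j, i] x) \<and>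
     (\<forall>i\<ge>1. run (step e) [i, Suc i, i] x = run (step e) [Suc i, i, Suc i] x)"

lemma type_A_relations_Nil: "2 \<le> e \<Longrightarrow> type_A_relations_hold e []"
  by (cases e) (auto simp: type_A_relations_hold_def)

text \<open>
  At the outermost pair, each side of a relation either kills or emits a word, and the emitted
  words are equal, or they are the two sides of a relation of the same kind, or they contain a square.
\<close>

lemma type_A_relations_Cons:
  assumes x: "type_A_relations_hold 2 x" and e: "2 \<le> e" and km: "1 \<le> k \<Longrightarrow> 1 \<le> m"
  shows "type_A_relations_hold e ((k, m) # x)"
proof -
  have sq: "run (step 2) [j, j] x = None" if "1 \<le> j" for j
  proof (cases "j = 1")
    case True
    then show ?thesis using x by (simp add: type_A_relations_hold_def numeral_2_eq_2)
  next
    case False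
    then have "2 \<le> j" using that by simp
    then show ?thesis using x unfolding type_A_relations_hold_def by blast
  qed
  have comm: "run (step 2) [i, j] x = run (step 2) [j, i] x" if "1 \<le> i" "i + 2 \<le> j" for i j
    using x that unfolding type_A_relations_hold_def by blast
  have braid: "run (step 2) [i, Suc i, i] x = run (step 2) [Suc i, i, Suc i] x" if "1 \<le> i" for i
    using x that unfolding type_A_relations_hold_def by blast
  note run.simps [simp del]
  have "run (step e) [j, j] ((k, m) # x) = None" if "2 \<le> j" for j
  proof -
    consider "k = 0" | "0 < k" "m + 1 < j" | "0 < k" "j = m + 1" | "0 < k" "j = m" | "0 < k" "j < m" by linarith
    then show ?thesis
      by cases (use that sq[of j] sq[of "j - 1"] km in \<open>auto simp: run_step_Cons letter_output_def\<close>)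
  qed
  moreover have "run (step e) [i, j] ((k, m) # x) = run (step e) [j, i] ((k, m) # x)"
    if ij: "1 \<le> i" "i + 2 \<le> j" for i j
  proof -
    consider "k = 0" "i = 1" | "k = 0" "2 \<le> i" | "0 < k" "m + 1 < i" | "0 < k" "m \<le> i" "i \<le> m + 1"
      | "0 < k" "i < m" using ij(1) by linarith
    then show ?thesis
    proof cases
      case 2
      then show ?thesis using ij comm[of "i - 1" "j - 1"] by (simp add: run_step_Cons letter_output_def)
    next
      case 3
      then show ?thesis using ij comm[of "i - 1" "j - 1"] by (simp add: run_step_Cons letter_output_def)
    next
      case 5
      consider "m + 1 < j" | "m \<le> j" "j \<le> m + 1" | "j < m" by linarith
      then show ?thesis
      proof cases
        case 1
        then show ?thesis using 5 ij comm[of i "j - 1"] by (simp add: run_step_Cons letter_output_def)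
      next
        case 2
        then have "j = m \<or> j = m + 1" by linarith
        then show ?thesis using 5 ij by (auto simp: run_step_Cons letter_output_def)
      next
        case 3
        then show ?thesis using 5 ij comm[of i j] by (simp add: run_step_Cons letter_output_def)
      qed
    next
      case 4
      then have "i = m \<or> i = m + 1" by linarith
      then show ?thesis using 4(1) ij km by (auto simp: run_step_Cons letter_output_def)
    qed (use ij in \<open>simp add: run_step_Cons letter_output_def\<close>)
  qed
  moreover have "run (step e) [i, Suc i, i] ((k, m) # x) = run (step e) [Suc i, i, Suc i] ((k, m) # x)"
    if i: "1 \<le> i" for i
  proof -
    consider "k = 0" "i = 1" | "k = 0" "2 \<le> i" | "0 < k" "m + 1 < i" | "0 < k" "m \<le> Suc i" "i \<le> m + 1"
      | "0 < k" "Suc i < m" using i by linarith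
    then show ?thesis
    proof cases
      case 2
      then show ?thesis using braid[of "i - 1"] by (simp add: run_step_Cons letter_output_def)
    next
      case 3
      then show ?thesis using i braid[of "i - 1"] by (simp add: run_step_Cons letter_output_def)
    next
      case 4
      then have "Suc i = m \<or> i = m \<or> i = m + 1" by linarith
      then show ?thesis using 4(1) i km by (auto simp: run_step_Cons letter_output_def)
    next
      case 5
      then show ?thesis using i braid[of i] by (simp add: run_step_Cons letter_output_def)
    qed (simp add: run_step_Cons letter_output_def)
  qed
  moreover have "run (step e) (replicate e 1) ((k, m) # x) = None"
  proof -
    have grow: "word_output e (replicate q 1) (l, 1) = None" if "1 \<le> l" "e \<le> l + q" "0 < q" for q l
      using that by (induction q arbitrary: l) (auto simp: letter_output_def)
    obtain e' where e': "e = Suc (Suc e')" using e by (metis Suc_le_D numeral_2_eq_2 Suc_le_mono)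
    consider "k = 0" | "0 < k" "m = 1" | "0 < k" "1 < m" using km by linarith
    then show ?thesis
    proof cases
      case 1
      have "word_output e (replicate (Suc e') 1) (1, 1) = None" using grow[of 1 "Suc e'"] e' by simp
      then have "word_output e (replicate e 1) (k, m) = None"
        using 1 by (simp add: e' letter_output_def)
      then show ?thesis by (simp add: run_step_Cons)
    next
      case 2
      then have "word_output e (replicate e 1) (k, m) = None" using grow[of k e] e by simp
      then show ?thesis by (simp add: run_step_Cons)
    next
      case 3
      have "run (step e) ([1, 1] @ replicate e' 1) ((k, m) # x) = None"
      proof -
        have "run (step e) [1, 1] ((k, m) # x) = None"
          using 3 sq[of 1] by (auto simp: run_step_Cons letter_output_def)
        then show ?thesis by (simp only: run_append) simp
      qed
      then show ?thesis by (simp add: e')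
    qed
  qed
  ultimately show ?thesis unfolding type_A_relations_hold_def by blast
qed

fun valid_state :: "nat \<Rightarrow> (nat \<times> nat) list \<Rightarrow> bool" where
  "valid_state e [] \<longleftrightarrow> True"
| "valid_state e ((k, m) # x) \<longleftrightarrow>
     (k = 0 \<and> m = 0 \<or> 1 \<le> k \<and> k < e \<and> 1 \<le> m \<and> m \<le> Suc (length x)) \<and> valid_state 2 x"

definition states :: "nat \<Rightarrow> nat \<Rightarrow> (nat \<times> nat) list set" where
  "states e n = {x. length x = n \<and> valid_state e x}"

lemma valid_type_A_relations:
  assumes "2 \<le> e" "valid_state e x"
  shows "type_A_relations_hold e x"
  using assms
proof (induction e x rule: valid_state.induct)
  case (2 e k m x)
  then show ?case by (intro type_A_relations_Cons) auto
qed (rule type_A_relations_Nil)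

lemma states_Suc:
  "states e (Suc n) = (\<lambda>(p, x). p # x) ` (insert (0, 0) ({1..<e} \<times> {1..Suc n}) \<times> states 2 n)"
proof (rule Set.set_eqI)
  fix y
  show "y \<in> states e (Suc n) \<longleftrightarrow>
      y \<in> (\<lambda>(p, x). p # x) ` (insert (0, 0) ({1..<e} \<times> {1..Suc n}) \<times> states 2 n)"
  proof (cases y)
    case (Cons p x)
    obtain k m where "p = (k, m)" by (cases p)
    with Cons show ?thesis by (force simp: states_def)
  qed (auto simp: states_def)
qed

lemma states_0: "states e 0 = {[]}"
  by (auto simp: states_def)

lemma card_states_Suc:
  assumes "finite (states 2 n)"
  shows "card (states e (Suc n)) = (1 + (e - 1) * Suc n) * card (states 2 n)"
proof -
  have "inj_on (\<lambda>(p, x). p # x) (insert (0, 0) ({1..<e} \<times> {1..Suc n}) \<times> states 2 n)"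
    by (auto simp: inj_on_def)
  then show ?thesis
    unfolding states_Suc by (simp add: card_image card_cartesian_product)
qed

lemma finite_states: "finite (states e n)"
  by (induction n arbitrary: e) (auto simp: states_0 states_Suc)

lemma card_states_2: "card (states 2 n) = fact (Suc n)"
proof (induction n)
  case (Suc n)
  then show ?case by (simp add: card_states_Suc finite_states)
qed (simp add: states_0)

lemma card_states: "1 \<le> n \<Longrightarrow> card (states e n) = fact n * (1 + n * (e - 1))"
  by (cases n) (simp_all add: card_states_Suc finite_states card_states_2 algebra_simps)

definition state_word_top :: "nat \<times> nat \<Rightarrow> nat list" where
  "state_word_top p = (case p of (k, m) \<Rightarrow> if k = 0 then [] else replicate k 1 @ [2..<Suc m])"

fun state_word :: "(nat \<times> nat) list \<Rightarrow> nat list" where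
  "state_word [] = []"
| "state_word (p # x) = map Suc (state_word x) @ state_word_top p"

definition type_A_rel :: "nat \<Rightarrow> (nat list \<times> nat list) set" where
  "type_A_rel n = {([i, j], [j, i]) |i j. 1 \<le> i \<and> i + 2 \<le> j \<and> j \<le> n} \<union>
     {([i, Suc i, i], [Suc i, i, Suc i]) |i. 1 \<le> i \<and> Suc i \<le> n}"

definition type_A_zero :: "nat \<Rightarrow> nat \<Rightarrow> nat list set" where
  "type_A_zero e n = {z. z = replicate e 1 \<and> 1 \<le> n} \<union> {[j, j] |j. 2 \<le> j \<and> j \<le> n}"

lemma type_A_rel_Suc: "(u, v) \<in> type_A_rel n \<Longrightarrow> word_cong (type_A_rel (Suc n)) (map Suc u) (map Suc v)"
  by (rule word_cong.relation) (auto simp: type_A_rel_def)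

lemma type_A_zero_Suc:
  "z \<in> type_A_zero 2 n \<Longrightarrow> vanishing (type_A_rel (Suc n)) (type_A_zero e (Suc n)) (map Suc z)"
  using vanishing_factor[of "map Suc z" "type_A_zero e (Suc n)" "type_A_rel (Suc n)" "[]" "[]"]
  by (auto simp: type_A_zero_def numeral_2_eq_2)

lemma vanishing_type_A_Suc:
  "vanishing (type_A_rel n) (type_A_zero 2 n) u \<Longrightarrow>
     vanishing (type_A_rel (Suc n)) (type_A_zero e (Suc n)) (map Suc u)"
  by (erule vanishing_map[rotated 2]) (erule type_A_rel_Suc type_A_zero_Suc)+

lemma commute_past:
  assumes "\<And>l. l \<in> set w \<Longrightarrow> 1 \<le> l \<and> l + 2 \<le> j" "j \<le> n"
  shows "word_cong (type_A_rel n) (w @ [j]) (j # w)"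
  using assms(1)
proof (induction w)
  case (Cons l w)
  have "word_cong (type_A_rel n) (l # w @ [j]) ([l] @ j # w)"
    using word_cong_context[OF Cons.IH, of "[l]" "[]"] Cons.prems by simp
  moreover have "word_cong (type_A_rel n) ([l, j] @ w) ([j, l] @ w)"
    using Cons.prems assms(2)
    by (intro word_cong.append word_cong.refl word_cong.relation) (auto simp: type_A_rel_def)
  ultimately show ?case by (auto intro: word_cong.trans)
qed (simp add: word_cong.refl)

lemma commute_past':
  assumes "\<And>l. l \<in> set w \<Longrightarrow> j + 2 \<le> l \<and> l \<le> n" "1 \<le> j"
  shows "word_cong (type_A_rel n) (w @ [j]) (j # w)"
  using assms(1)
proof (induction w)
  case (Cons l w)
  have "word_cong (type_A_rel n) (l # w @ [j]) ([l] @ j # w)"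
    using word_cong_context[OF Cons.IH, of "[l]" "[]"] Cons.prems by simp
  moreover have "word_cong (type_A_rel n) ([l, j] @ w) ([j, l] @ w)"
    using Cons.prems assms(2)
    by (intro word_cong.append word_cong.refl word_cong.sym[OF word_cong.relation]) (auto simp: type_A_rel_def)
  ultimately show ?case by (auto intro: word_cong.trans)
qed (simp add: word_cong.refl)

text \<open>
  How the letter \<open>j\<close> passes an increasing run: it commutes back to \<open>[j, Suc j]\<close>, is exchanged by the
  braid relation for a letter \<open>Suc j\<close>, and this letter commutes with all that remains on the left.
\<close>

lemma slide_left:
  assumes A: "\<And>l. l \<in> set A \<Longrightarrow> 1 \<le> l \<and> l < j" and B: "\<And>l. l \<in> set B \<Longrightarrow> j + 2 \<le> l \<and> l \<le> n"
    and j: "1 \<le> j" "Suc j \<le> n"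
  shows "word_cong (type_A_rel n) ((A @ [j, Suc j] @ B) @ [j]) (Suc j # A @ [j, Suc j] @ B)"
proof -
  have "word_cong (type_A_rel n) ((A @ [j, Suc j]) @ (B @ [j]) @ []) ((A @ [j, Suc j]) @ (j # B) @ [])"
    by (intro word_cong_context commute_past' B j)
  moreover have "word_cong (type_A_rel n) (A @ [j, Suc j, j] @ B) (A @ [Suc j, j, Suc j] @ B)"
    using j by (intro word_cong_context word_cong.relation) (auto simp: type_A_rel_def)
  moreover have "word_cong (type_A_rel n) ([] @ (A @ [Suc j]) @ [j, Suc j] @ B) ([] @ (Suc j # A) @ [j, Suc j] @ B)"
    using A j(2) by (intro word_cong_context commute_past) fastforce+
  ultimately show ?thesis by (auto intro: word_cong.trans)
qed

lemma upt_split: "i \<le> j \<Longrightarrow> j \<le> k \<Longrightarrow> [i..<k] = [i..<j] @ [j..<k]"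
  by (metis le_add_diff_inverse upt_add_eq_append)

text \<open>
  The rules of \<open>letter_output\<close> hold in the monoid.
\<close>

lemma state_word_top_step:
  assumes e: "2 \<le> e" and j: "1 \<le> j" "j \<le> n"
    and p: "k = 0 \<and> m = 0 \<or> 1 \<le> k \<and> k < e \<and> 1 \<le> m \<and> m \<le> n"
  shows "case letter_output e j (k, m) of
      None \<Rightarrow> vanishing (type_A_rel n) (type_A_zero e n) (state_word_top (k, m) @ [j])
    | Some (w, q) \<Rightarrow> word_cong (type_A_rel n) (state_word_top (k, m) @ [j]) (map Suc w @ state_word_top q) \<and>
        (\<forall>i\<in>set w. 1 \<le> i \<and> Suc i \<le> n) \<and> length w \<le> 1 \<and>
        (case q of (k', m') \<Rightarrow> k' = 0 \<and> m' = 0 \<or> 1 \<le> k' \<and> k' < e \<and> 1 \<le> m' \<and> m' \<le> n)"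
proof -
  consider (start) "k = 0" | (high) "1 \<le> k" "m + 1 < j" | (grow) "1 \<le> k" "j = m + 1"
    | (square) "1 \<le> k" "j = m" "2 \<le> m" | (power) "1 \<le> k" "j = m" "m = 1"
    | (low) "1 \<le> k" "j < m" "2 \<le> j \<or> k = 1" | (dead) "2 \<le> k" "j < m" "j = 1"
    using j p by linarith
  then show ?thesis
  proof cases
    case start
    then show ?thesis using p e j
      by (auto simp: letter_output_def state_word_top_def intro: word_cong.refl)
  next
    case high
    have "word_cong (type_A_rel n) (state_word_top (k, m) @ [j]) (j # state_word_top (k, m))"
      using high j p by (intro commute_past) (auto simp: state_word_top_def split: if_splits)
    then show ?thesis using high p j by (auto simp: letter_output_def)
  next
    case grow
    then have "state_word_top (k, m) @ [j] = state_word_top (k, m + 1)"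
      using p by (auto simp: state_word_top_def)
    then show ?thesis using grow p j by (auto simp: letter_output_def intro: word_cong.refl)
  next
    case square
    then have "state_word_top (k, m) @ [j] = (replicate k 1 @ [2..<m]) @ [m, m] @ []"
      by (simp add: state_word_top_def)
    moreover have "[m, m] \<in> type_A_zero e n" using square j by (auto simp: type_A_zero_def)
    ultimately have "vanishing (type_A_rel n) (type_A_zero e n) (state_word_top (k, m) @ [j])"
      using vanishing_factor by metis
    then show ?thesis using square by (simp add: letter_output_def)
  next
    case power
    have eq: "state_word_top (k, m) @ [j] = replicate (Suc k) 1"
      using power by (simp add: state_word_top_def replicate_append_same)
    show ?thesis
    proof (cases "k + 1 < e")
      case True
      then have "replicate (Suc k) 1 = state_word_top (Suc k, 1)" by (simp add: state_word_top_def)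
      then show ?thesis using True power eq j by (auto simp: letter_output_def intro: word_cong.refl)
    next
      case False
      then have "Suc k = e" using p power by linarith
      then have "replicate (Suc k) 1 \<in> type_A_zero e n" using j by (auto simp: type_A_zero_def)
      then have "vanishing (type_A_rel n) (type_A_zero e n) (state_word_top (k, m) @ [j])"
        using vanishing_factor[of _ _ _ "[]" "[]"] eq by simp
      then show ?thesis using False power by (simp add: letter_output_def)
    qed
  next
    case low
    define A where "A = (if j = 1 then [] else replicate k 1 @ [2..<j])"
    have split: "[2..<Suc m] = (if j = 1 then [2] else [2..<j] @ [j, Suc j]) @ [j + 2..<Suc m]"
    proof (cases "j = 1")
      case True
      then show ?thesis using low by (simp add: upt_rec numeral_2_eq_2 numeral_3_eq_3)
    next
      case False
      then have "[2..<Suc m] = [2..<j] @ [j..<j + 2] @ [j + 2..<Suc m]"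
        using low j upt_split[of 2 j "Suc m"] upt_split[of j "j + 2" "Suc m"] by simp
      then show ?thesis using False by (simp add: upt_rec)
    qed
    have "state_word_top (k, m) = replicate k 1 @ [2..<Suc m]"
      using low by (simp add: state_word_top_def del: upt_Suc)
    also have "\<dots> = A @ [j, Suc j] @ [j + 2..<Suc m]"
      unfolding split A_def using low by (auto simp: numeral_2_eq_2 simp del: upt_Suc)
    finally have eq: "state_word_top (k, m) = A @ [j, Suc j] @ [j + 2..<Suc m]" .
    have "word_cong (type_A_rel n) (state_word_top (k, m) @ [j]) (Suc j # state_word_top (k, m))"
      unfolding eq using low j p by (intro slide_left) (auto simp: A_def split: if_splits)
    then show ?thesis using low j p by (auto simp: letter_output_def)
  next
    case dead
    (* The letter 1 emerges from the last 1 2 of the run as a 2; the 1 before it then brings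
       about 1 2 1 2 = 2 1 2 2, which contains a square. *)
    have upt: "[2..<Suc m] = 2 # [3..<Suc m]" using dead by (simp add: upt_rec numeral_2_eq_2 numeral_3_eq_3)
    have "replicate k 1 = replicate (k - 2 + 2) (1::nat)"
      using dead(1) by (simp only: le_add_diff_inverse2)
    also have "\<dots> = replicate (k - 2) 1 @ replicate 2 1" by (rule replicate_add)
    also have "replicate 2 (1::nat) = [1, Suc 0]" by (simp add: numeral_2_eq_2)
    finally have ones: "replicate k 1 = replicate (k - 2) 1 @ [1, Suc 0]" .
    have "state_word_top (k, m) = replicate k 1 @ [2..<Suc m]"
      using dead by (simp add: state_word_top_def del: upt_Suc)
    then have eq: "state_word_top (k, m) @ [j] =
        (replicate (k - 2) 1 @ [1]) @ (([] @ [1, Suc 1] @ [3..<Suc m]) @ [1]) @ []"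
      unfolding ones upt using dead by (simp add: numeral_2_eq_2 del: upt_Suc)
    have "word_cong (type_A_rel n) (state_word_top (k, m) @ [j])
        ((replicate (k - 2) 1 @ [1]) @ (Suc 1 # [] @ [1, Suc 1] @ [3..<Suc m]) @ [])"
      unfolding eq using dead p by (intro word_cong_context slide_left) auto
    moreover have "word_cong (type_A_rel n)
        (replicate (k - 2) 1 @ [1, Suc 1, 1] @ Suc 1 # [3..<Suc m])
        (replicate (k - 2) 1 @ [Suc 1, 1, Suc 1] @ Suc 1 # [3..<Suc m])"
      using dead p by (intro word_cong_context word_cong.relation) (auto simp: type_A_rel_def)
    ultimately have "word_cong (type_A_rel n) (state_word_top (k, m) @ [j])
        ((replicate (k - 2) 1 @ [2, 1]) @ [2, 2] @ [3..<Suc m])"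
      by (auto intro: word_cong.trans simp: numeral_2_eq_2)
    moreover have "[2, 2] \<in> type_A_zero e n" using dead p by (auto simp: type_A_zero_def)
    ultimately have "vanishing (type_A_rel n) (type_A_zero e n) (state_word_top (k, m) @ [j])"
      unfolding vanishing_def by blast
    then show ?thesis using dead by (simp add: letter_output_def)
  qed
qed

lemma state_word_step:
  assumes "2 \<le> e" "1 \<le> j" "j \<le> length x" "valid_state e x"
  shows "case step e j x of
      None \<Rightarrow> vanishing (type_A_rel (length x)) (type_A_zero e (length x)) (state_word x @ [j])
    | Some y \<Rightarrow> word_cong (type_A_rel (length x)) (state_word x @ [j]) (state_word y) \<and>
        valid_state e y \<and> length y = length x"
  using assms
proof (induction x arbitrary: e j)
  case (Cons p x)
  obtain k m where p: "p = (k, m)" by (cases p)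
  let ?n = "length (p # x)"
  let ?C = "word_cong (type_A_rel ?n)" and ?V = "vanishing (type_A_rel ?n) (type_A_zero e ?n)"
  note top = state_word_top_step[of e j ?n k m]
  have ctx: "?C (state_word (p # x) @ [j]) (map Suc (state_word x) @ v)" if "?C (state_word_top p @ [j]) v" for v
    using word_cong_context[OF that, of "map Suc (state_word x)" "[]"] by simp
  show ?case
  proof (cases "letter_output e j p")
    case None
    then have "?V (state_word_top p @ [j])" using top Cons.prems p by auto
    then have "?V (state_word (p # x) @ [j])"
      using vanishing_context[of _ _ _ "map Suc (state_word x)" "[]"] by fastforce
    then show ?thesis using None by simp
  next
    case (Some wq)
    obtain w k' m' where wq: "wq = (w, (k', m'))" by (cases wq) auto
    have t: "?C (state_word_top p @ [j]) (map Suc w @ state_word_top (k', m'))"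
      "\<forall>i\<in>set w. 1 \<le> i \<and> Suc i \<le> ?n" "length w \<le> 1"
      "k' = 0 \<and> m' = 0 \<or> 1 \<le> k' \<and> k' < e \<and> 1 \<le> m' \<and> m' \<le> ?n"
      using top Cons.prems p Some wq by auto
    have c: "?C (state_word (p # x) @ [j]) (map Suc (state_word x @ w) @ state_word_top (k', m'))"
      using ctx[OF t(1)] by simp
    show ?thesis
    proof (cases w)
      case Nil
      then show ?thesis using Some wq c t Cons.prems p by simp
    next
      case (Cons i w')
      then have w: "w = [i]" using t(3) by simp
      have IH: "case step 2 i x of
          None \<Rightarrow> vanishing (type_A_rel (length x)) (type_A_zero 2 (length x)) (state_word x @ [i])
        | Some y \<Rightarrow> word_cong (type_A_rel (length x)) (state_word x @ [i]) (state_word y) \<and>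
            valid_state 2 y \<and> length y = length x"
        using Cons.IH[of 2 i] t(2) w Cons.prems p by simp
      show ?thesis
      proof (cases "step 2 i x")
        case None
        then have "?V (map Suc (state_word x @ [i]))"
          using IH vanishing_type_A_Suc[of "length x" "state_word x @ [i]" e] by simp
        then have "?V (map Suc (state_word x @ w) @ state_word_top (k', m'))"
          using vanishing_context[of _ _ _ "[]"] w by fastforce
        then show ?thesis using vanishing_cong[OF c] Some wq w None by simp
      next
        case (Some y)
        then have y: "word_cong (type_A_rel (length x)) (state_word x @ [i]) (state_word y)"
          "valid_state 2 y" "length y = length x" using IH by auto
        have "?C (map Suc (state_word x @ [i])) (map Suc (state_word y))"
          using word_cong_map[of "type_A_rel (length x)" "type_A_rel (Suc (length x))" Suc, OF type_A_rel_Suc y(1)]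
          by simp
        then have "?C (map Suc (state_word x @ w) @ state_word_top (k', m')) (state_word ((k', m') # y))"
          using word_cong.append[OF _ word_cong.refl] w by fastforce
        with c have "?C (state_word (p # x) @ [j]) (state_word ((k', m') # y))" by (rule word_cong.trans)
        moreover have "step e j (p # x) = Some ((k', m') # y)"
          using \<open>letter_output e j p = Some wq\<close> wq w Some by simp
        ultimately show ?thesis using y t(4) by simp
      qed
    qed
  qed
qed simp

lemma letters_state_word: "valid_state e x \<Longrightarrow> j \<in> set (state_word x) \<Longrightarrow> 1 \<le> j \<and> j \<le> length x"
  by (induction e x arbitrary: j rule: valid_state.induct)
     (fastforce simp: state_word_top_def split: if_splits)+

lemma run_state_word:
  assumes "valid_state e x" "2 \<le> e"
  shows "run (step e) (state_word x) (replicate (length x) (0, 0)) = Some x"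
  using assms
proof (induction x arbitrary: e)
  case (Cons p x)
  obtain k m where p: "p = (k, m)" by (cases p)
  have pass: "word_output e (map Suc u) (0, 0) = Some (u, (0, 0))" if "\<forall>j\<in>set u. 1 \<le> j" for u
    using that by (induction u) (auto simp: letter_output_def)
  have ones: "run (step e) (replicate q 1) ((l, 1) # x) = Some ((l + q, 1) # x)" if "1 \<le> l" "l + q < e" for q l
    using that by (induction q arbitrary: l) (auto simp: letter_output_def)
  have up: "run (step e) [2..<Suc m] ((k, 1) # x) = Some ((k, m) # x)" if "1 \<le> k" "1 \<le> m" for m
    using that(2)
  proof (induction m rule: nat_induct_at_least)
    case (Suc m)
    then have "[2..<Suc (Suc m)] = [2..<Suc m] @ [Suc m]" by simp
    then show ?case using Suc that(1) by (simp only: run_append) (simp add: letter_output_def)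
  qed simp
  have "run (step 2) (state_word x) (replicate (length x) (0, 0)) = Some x"
    using Cons p by simp
  then have 1: "run (step e) (map Suc (state_word x)) (replicate (length (p # x)) (0, 0)) = Some ((0, 0) # x)"
    using pass[of "state_word x"] letters_state_word[of 2 x] Cons.prems p
    by (simp add: run_step_Cons)
  have 2: "run (step e) (state_word_top p) ((0, 0) # x) = Some (p # x)"
  proof (cases "k = 0")
    case True
    then show ?thesis using p Cons.prems by (simp add: state_word_top_def)
  next
    case False
    then obtain l where l: "k = Suc l" by (cases k) auto
    have "run (step e) (replicate k 1) ((0, 0) # x) = run (step e) (replicate l 1) ((1, 1) # x)"
      by (simp add: l letter_output_def)
    also have "\<dots> = Some ((k, 1) # x)" using ones[of 1 l] Cons.prems p l by simp
    finally show ?thesis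
      using up[of m] False p Cons.prems by (simp add: state_word_top_def run_append)
  qed
  show ?case using 1 2 by (simp add: run_append)
qed simp

lemma type_A_end_first:
  assumes "type_A_end_exponent M d n e"
  obtains f where "type_A_numbering M n f" "\<And>p. p \<in> {1..n} \<Longrightarrow> d (f p) = (if p = 1 then e else 2)"
proof -
  obtain f where f: "type_A_numbering M n f"
    and d: "(\<forall>p\<in>{1..n}. d (f p) = (if p = 1 then e else 2)) \<or>
      (\<forall>p\<in>{1..n}. d (f p) = (if p = n then e else 2))"
    using assms by (auto simp: type_A_end_exponent_def)
  from d show thesis
  proof
    assume "\<forall>p\<in>{1..n}. d (f p) = (if p = 1 then e else 2)"
    with f show thesis using that by blast
  next
    assume last: "\<forall>p\<in>{1..n}. d (f p) = (if p = n then e else 2)"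
    define r where "r p = n + 1 - p" for p
    have r: "r p \<in> {1..n}" if "p \<in> {1..n}" for p using that by (auto simp: r_def)
    have "bij_betw r {1..n} {1..n}"
      by (rule bij_betwI[of _ _ _ r]) (auto simp: r_def)
    then have "bij_betw (f \<circ> r) {1..n} UNIV"
      using f by (auto simp: type_A_numbering_def intro: bij_betw_trans)
    moreover have "M (f (r p)) (f (r q)) = (if p = q then 1 else if p = q + 1 \<or> q = p + 1 then 3 else 2)"
      if pq: "p \<in> {1..n}" "q \<in> {1..n}" for p q
    proof -
      have "r p = r q \<longleftrightarrow> p = q" "r p = r q + 1 \<or> r q = r p + 1 \<longleftrightarrow> p = q + 1 \<or> q = p + 1"
        using pq by (auto simp: r_def)
      then show ?thesis
        using f r[OF pq(1)] r[OF pq(2)] unfolding type_A_numbering_def by simp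
    qed
    ultimately have "type_A_numbering M n (f \<circ> r)"
      using f by (simp add: type_A_numbering_def)
    moreover have "d ((f \<circ> r) p) = (if p = 1 then e else 2)" if "p \<in> {1..n}" for p
      using last r[OF that] that by (auto simp: r_def)
    ultimately show thesis using that by blast
  qed
qed

text \<open>
  The states are the normal forms, and the numbering carries the action on them over to the given
  index type.
\<close>

theorem card_classes_type_A:
  fixes M :: "'i \<Rightarrow> 'i \<Rightarrow> enat"
  assumes e: "2 \<le> e" and k: "4 \<le> k" and A: "type_A_end_exponent M d n e"
  shows "finite (nil_Hecke_classes M d (braid_pairs_less M k))"
    and "card (nil_Hecke_classes M d (braid_pairs_less M k)) = fact n * (1 + n * (e - 1))"
proof -
  obtain f where f: "type_A_numbering M n f" and d: "\<And>p. p \<in> {1..n} \<Longrightarrow> d (f p) = (if p = 1 then e else 2)"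
    using type_A_end_first[OF A] by blast
  have n: "1 \<le> n" and bij: "bij_betw f {1..n} UNIV"
    and Mf: "\<And>p q. p \<in> {1..n} \<Longrightarrow> q \<in> {1..n} \<Longrightarrow>
        M (f p) (f q) = (if p = q then 1 else if p = q + 1 \<or> q = p + 1 then 3 else 2)"
    using f by (auto simp: type_A_numbering_def)
  define g where "g = the_inv_into {1..n} f"
  have gf: "g (f p) = p" if "p \<in> {1..n}" for p
    using bij that unfolding g_def bij_betw_def by (simp add: the_inv_into_f_f)
  have g: "g i \<in> {1..n}" "f (g i) = i" for i
    using bij the_inv_into_into[of f "{1..n}" i "{1..n}"] unfolding g_def bij_betw_def
    by (simp_all add: f_the_inv_into_f)
  have g_eq: "g i = g j \<longleftrightarrow> i = j" for i j by (metis g(2))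
  let ?J = "braid_pairs_less M k"
  have M: "M i j = (if g i = g j then 1 else if g i = g j + 1 \<or> g j = g i + 1 then 3 else 2)" for i j
    using Mf[OF g(1)[of i] g(1)[of j]] g(2) by metis
  have small: "M i j < \<infinity>" "M i j < k" for i j
  proof -
    have le: "M i j \<le> enat 3" using M[of i j] by (auto simp: numeral_eq_enat one_enat_def)
    have "enat 3 < enat 4" by simp
    also have "enat 4 \<le> k" using k by (simp add: numeral_eq_enat)
    finally have "enat 3 < k" .
    with le show "M i j < k" by (rule le_less_trans)
    show "M i j < \<infinity>" using le by (cases "M i j") auto
  qed
  have J: "{i, j} \<in> ?J" if "i \<noteq> j" for i j
    using small that unfolding braid_pairs_less_def by blast
  have all: "braid_pairs M - ?J = {}" using small by (auto simp: braid_pairs_def braid_pairs_less_def)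
  have R: "braid_rel M ?J = {(alternating i j (the_enat (M i j)), alternating j i (the_enat (M i j))) |i j. i \<noteq> j}"
    unfolding braid_rel_def using J by blast
  have Z: "zero_words M d ?J = {replicate (d i) i |i. True}"
    unfolding zero_words_def all by blast
  have di: "d i = (if g i = 1 then e else 2)" for i using d[OF g(1)[of i]] g(2) by simp
  define act where "act = (\<lambda>i y. if y \<in> states e n then step e (g i) y else None)"
  have closed: "z \<in> states e n" if "j \<in> {1..n}" "y \<in> states e n" "step e j y = Some z" for j y z
    using state_word_step[of e j y] that e by (auto simp: states_def)
  have run: "run act u y = run (step e) (map g u) y" if "y \<in> states e n" for u y
  proof -
    have "run act u y = run (\<lambda>j y. if y \<in> states e n then step e j y else None) (map g u) y"
      unfolding act_def using run_comp[of "\<lambda>j y. if y \<in> states e n then step e j y else None" g u y] by simp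
    also have "\<dots> = run (step e) (map g u) y"
      by (rule run_restrict[of "{1..n}"]) (use closed that g in auto)
    finally show ?thesis .
  qed
  have undefined: "run act u y = None" if "y \<notin> states e n" "u \<noteq> []" for u y
    using that by (cases u) (auto simp: act_def)
  have hold: "type_A_relations_hold e y" if "y \<in> states e n" for y
    using that valid_type_A_relations[OF e] by (simp add: states_def)
  have braid: "run act (alternating i j (the_enat (M i j))) y = run act (alternating j i (the_enat (M i j))) y"
    if "i \<noteq> j" for i j y
  proof (cases "y \<in> states e n")
    case False
    have "the_enat (M i j) \<noteq> 0" using M[of i j] by (auto simp: numeral_eq_enat one_enat_def)
    then have "alternating i j (the_enat (M i j)) \<noteq> []" "alternating j i (the_enat (M i j)) \<noteq> []"
      by (metis length_alternating list.size(3))+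
    then show ?thesis using undefined[OF False] by simp
  next
    case True
    note h = hold[OF True, unfolded type_A_relations_hold_def]
    have ne: "g i \<noteq> g j" using g_eq that by simp
    have pos: "1 \<le> g i" "1 \<le> g j" using g(1) by auto
    have near: "run (step e) [p, q, p] y = run (step e) [q, p, q] y" if "p = q + 1 \<or> q = p + 1" "1 \<le> p" "1 \<le> q" for p q
      using h that by (elim disjE) simp_all
    have far: "run (step e) [p, q] y = run (step e) [q, p] y" if "p + 2 \<le> q \<or> q + 2 \<le> p" "1 \<le> p" "1 \<le> q" for p q
      using h that by (elim disjE) metis+
    show ?thesis
    proof (cases "g i = g j + 1 \<or> g j = g i + 1")
      case adj: True
      then have "M i j = enat 3" using M[of i j] ne by (simp add: numeral_eq_enat)
      then show ?thesis
        unfolding run[OF True] using near[OF adj pos] by (simp add: numeral_3_eq_3)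
    next
      case False
      then have "M i j = enat 2" using M[of i j] ne by (simp add: numeral_eq_enat)
      moreover have "g i + 2 \<le> g j \<or> g j + 2 \<le> g i" using False ne by linarith
      ultimately show ?thesis
        unfolding run[OF True] using far pos by (simp add: numeral_2_eq_2)
    qed
  qed
  have power: "run act (replicate (d i) i) y = None" for i y
  proof (cases "y \<in> states e n")
    case False
    moreover have "d i \<noteq> 0" using e di[of i] by (simp split: if_splits)
    ultimately show ?thesis using undefined[of y "replicate (d i) i"] by simp
  next
    case True
    note h = hold[OF True, unfolded type_A_relations_hold_def]
    show ?thesis
    proof (cases "g i = 1")
      case 1: True
      then show ?thesis unfolding run[OF True] using h by (simp add: di)
    next
      case False
      then have "2 \<le> g i" using g(1)[of i] by auto
      then show ?thesis unfolding run[OF True] using h False by (simp add: di numeral_2_eq_2)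
    qed
  qed
  have respects: "respects_relations (braid_rel M ?J) (zero_words M d ?J) act"
    unfolding respects_relations_def R Z using braid power by (auto simp: fun_eq_iff)
  have rel_f: "word_cong (braid_rel M ?J) (map f u) (map f v)" if "(u, v) \<in> type_A_rel n" for u v
  proof -
    have "(map f u, map f v) \<in> braid_rel M ?J"
    proof -
      consider (far) p q where "u = [p, q]" "v = [q, p]" "1 \<le> p" "p + 2 \<le> q" "q \<le> n"
        | (near) p where "u = [p, Suc p, p]" "v = [Suc p, p, Suc p]" "1 \<le> p" "Suc p \<le> n"
        using \<open>(u, v) \<in> type_A_rel n\<close> unfolding type_A_rel_def by blast
      then show ?thesis
      proof cases
        case far
        then have "M (f p) (f q) = enat 2" "f p \<noteq> f q"
          using Mf[of p q] gf[of p] gf[of q] by (auto simp: numeral_eq_enat)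
        then show ?thesis unfolding R far
          by (intro CollectI exI[of _ "f p"] exI[of _ "f q"]) (simp add: numeral_2_eq_2)
      next
        case near
        then have "M (f p) (f (Suc p)) = enat 3" "f p \<noteq> f (Suc p)"
          using Mf[of p "Suc p"] gf[of p] gf[of "Suc p"] by (auto simp: numeral_eq_enat)
        then show ?thesis unfolding R near
          by (intro CollectI exI[of _ "f p"] exI[of _ "f (Suc p)"]) (simp add: numeral_3_eq_3)
      qed
    qed
    then show ?thesis by (rule word_cong.relation)
  qed
  have zero_f: "vanishing (braid_rel M ?J) (zero_words M d ?J) (map f z)" if "z \<in> type_A_zero e n" for z
  proof -
    have "map f z \<in> zero_words M d ?J"
    proof -
      consider "z = replicate e 1" | q where "z = [q, q]" "2 \<le> q" "q \<le> n"
        using \<open>z \<in> type_A_zero e n\<close> unfolding type_A_zero_def by blast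
      then show ?thesis
      proof cases
        case 1
        then show ?thesis unfolding Z using d[of 1] n by (auto intro!: exI[of _ "f 1"])
      next
        case 2
        then show ?thesis unfolding Z using d[of q]
          by (intro CollectI exI[of _ "f q"]) (simp add: numeral_2_eq_2)
      qed
    qed
    then show ?thesis using vanishing_factor[of "map f z" _ _ "[]" "[]"] by simp
  qed
  define s0 where "s0 = replicate n (0::nat, 0::nat)"
  have valid0: "valid_state e' (replicate m (0, 0))" for e' m
    by (induction m arbitrary: e') auto
  have word0: "state_word (replicate m (0, 0)) = []" for m
    by (induction m) (auto simp: state_word_top_def)
  have s0: "s0 \<in> states e n" "map f (state_word s0) = []"
    by (simp_all add: s0_def states_def valid0 word0)
  have "bij_betw (\<lambda>s. {v. word_cong (braid_rel M ?J) (map f (state_word s)) v}) (states e n)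
      (nil_Hecke_classes M d ?J)"
  proof (rule bij_betw_nonzero_classes[where w = "\<lambda>s. map f (state_word s)", OF respects s0])
    fix x assume x: "x \<in> states e n"
    have "map g (map f (state_word x)) = state_word x"
      using letters_state_word[of e x] x gf unfolding states_def map_map by (intro map_idI) auto
    then show "run act (map f (state_word x)) s0 = Some x"
      using run[OF s0(1)] run_state_word[of e x] x e by (simp add: s0_def states_def)
    fix i
    have j: "1 \<le> g i" "g i \<le> length x" "map f (state_word x @ [g i]) = map f (state_word x) @ [i]"
      using g[of i] x by (auto simp: states_def)
    note step = state_word_step[OF e j(1,2)]
    show "t \<in> states e n \<and> word_cong (braid_rel M ?J) (map f (state_word x) @ [i]) (map f (state_word t))"
      if "act i x = Some t" for t
    proof -
      have "word_cong (type_A_rel n) (state_word x @ [g i]) (state_word t)" "t \<in> states e n"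
        using step x that by (auto simp: states_def act_def)
      then show ?thesis using word_cong_map[of _ _ f, OF rel_f] j(3) by metis
    qed
    show "vanishing (braid_rel M ?J) (zero_words M d ?J) (map f (state_word x) @ [i])" if "act i x = None"
    proof -
      have "vanishing (type_A_rel n) (type_A_zero e n) (state_word x @ [g i])"
        using step x that by (auto simp: states_def act_def)
      then show ?thesis using vanishing_map[of _ _ f, OF rel_f zero_f] j(3) by metis
    qed
  qed
  then show "finite (nil_Hecke_classes M d ?J)"
    and "card (nil_Hecke_classes M d ?J) = fact n * (1 + n * (e - 1))"
    using finite_states[of e n] card_states[OF n, of e] bij_betw_finite bij_betw_same_card by metis+
qed

section \<open>Counting in dihedral types\<close>

text \<open>
  A state \<open>(c, q)\<close> is the alternating word of length \<open>q\<close> that starts with \<open>c\<close>; both choices of \<open>c\<close>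
  give the empty word for \<open>q = 0\<close>, which is represented by \<open>(a, 0)\<close>.  Of length \<open>m\<close> there is one class,
  represented by \<open>(a, m)\<close>, if the braid relation is imposed, and none if its sides are killed.
\<close>

theorem card_classes_dihedral:
  fixes M :: "'i::finite \<Rightarrow> 'i \<Rightarrow> enat"
  assumes M: "coxeter_matrix M" and d: "\<And>i. d i = 2" and ab: "a \<noteq> b" "UNIV = {a, b}" "M a b = enat m"
  shows "finite (nil_Hecke_classes M d (braid_pairs_less M k))"
    and "card (nil_Hecke_classes M d (braid_pairs_less M k)) = (if enat m < k then 2 * m else 2 * m - 1)"
proof -
  let ?J = "braid_pairs_less M k"
  let ?C = "word_cong (braid_rel M ?J)" and ?V = "vanishing (braid_rel M ?J) (zero_words M d ?J)"
  have "2 \<le> M a b" using M ab(1) by (simp add: coxeter_matrix_def)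
  then have m: "2 \<le> m" using ab(3) by (simp add: numeral_eq_enat)
  have Mxy: "M x y = enat m" if "x \<noteq> y" for x y
    using that ab M by (metis UNIV_I coxeter_matrix_def empty_iff insert_iff)
  have pair: "{x, y} = {a, b}" if "x \<noteq> y" for x y
    using that ab(1,2) by (metis UNIV_I doubleton_eq_iff empty_iff insert_iff)
  have J: "{x, y} \<in> ?J \<longleftrightarrow> enat m < k" if "x \<noteq> y" for x y
  proof
    assume "{x, y} \<in> ?J"
    then obtain x' y' where "x' \<noteq> y'" "M x' y' < k" unfolding braid_pairs_less_def by blast
    then show "enat m < k" using Mxy by simp
  next
    assume "enat m < k"
    then show "{x, y} \<in> ?J"
      unfolding braid_pairs_less_def using that Mxy[OF that]
      by (intro CollectI exI[of _ x] exI[of _ y]) simp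
  qed
  have Jall: "{x, y} \<in> braid_pairs M" if "x \<noteq> y" for x y
    unfolding braid_pairs_def using that Mxy[OF that]
    by (intro CollectI exI[of _ x] exI[of _ y]) simp
  have R: "(alternating x y m, alternating y x m) \<in> braid_rel M ?J" if "x \<noteq> y" "enat m < k" for x y
    unfolding braid_rel_def using that J[of x y] Mxy[of x y]
    by (intro CollectI exI[of _ x] exI[of _ y]) simp
  have Z1: "[i, i] \<in> zero_words M d ?J" for i
    unfolding zero_words_def using d[of i] by (intro UnI1 CollectI exI[of _ i]) (simp add: numeral_2_eq_2)
  have Z2: "alternating x y m \<in> zero_words M d ?J" if "x \<noteq> y" "\<not> enat m < k" for x y
    unfolding zero_words_def using that J[of x y] Jall[of x y] Mxy[of x y]
    by (intro UnI2 CollectI exI[of _ x] exI[of _ y]) simp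
  define oc where "oc x = (if x = a then b else a)" for x
  have oc: "oc x \<noteq> x" "x \<noteq> y \<Longrightarrow> y = oc x" for x y
    using ab(1,2) by (auto simp: oc_def)
  define after where "after c q = (if even q then c else oc c)" for c and q :: nat
  define act where "act i = (\<lambda>(c, q). if q = 0 then Some (i, 1)
      else if i = after c q then (if q + 1 < m then Some (c, q + 1)
        else if q + 1 = m \<and> enat m < k then Some (a, m) else None) else None)" for i
  have act_eq: "act i (c, q) = (if q = 0 then Some (i, 1)
      else if i = after c q then (if q + 1 < m then Some (c, q + 1)
        else if q + 1 = m \<and> enat m < k then Some (a, m) else None) else None)" for i c q
    by (simp add: act_def)
  define states where "states = insert (a, 0) (UNIV \<times> {1..<m}) \<union> (if enat m < k then {(a, m)} else {})"
  define w where "w = (\<lambda>(c, q). alternating c (oc c) q)"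
  have grow: "q' = q + length u \<and> (u \<noteq> [] \<longrightarrow> q' \<le> m \<and> (\<not> enat m < k \<longrightarrow> q' < m))"
    if "run act u (c, q) = Some (c', q')" for u c q c' q'
    using that
  proof (induction u arbitrary: c q)
    case (Cons i u)
    then obtain c1 q1 where 1: "act i (c, q) = Some (c1, q1)" "run act u (c1, q1) = Some (c', q')"
      by (auto split: Option.bind_splits)
    have "q1 = q + 1 \<and> q1 \<le> m \<and> (\<not> enat m < k \<longrightarrow> q1 < m)"
      using 1(1) m by (auto simp: act_eq split: if_splits)
    then show ?case using Cons.IH[OF 1(2)] 1(2) by (cases u) auto
  qed simp
  have climb: "run act (alternating c (oc c) q) (x, 0) =
      (if q < m then Some (c, q) else if q = m \<and> enat m < k then Some (a, m) else None)"
    if "q \<noteq> 0" for c q x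
    using that
  proof (induction q)
    case (Suc q)
    show ?case
    proof (cases "q = 0")
      case True
      then show ?thesis using m by (simp add: act_eq)
    next
      case False
      then show ?thesis
        unfolding alternating_snoc run_append using Suc.IH m by (auto simp: act_eq after_def)
    qed
  qed simp
  have long: "run act u (c, q) = None" if "length u = m" "q \<noteq> 0" for u c q
  proof (rule ccontr)
    assume "run act u (c, q) \<noteq> None"
    then obtain c' q' where "run act u (c, q) = Some (c', q')" by auto
    from grow[OF this] show False using that m by auto
  qed
  have alt_oc: "alternating x y m = alternating x (oc x) m" if "x \<noteq> y" for x y
    using oc(2)[OF that] by simp
  have braid: "run act (alternating x y m) s = run act (alternating y x m) s" if "x \<noteq> y" "enat m < k" for x y s
  proof (cases s)
    case (Pair c q)
    show ?thesis
    proof (cases "q = 0")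
      case True
      then show ?thesis
        unfolding Pair alt_oc[OF that(1)] alt_oc[OF that(1)[symmetric]]
        using climb[of m] m that(2) by simp
    next
      case False
      then show ?thesis unfolding Pair using long by simp
    qed
  qed
  have zero: "run act (alternating x y m) s = None" if "x \<noteq> y" "\<not> enat m < k" for x y s
  proof (cases s)
    case (Pair c q)
    show ?thesis
    proof (cases "q = 0")
      case True
      then show ?thesis unfolding Pair alt_oc[OF that(1)] using climb[of m] m that(2) by simp
    next
      case False
      then show ?thesis unfolding Pair using long by simp
    qed
  qed
  have square: "run act [i, i] s = None" for i s
  proof (cases s)
    case (Pair c q)
    have turn: "after c (Suc q) \<noteq> after c q" for c q
      using oc(1)[of c] oc(1)[of c, symmetric] by (simp add: after_def)
    have "i \<noteq> after i 1" using turn[of i 0] by (simp add: after_def)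
    moreover have "act i (a, m) = None" using m by (simp add: act_eq)
    ultimately show ?thesis
      unfolding Pair using turn[of c q] by (simp add: act_eq)
  qed
  have respects: "respects_relations (braid_rel M ?J) (zero_words M d ?J) act"
  proof -
    have "run act u s = run act v s" if uv: "(u, v) \<in> braid_rel M ?J" for u v s
    proof -
      obtain x y where "u = alternating x y m" "v = alternating y x m" "x \<noteq> y" "enat m < k"
        using uv Mxy J unfolding braid_rel_def by auto
      then show ?thesis using braid by blast
    qed
    moreover have "run act z s = None" if z: "z \<in> zero_words M d ?J" for z s
    proof -
      consider i where "z = [i, i]" | x y where "z = alternating x y m" "x \<noteq> y" "\<not> enat m < k"
        using z Mxy J unfolding zero_words_def by (auto simp: d numeral_2_eq_2)
      then show ?thesis using square zero by cases auto
    qed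
    ultimately show ?thesis unfolding respects_relations_def by (auto simp: fun_eq_iff)
  qed
  have square_zero: "?V (w (c, q) @ [i])" if "q \<noteq> 0" "i \<noteq> after c q" for c q i
  proof -
    have "w (c, q) @ [i] = alternating c (oc c) (q - 1) @ [i, i] @ []"
      using that oc(2)[of "after c q" i] oc(2)[of "oc c" c] oc(1)[of c] alternating_last[OF that(1), of c "oc c"]
      by (auto simp: w_def after_def)
    then show ?thesis using vanishing_factor[OF Z1] by metis
  qed
  have "bij_betw (\<lambda>s. {v. ?C (w s) v}) states (nil_Hecke_classes M d ?J)"
  proof (rule bij_betw_nonzero_classes[OF respects, where ?s0.0 = "(a, 0)"])
    show "(a, 0) \<in> states" by (simp add: states_def)
    show "w (a, 0) = []" by (simp add: w_def)
  next
    fix s assume "s \<in> states"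
    then show "run act (w s) (a, 0) = Some s"
      using climb m by (auto simp: states_def w_def split: if_splits)
  next
    fix i s t assume s: "s \<in> states" and t: "act i s = Some t"
    obtain c q where cq: "s = (c, q)" by (cases s)
    consider "q = 0" "t = (i, 1)" | "q \<noteq> 0" "i = after c q" "q + 1 < m" "t = (c, q + 1)"
      | "q \<noteq> 0" "i = after c q" "q + 1 = m" "enat m < k" "t = (a, m)"
      using t unfolding cq act_eq by (auto split: if_splits)
    then show "t \<in> states \<and> ?C (w s @ [i]) (w t)"
    proof cases
      case 1
      then show ?thesis using m cq by (auto simp: states_def w_def intro: word_cong.refl)
    next
      case 2
      then have "w s @ [i] = w t"
        using alternating_snoc[of c "oc c" q] by (simp add: cq w_def after_def)
      then show ?thesis using 2 by (auto simp: states_def intro: word_cong.refl)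
    next
      case 3
      then have eq: "w s @ [i] = alternating c (oc c) m"
        using alternating_snoc[of c "oc c" q] by (auto simp: cq w_def after_def)
      have "?C (alternating c (oc c) m) (alternating a (oc a) m)"
      proof (cases "c = a")
        case False
        then have "oc c = a" "c = oc a" using oc(2) by metis+
        then show ?thesis using R[of c a] False 3(4) by (auto intro: word_cong.relation)
      qed (simp add: word_cong.refl)
      then show ?thesis using 3 eq by (auto simp: states_def w_def)
    qed
  next
    fix i s assume s: "s \<in> states" and none: "act i s = None"
    obtain c q where cq: "s = (c, q)" by (cases s)
    have q: "q \<noteq> 0" using none by (cases "q = 0") (simp_all add: cq act_eq)
    show "?V (w s @ [i])"
    proof (cases "i = after c q")
      case False
      then show ?thesis using square_zero q cq by simp
    next
      case True
      then have ge: "m \<le> q + 1" "q + 1 = m \<Longrightarrow> \<not> enat m < k" using none q by (auto simp: cq act_eq split: if_splits)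
      show ?thesis
      proof (cases "q + 1 = m")
        case top: True
        then have "w s @ [i] = alternating c (oc c) m"
          using alternating_snoc[of c "oc c" q] True by (auto simp: cq w_def after_def)
        then show ?thesis
          using vanishing_factor[OF Z2[of c "oc c"], of _ "[]" "[]"] ge(2)[OF top] oc(1)[of c] by simp
      next
        case False
        then have "q = m" "enat m < k" "c = a"
          using s ge(1) q by (auto simp: cq states_def split: if_splits)
        have twice: "oc (oc c) = c" using oc(2)[OF oc(1)[of c]] by simp
        have "(alternating c (oc c) q, alternating (oc c) c q) \<in> braid_rel M ?J"
          using R[of c "oc c"] oc(1)[of c] \<open>q = m\<close> \<open>enat m < k\<close> by metis
        then have "?C (w s @ [i]) (w (oc c, q) @ [i])"
          unfolding cq w_def prod.case twice
          by (intro word_cong.append word_cong.refl word_cong.relation)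
        moreover have "i \<noteq> after (oc c) q"
          using oc(1)[of c] twice True by (simp add: after_def split: if_splits)
        then have "?V (w (oc c, q) @ [i])" using square_zero[OF q] by blast
        ultimately show ?thesis using vanishing_cong by blast
      qed
    qed
  qed
  moreover have "finite states" by (simp add: states_def)
  moreover have "card states = (if enat m < k then 2 * m else 2 * m - 1)"
  proof -
    have "card (UNIV :: 'i set) = card {a, b}" by (simp only: ab(2))
    then have "card (UNIV :: 'i set) = 2" using ab(1) by simp
    then have "card (insert (a, 0::nat) (UNIV \<times> {1..<m})) = 2 * m - 1"
      using m by (simp add: card_cartesian_product)
    moreover have "(a, m) \<notin> insert (a, 0) (UNIV \<times> {1..<m})" using m by auto
    ultimately show ?thesis
      using m unfolding states_def by simp
  qed
  ultimately show "finite (nil_Hecke_classes M d ?J)"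
    and "card (nil_Hecke_classes M d ?J) = (if enat m < k then 2 * m else 2 * m - 1)"
    using bij_betw_finite bij_betw_same_card by metis+
qed

section \<open>The classification\<close>

lemma braid_pairs_less_infinity: "braid_pairs_less M \<infinity> = braid_pairs M"
  by (simp add: braid_pairs_less_def braid_pairs_def)

lemma finite_group_iff_finite_classes:
  assumes "coxeter_matrix M" "\<And>i. d i = 2"
  shows "finite (carrier (coxeter_group M)) \<longleftrightarrow> finite (nil_Hecke_classes M d (braid_pairs M))"
    and "card (nil_Hecke_classes M d (braid_pairs M)) = Coset.order (coxeter_group M)"
  using bij_betw_finite[OF classes_bij_coxeter_group[OF assms]]
    bij_betw_same_card[OF classes_bij_coxeter_group[OF assms]]
  by (auto simp: Coset.order_def)

text \<open>
  If some finite bond is at least \<open>k \<ge> 6\<close>, then either there are just two nodes, or a third node is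
  attached to that bond and \<open>infinite_classes_heavy_bond\<close> applies twice: to the given algebra, and to the
  nil-Coxeter algebra with all braid relations, whose nonzero classes are the group elements.
\<close>

lemma long_bond_cases:
  fixes M :: "'i::finite \<Rightarrow> 'i \<Rightarrow> enat"
  assumes M: "coxeter_matrix M" and irr: "coxeter_irreducible M" and k: "6 \<le> k"
    and long: "braid_pairs_less M k \<noteq> braid_pairs M" and d: "\<And>i. 2 \<le> d i"
  obtains m where "type_I2 M m"
  | "infinite (nil_Hecke_classes M d (braid_pairs_less M k))" "infinite (carrier (coxeter_group M))"
proof -
  have "braid_pairs_less M k \<subseteq> braid_pairs M" by (auto simp: braid_pairs_less_def braid_pairs_def)
  then obtain a b where ab: "a \<noteq> b" "M a b < \<infinity>" "{a, b} \<notin> braid_pairs_less M k"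
    using long by (auto simp: braid_pairs_def)
  then have "\<not> M a b < k" unfolding braid_pairs_less_def by blast
  then have M6: "6 \<le> M a b" "6 \<le> M b a"
    using k coxeter_matrix_sym[OF M, of a b] by auto
  show thesis
  proof (cases "UNIV = {a, b}")
    case True
    obtain m where "M a b = enat m" using ab(2) by auto
    then have "type_I2 M m" unfolding type_I2_def using ab(1) True by blast
    then show thesis using that by blast
  next
    case False
    then obtain c where c: "c \<notin> {a, b}" by blast
    have "(\<lambda>x y. x \<noteq> y \<and> 3 \<le> M x y)\<^sup>*\<^sup>* a c"
      using irr by (simp add: coxeter_irreducible_def)
    then have "c \<in> {a, b} \<or> (\<exists>x y. x \<in> {a, b} \<and> y \<notin> {a, b} \<and> 3 \<le> M x y)"
      by (induction rule: rtranclp_induct) auto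
    with c obtain x y where xy: "x \<in> {a, b}" "y \<notin> {a, b}" "3 \<le> M x y" by blast
    define z where "z = (if x = a then b else a)"
    have z: "z \<noteq> x" "x \<noteq> y" "z \<noteq> y" "6 \<le> M z x" using xy ab(1) M6 by (auto simp: z_def)
    have k3: "3 \<le> k" using k by (meson order_trans numeral_le_iff semiring_norm)
    have "infinite (nil_Hecke_classes M d (braid_pairs_less M k))"
      by (rule infinite_classes_heavy_bond[OF M d k3 z xy(3)])
    moreover have "infinite (nil_Hecke_classes M (\<lambda>_. 2) (braid_pairs_less M \<infinity>))"
      by (rule infinite_classes_heavy_bond[OF M _ _ z xy(3)]) auto
    then have "infinite (carrier (coxeter_group M))"
      using finite_group_iff_finite_classes(1)[OF M, of "\<lambda>_. 2"] by (simp add: braid_pairs_less_infinity)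
    ultimately show thesis using that by blast
  qed
qed

lemma finite_group_I2:
  fixes M :: "'i::finite \<Rightarrow> 'i \<Rightarrow> enat"
  assumes M: "coxeter_matrix M" and "type_I2 M m"
  shows "finite (carrier (coxeter_group M))"
proof -
  obtain a b where "a \<noteq> b" "UNIV = {a, b}" "M a b = enat m"
    using assms(2) by (auto simp: type_I2_def)
  then have "finite (nil_Hecke_classes M (\<lambda>_. 2) (braid_pairs_less M \<infinity>))"
    by (rule card_classes_dihedral(1)[OF M HOL.refl])
  then show ?thesis
    using finite_group_iff_finite_classes(1)[OF M, of "\<lambda>_. 2"] by (simp add: braid_pairs_less_infinity)
qed

lemma fin_gen_nil_Hecke_iff:
  assumes "coxeter_matrix M"
  shows "fin_gen_module (ring_of_type_algebra :: 'k::comm_ring_1 ring) (nil_Hecke TYPE('k) M d J0) \<longleftrightarrow>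
      finite (nil_Hecke_classes M d J0)"
    and "finite (nil_Hecke_classes M d J0) \<Longrightarrow>
      free_module_of_rank (ring_of_type_algebra :: 'k ring) (nil_Hecke TYPE('k) M d J0)
        (card (nil_Hecke_classes M d J0))"
proof -
  have eq: "nil_Hecke TYPE('k) M d J0 =
      presented_algebra (monomial_relations (braid_rel M J0) (zero_words M d J0))"
    by (simp add: nil_Hecke_def nil_Hecke_relations_monomial[OF assms])
  show free: "free_module_of_rank (ring_of_type_algebra :: 'k ring) (nil_Hecke TYPE('k) M d J0)
      (card (nil_Hecke_classes M d J0))" if "finite (nil_Hecke_classes M d J0)"
    unfolding eq by (rule free_on_nonzero_classes[OF that]) (simp add: ring_of_type_algebra_simps)
  show "fin_gen_module (ring_of_type_algebra :: 'k ring) (nil_Hecke TYPE('k) M d J0) \<longleftrightarrow>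
      finite (nil_Hecke_classes M d J0)"
    using finitely_generated_imp_finite_classes[of "ring_of_type_algebra :: 'k ring"] free free_imp_fin_gen
    unfolding eq by blast
qed

theorem corollary1p10:
  fixes M :: "'i::finite \<Rightarrow> 'i \<Rightarrow> enat" and d :: "'i \<Rightarrow> nat" and k :: enat
  assumes "coxeter_matrix M" and "coxeter_irreducible M"
    and "\<And>i. 2 \<le> d i"
    and "6 \<le> k"
  shows
    "let W = coxeter_group M;
         K = ring_of_type_algebra;
         H = nil_Hecke TYPE('k::comm_ring_1) M d (braid_pairs_less M k)
     in
       (fin_gen_module K H \<longleftrightarrow>
          (finite (carrier W) \<and> (\<forall>i. d i = 2)) \<or>
          (\<exists>n e. 1 \<le> n \<and> 2 < e \<and> type_A_end_exponent M d n e)) \<and>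
       (finite (carrier W) \<and> (\<forall>i. d i = 2) \<longrightarrow>
          ((\<nexists>m. type_I2 M m) \<longrightarrow> free_module_of_rank K H (Coset.order W)) \<and>
          (\<forall>m. type_I2 M m \<longrightarrow>
             free_module_of_rank K H (if enat m < k then 2 * m else 2 * m - 1))) \<and>
       (\<forall>n e. 1 \<le> n \<and> 2 < e \<and> type_A_end_exponent M d n e \<longrightarrow>
          free_module_of_rank K H (fact n * (1 + n * (e - 1))))"
proof -
  let ?C = "nil_Hecke_classes M d (braid_pairs_less M k)"
  let ?W = "carrier (coxeter_group M)"
  have k: "3 \<le> k" "4 \<le> k" using order_trans[OF _ assms(4)] by simp_all
  note module = fin_gen_nil_Hecke_iff[OF assms(1), where 'k = 'k and d = d and ?J0.0 = "braid_pairs_less M k"]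
  have dihedral: "finite ?C" "card ?C = (if enat m < k then 2 * m else 2 * m - 1)"
    if I2: "type_I2 M m" and d2: "\<forall>i. d i = 2" for m
  proof -
    obtain a b where "a \<noteq> b" "UNIV = {a, b}" "M a b = enat m"
      using I2 by (auto simp: type_I2_def)
    then show "finite ?C" "card ?C = (if enat m < k then 2 * m else 2 * m - 1)"
      using card_classes_dihedral[OF assms(1), of d a b m k] d2 by blast+
  qed
  have type_A: "finite ?C" "card ?C = fact n * (1 + n * (e - 1))"
    if "2 < e" "type_A_end_exponent M d n e" for n e
    using card_classes_type_A[OF _ k(2) that(2)] that(1) by auto
  have same: "finite ?C \<longleftrightarrow> finite ?W" "card ?C = Coset.order (coxeter_group M)"
    if "\<forall>i. d i = 2" "\<nexists>m. type_I2 M m" "finite ?C \<or> finite ?W"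
  proof -
    have "braid_pairs_less M k = braid_pairs M"
    proof (rule ccontr)
      assume long: "braid_pairs_less M k \<noteq> braid_pairs M"
      show False
        by (rule long_bond_cases[where d = d, OF assms(1,2,4) long assms(3)]) (use that(2,3) in simp_all)
    qed
    then show "finite ?C \<longleftrightarrow> finite ?W" "card ?C = Coset.order (coxeter_group M)"
      using finite_group_iff_finite_classes[OF assms(1), of d] that(1) by simp_all
  qed
  have "finite ?C \<longleftrightarrow> finite ?W \<and> (\<forall>i. d i = 2) \<or>
      (\<exists>n e. 1 \<le> n \<and> 2 < e \<and> type_A_end_exponent M d n e)"
  proof
    assume fin: "finite ?C"
    show "finite ?W \<and> (\<forall>i. d i = 2) \<or> (\<exists>n e. 1 \<le> n \<and> 2 < e \<and> type_A_end_exponent M d n e)"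
    proof (cases "\<forall>i. d i = 2")
      case True
      then show ?thesis
        using same(1) fin finite_group_I2[OF assms(1)] by blast
    next
      case False
      then obtain a where "d a \<noteq> 2" by blast
      then have a: "3 \<le> d a" using assms(3)[of a] by linarith
      then show ?thesis
        using finite_classes_imp_type_A[OF assms(1-3) k(1) fin a]
        by (metis Suc_le_eq eval_nat_numeral(3))
    qed
  next
    assume "finite ?W \<and> (\<forall>i. d i = 2) \<or> (\<exists>n e. 1 \<le> n \<and> 2 < e \<and> type_A_end_exponent M d n e)"
    then show "finite ?C"
      using same(1) dihedral(1) type_A(1) by blast
  qed
  moreover have "free_module_of_rank ring_of_type_algebra (nil_Hecke TYPE('k) M d (braid_pairs_less M k))
      (Coset.order (coxeter_group M))" if "finite ?W" "\<forall>i. d i = 2" "\<nexists>m. type_I2 M m"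
    using module(2) same[OF that(2,3)] that(1) by simp
  moreover have "free_module_of_rank ring_of_type_algebra (nil_Hecke TYPE('k) M d (braid_pairs_less M k))
      (if enat m < k then 2 * m else 2 * m - 1)" if "\<forall>i. d i = 2" "type_I2 M m" for m
    using module(2) dihedral[OF that(2,1)] by simp
  moreover have "free_module_of_rank ring_of_type_algebra (nil_Hecke TYPE('k) M d (braid_pairs_less M k))
      (fact n * (1 + n * (e - 1)))" if "2 < e" "type_A_end_exponent M d n e" for n e
    using module(2) type_A[OF that] by simp
  ultimately show ?thesis
    unfolding Let_def module(1) by blast
qed

end
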